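(* Let $(L_n)_{n\ge1}$ be a sequence of integers $L_n\geq 0$ and let $(G,X)$, with $G=\mathbb{R}$, be Rieffel's free transformation group with repetition numbers $(L_n)$ and orbit representatives $x_n$ ($n\ge 0$), as described in the context. Then $$M_L(\operatorname{Ind}\epsilon_{x_0},(\operatorname{Ind}\epsilon_{x_n}))=\liminf_n (L_n+1)\quad\text{and}\quad M_U(\operatorname{Ind}\epsilon_{x_0},(\operatorname{Ind}\epsilon_{x_n}))=\limsup_n (L_n+1),$$ where the sequence $(\operatorname{Ind}\epsilon_{x_n})$ is indexed by $n\geq1$ and both sides may be $\infty$.
   Context: The transformation group. $G=\mathbb{R}$ acts freely on a closed subset $X$ of $\mathbb{R}^3$, which is the union of the following orbits. Let $x_0=(0,0,0)$, with orbit $\{(0,s,0):s\in\mathbb{R}\}$ on which $\mathbb{R}$ acts by translation in $s$. Let $(b_n)_{n\ge1}$ be a strictly decreasing sequence of real numbers converging to $0$ and let $x_n=(b_n,0,0)$ for $n\ge1$. To each $n\ge1$ is assigned an integer $L_n\ge0$. If $L_n=0$, the orbit of $x_n$ is $\{(b_n,s,0):s\in\mathbb{R}\}$ with $\mathbb{R}$ acting by translation in $s$. If $L_n\ge1$, choose $b_{n+1}<b_n^{L_n}<\cdots<b_n^2<b_n^1<b_n^0=b_n$ (superscripts are indices), and the orbit of $x_n$ is given by $$t\cdot x_n=\begin{cases}(b_n,t,0)&\text{if } t\in(-\infty,n];\\ (b_n^{L_n},s,0)&\text{if } s\in(-n,\infty)\text{ and } t=s+L_n(2n+1);\\ (b_n^j,s,0)&\text{if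 } s\in(-n,n],\ t=s+j(2n+1),\ j\in\{1,\dots,L_n-1\};\\ \big((1-s)b_n^j+sb_n^{j+1},\,n\cos(\pi s),\,n\sin(\pi s)\big)&\text{if } s\in(0,1],\ t=s+n+j(2n+1),\ j\in\{0,\dots,L_n-1\}.\end{cases}$$ All orbits are closed in $X$. The $C^*$-algebra and induced representations. $C_0(X)\times G$ is the transformation-group $C^*$-algebra (full crossed product of $C_0(X)$ by the action $\operatorname{lt}_s(f)(x)=f(s^{-1}\cdot x)$). For $x\in X$, with $\epsilon_x:C_0(X)\to\mathbb{C}$ evaluation at $x$, $\operatorname{Ind}\epsilon_x$ is the (irreducible) representation $\tilde\epsilon_x\times\lambda$ of $C_0(X)\times G$ on $L^2(G)$ given by the covariant pair $(\tilde\epsilon_x(f)\xi)(s)=f(s\cdot x)\xi(s)$ and $(\lambda_t\xi)(s)=\xi(s-t)$ ($G=\mathbb{R}$ with Lebesgue measure). Multiplicities. Let $A$ be a $C^*$-algebra with spectrum $\hat A$ and set of pure states $P(A)$. Let $\mathcal N$ be the weak*-neighbourhood base at $0$ in $A^*$ of all sets $\{\psi\in A^*:|\psi(a_i)|<\epsilon,\ 1\le i\le n\}$ ($\epsilon>0$, $a_1,\dots,a_n\in A$). Let $\pi\in\hat A$ and let $\phi$ be a pure state associated with $\pi$. For $\sigma\in\hat A$ (on Hilbert space $H_\sigma$) and $N\in\mathcal N$ let $\mathrm{Vec}(\sigma,\phi,N)=\{\eta\in H_\sigma:\|\eta\|=1,\ \langle\sigma(\cdot)\eta,\eta\rangle\in\phi+N\}$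 and let $d(\sigma,\phi,N)\in\mathbb{N}\cup\{\infty\}$ be the supremum of the cardinalities of finite orthonormal subsets of $\mathrm{Vec}(\sigma,\phi,N)$ ($0$ if it is empty). For a net $\Omega=(\pi_\alpha)$ in $\hat A$, $M_L(\pi,\Omega)=\inf_{N\in\mathcal N}\liminf_\alpha d(\pi_\alpha,\phi,N)$ and $M_U(\pi,\Omega)=\inf_{N\in\mathcal N}\limsup_\alpha d(\pi_\alpha,\phi,N)$; these are independent of the choice of $\phi$. *)

theory Defs
  imports "HOL-Analysis.Analysis" "HOL-Library.Extended_Nat"
begin

section \<open>Complex Hilbert spaces with explicit carrier\<close>

record 'h hspace =
  hcarrier :: "'h set"
  hzero :: 'h
  hadd :: "'h \<Rightarrow> 'h \<Rightarrow> 'h"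
  hscale :: "complex \<Rightarrow> 'h \<Rightarrow> 'h"
  hinner :: "'h \<Rightarrow> 'h \<Rightarrow> complex"

definition hnorm :: "'h hspace \<Rightarrow> 'h \<Rightarrow> real" where
  "hnorm H x = sqrt (Re (hinner H x x))"

definition hdist :: "'h hspace \<Rightarrow> 'h \<Rightarrow> 'h \<Rightarrow> real" where
  "hdist H x y = hnorm H (hadd H x (hscale H (-1) y))"

text \<open>The inner product is linear in its first argument.\<close>

definition hilbert_space :: "'h hspace \<Rightarrow> bool" where
  "hilbert_space H \<longleftrightarrow>
     hzero H \<in> hcarrier H \<and>
     (\<forall>x\<in>hcarrier H. \<forall>y\<in>hcarrier H. hadd H x y \<in> hcarrier H) \<and>
     (\<forall>c. \<forall>x\<in>hcarrier H. hscale H c x \<in> hcarrier H) \<and>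
     (\<forall>x\<in>hcarrier H. \<forall>y\<in>hcarrier H. \<forall>z\<in>hcarrier H.
        hadd H (hadd H x y) z = hadd H x (hadd H y z)) \<and>
     (\<forall>x\<in>hcarrier H. \<forall>y\<in>hcarrier H. hadd H x y = hadd H y x) \<and>
     (\<forall>x\<in>hcarrier H. hadd H (hzero H) x = x) \<and>
     (\<forall>x\<in>hcarrier H. hadd H x (hscale H (-1) x) = hzero H) \<and>
     (\<forall>c. \<forall>x\<in>hcarrier H. \<forall>y\<in>hcarrier H.
        hscale H c (hadd H x y) = hadd H (hscale H c x) (hscale H c y)) \<and>
     (\<forall>c d. \<forall>x\<in>hcarrier H. hscale H (c + d) x = hadd H (hscale H c x) (hscale H d x)) \<and>
     (\<forall>c d. \<forall>x\<in>hcarrier H. hscale H (c * d) x = hscale H c (hscale H d x)) \<and>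
     (\<forall>x\<in>hcarrier H. hscale H 1 x = x) \<and>
     (\<forall>x\<in>hcarrier H. \<forall>y\<in>hcarrier H. hinner H y x = cnj (hinner H x y)) \<and>
     (\<forall>x\<in>hcarrier H. \<forall>y\<in>hcarrier H. \<forall>z\<in>hcarrier H.
        hinner H (hadd H x y) z = hinner H x z + hinner H y z) \<and>
     (\<forall>c. \<forall>x\<in>hcarrier H. \<forall>y\<in>hcarrier H. hinner H (hscale H c x) y = c * hinner H x y) \<and>
     (\<forall>x\<in>hcarrier H. 0 \<le> Re (hinner H x x)) \<and>
     (\<forall>x\<in>hcarrier H. hinner H x x = 0 \<longrightarrow> x = hzero H) \<and>
     (\<forall>u. (\<forall>k::nat. u k \<in> hcarrier H) \<and>
          (\<forall>e>0. \<exists>M. \<forall>m\<ge>M. \<forall>n\<ge>M. hdist H (u m) (u n) < e) \<longrightarrow>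
          (\<exists>x\<in>hcarrier H. (\<lambda>k. hdist H (u k) x) \<longlonglongrightarrow> 0))"

definition bounded_operator :: "'h hspace \<Rightarrow> ('h \<Rightarrow> 'h) \<Rightarrow> bool" where
  "bounded_operator H T \<longleftrightarrow>
     (\<forall>x\<in>hcarrier H. T x \<in> hcarrier H) \<and>
     (\<forall>x\<in>hcarrier H. \<forall>y\<in>hcarrier H. T (hadd H x y) = hadd H (T x) (T y)) \<and>
     (\<forall>c. \<forall>x\<in>hcarrier H. T (hscale H c x) = hscale H c (T x)) \<and>
     (\<exists>C. \<forall>x\<in>hcarrier H. hnorm H (T x) \<le> C * hnorm H x)"

definition orthonormal :: "'h hspace \<Rightarrow> 'h set \<Rightarrow> bool" where
  "orthonormal H E \<longleftrightarrow> (\<forall>x\<in>E. \<forall>y\<in>E. hinner H x y = (if x = y then 1 else 0))"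

subsection \<open>The Hilbert space of square-integrable functions on the real line\<close>

type_synonym l2 = "(real \<Rightarrow> complex) set"

definition square_integrable :: "(real \<Rightarrow> complex) \<Rightarrow> bool" where
  "square_integrable f \<longleftrightarrow>
     f \<in> borel_measurable lborel \<and> integrable lborel (\<lambda>s. (cmod (f s))\<^sup>2)"

definition l2_class :: "(real \<Rightarrow> complex) \<Rightarrow> l2" where
  "l2_class f = {g. square_integrable g \<and> (AE s in lborel. g s = f s)}"

definition l2_fun :: "l2 \<Rightarrow> real \<Rightarrow> complex" where
  "l2_fun \<xi> = (SOME f. f \<in> \<xi>)"

definition L2R :: "l2 hspace" where
  "L2R = \<lparr> hcarrier = l2_class ` {f. square_integrable f},
           hzero = l2_class (\<lambda>s. 0),
           hadd = (\<lambda>\<xi> \<eta>. l2_class (\<lambda>s. l2_fun \<xi> s + l2_fun \<eta> s)),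
           hscale = (\<lambda>c \<xi>. l2_class (\<lambda>s. c * l2_fun \<xi> s)),
           hinner = (\<lambda>\<xi> \<eta>. LINT s|lborel. l2_fun \<xi> s * cnj (l2_fun \<eta> s)) \<rparr>"

section \<open>Normed star-algebras and their representations\<close>

record 'a star_alg =
  acarrier :: "'a set"
  azero :: 'a
  aadd :: "'a \<Rightarrow> 'a \<Rightarrow> 'a"
  ascale :: "complex \<Rightarrow> 'a \<Rightarrow> 'a"
  amult :: "'a \<Rightarrow> 'a \<Rightarrow> 'a"
  astar :: "'a \<Rightarrow> 'a"
  anorm :: "'a \<Rightarrow> real"

definition adist :: "'a star_alg \<Rightarrow> 'a \<Rightarrow> 'a \<Rightarrow> real" where
  "adist A x y = anorm A (aadd A x (ascale A (-1) y))"

definition star_rep :: "'a star_alg \<Rightarrow> 'h hspace \<Rightarrow> ('a \<Rightarrow> 'h \<Rightarrow> 'h) \<Rightarrow> bool" where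
  "star_rep A H \<pi> \<longleftrightarrow>
     (\<forall>a\<in>acarrier A. bounded_operator H (\<pi> a)) \<and>
     (\<forall>a\<in>acarrier A. \<forall>b\<in>acarrier A. \<forall>x\<in>hcarrier H.
        \<pi> (aadd A a b) x = hadd H (\<pi> a x) (\<pi> b x)) \<and>
     (\<forall>c. \<forall>a\<in>acarrier A. \<forall>x\<in>hcarrier H. \<pi> (ascale A c a) x = hscale H c (\<pi> a x)) \<and>
     (\<forall>a\<in>acarrier A. \<forall>b\<in>acarrier A. \<forall>x\<in>hcarrier H. \<pi> (amult A a b) x = \<pi> a (\<pi> b x)) \<and>
     (\<forall>a\<in>acarrier A. \<forall>x\<in>hcarrier H. \<forall>y\<in>hcarrier H.
        hinner H (\<pi> (astar A a) x) y = hinner H x (\<pi> a y))"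

subsection \<open>Completion\<close>

definition cauchy_seq :: "'a star_alg \<Rightarrow> (nat \<Rightarrow> 'a) \<Rightarrow> bool" where
  "cauchy_seq D F \<longleftrightarrow> (\<forall>k. F k \<in> acarrier D) \<and>
     (\<forall>e>0. \<exists>M. \<forall>m\<ge>M. \<forall>n\<ge>M. adist D (F m) (F n) < e)"

definition cauchy_class :: "'a star_alg \<Rightarrow> (nat \<Rightarrow> 'a) \<Rightarrow> (nat \<Rightarrow> 'a) set" where
  "cauchy_class D F = {F'. cauchy_seq D F' \<and> (\<lambda>k. adist D (F k) (F' k)) \<longlonglongrightarrow> 0}"

definition cauchy_repr :: "(nat \<Rightarrow> 'a) set \<Rightarrow> nat \<Rightarrow> 'a" where
  "cauchy_repr a = (SOME F. F \<in> a)"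

definition completion :: "'a star_alg \<Rightarrow> (nat \<Rightarrow> 'a) set star_alg" where
  "completion D =
     \<lparr> acarrier = cauchy_class D ` {F. cauchy_seq D F},
       azero = cauchy_class D (\<lambda>k. azero D),
       aadd = (\<lambda>a b. cauchy_class D (\<lambda>k. aadd D (cauchy_repr a k) (cauchy_repr b k))),
       ascale = (\<lambda>c a. cauchy_class D (\<lambda>k. ascale D c (cauchy_repr a k))),
       amult = (\<lambda>a b. cauchy_class D (\<lambda>k. amult D (cauchy_repr a k) (cauchy_repr b k))),
       astar = (\<lambda>a. cauchy_class D (\<lambda>k. astar D (cauchy_repr a k))),
       anorm = (\<lambda>a. lim (\<lambda>k. anorm D (cauchy_repr a k))) \<rparr>"

subsection \<open>Functionals and pure states\<close>

text \<open>Functionals are only relevant on the carrier of the algebra; they are compared there.\<close>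

definition dual_space :: "'a star_alg \<Rightarrow> ('a \<Rightarrow> complex) set" where
  "dual_space A = {\<psi>.
     (\<forall>a\<in>acarrier A. \<forall>b\<in>acarrier A. \<psi> (aadd A a b) = \<psi> a + \<psi> b) \<and>
     (\<forall>c. \<forall>a\<in>acarrier A. \<psi> (ascale A c a) = c * \<psi> a) \<and>
     (\<exists>C. \<forall>a\<in>acarrier A. cmod (\<psi> a) \<le> C * anorm A a)}"

definition state :: "'a star_alg \<Rightarrow> ('a \<Rightarrow> complex) \<Rightarrow> bool" where
  "state A \<phi> \<longleftrightarrow> \<phi> \<in> dual_space A \<and>
     (\<forall>a\<in>acarrier A. \<phi> (amult A (astar A a) a) \<in> \<real> \<and> 0 \<le> Re (\<phi> (amult A (astar A a) a))) \<and>
     (SUP a\<in>{a \<in> acarrier A. anorm A a \<le> 1}. cmod (\<phi> a)) = 1"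

definition pure_state :: "'a star_alg \<Rightarrow> ('a \<Rightarrow> complex) \<Rightarrow> bool" where
  "pure_state A \<phi> \<longleftrightarrow> state A \<phi> \<and>
     (\<forall>\<psi>1 \<psi>2 t. state A \<psi>1 \<and> state A \<psi>2 \<and> 0 < t \<and> t < (1::real) \<and>
        (\<forall>a\<in>acarrier A. \<phi> a = of_real t * \<psi>1 a + of_real (1 - t) * \<psi>2 a) \<longrightarrow>
        (\<forall>a\<in>acarrier A. \<psi>1 a = \<phi> a \<and> \<psi>2 a = \<phi> a))"

section \<open>Multiplicity numbers\<close>

text \<open>A representation is given together with the Hilbert space on which it acts.\<close>

type_synonym ('a, 'h) repn = "'h hspace \<times> ('a \<Rightarrow> 'h \<Rightarrow> 'h)"

definition vector_functional :: "('a, 'h) repn \<Rightarrow> 'h \<Rightarrow> 'a \<Rightarrow> complex" where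
  "vector_functional \<sigma> \<eta> a = hinner (fst \<sigma>) (snd \<sigma> a \<eta>) \<eta>"

text \<open>For an irreducible representation, the pure states associated with it (those whose GNS
  representation is equivalent to it) are its vector states.\<close>

definition associated_pure_state ::
  "'a star_alg \<Rightarrow> ('a, 'h) repn \<Rightarrow> ('a \<Rightarrow> complex) \<Rightarrow> bool" where
  "associated_pure_state A \<pi> \<phi> \<longleftrightarrow> pure_state A \<phi> \<and>
     (\<exists>\<xi>\<in>hcarrier (fst \<pi>). hnorm (fst \<pi>) \<xi> = 1 \<and>
        (\<forall>a\<in>acarrier A. \<phi> a = vector_functional \<pi> \<xi> a))"

definition weak_star_base :: "'a star_alg \<Rightarrow> ('a \<Rightarrow> complex) set set" where
  "weak_star_base A =
     {{\<psi> \<in> dual_space A. \<forall>a\<in>S. cmod (\<psi> a) < e} | S e. finite S \<and> S \<subseteq> acarrier A \<and> 0 < (e::real)}"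

definition Vec ::
  "('a, 'h) repn \<Rightarrow> ('a \<Rightarrow> complex) \<Rightarrow> ('a \<Rightarrow> complex) set \<Rightarrow> 'h set" where
  "Vec \<sigma> \<phi> N = {\<eta> \<in> hcarrier (fst \<sigma>). hnorm (fst \<sigma>) \<eta> = 1 \<and>
     (\<lambda>a. vector_functional \<sigma> \<eta> a - \<phi> a) \<in> N}"

definition d_mult ::
  "('a, 'h) repn \<Rightarrow> ('a \<Rightarrow> complex) \<Rightarrow> ('a \<Rightarrow> complex) set \<Rightarrow> enat" where
  "d_mult \<sigma> \<phi> N =
     (SUP E\<in>{E. finite E \<and> E \<subseteq> Vec \<sigma> \<phi> N \<and> orthonormal (fst \<sigma>) E}. enat (card E))"

text \<open>Both numbers are written in terms of a pure state \<open>\<phi>\<close> associated with the representation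
  \<open>\<pi>\<close>; they depend only on \<open>\<pi>\<close>. A net is given by a family together with the filter of
  sections of its index set (\<open>sequentially\<close> for a sequence).\<close>

definition M_L ::
  "'a star_alg \<Rightarrow> ('a \<Rightarrow> complex) \<Rightarrow> 'i filter \<Rightarrow> ('i \<Rightarrow> ('a, 'h) repn) \<Rightarrow> enat" where
  "M_L A \<phi> F \<Omega> = (INF N\<in>weak_star_base A. Liminf F (\<lambda>i. d_mult (\<Omega> i) \<phi> N))"

definition M_U ::
  "'a star_alg \<Rightarrow> ('a \<Rightarrow> complex) \<Rightarrow> 'i filter \<Rightarrow> ('i \<Rightarrow> ('a, 'h) repn) \<Rightarrow> enat" where
  "M_U A \<phi> F \<Omega> = (INF N\<in>weak_star_base A. Limsup F (\<lambda>i. d_mult (\<Omega> i) \<phi> N))"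

section \<open>Transformation groups of the real line and their C*-algebras\<close>

definition free_real_action :: "'x::topological_space set \<Rightarrow> (real \<Rightarrow> 'x \<Rightarrow> 'x) \<Rightarrow> bool" where
  "free_real_action X act \<longleftrightarrow>
     (\<forall>t. \<forall>p\<in>X. act t p \<in> X) \<and>
     (\<forall>p\<in>X. act 0 p = p) \<and>
     (\<forall>s t. \<forall>p\<in>X. act (s + t) p = act s (act t p)) \<and>
     continuous_on (UNIV \<times> X) (\<lambda>(t, p). act t p) \<and>
     (\<forall>t. \<forall>p\<in>X. act t p = p \<longrightarrow> t = 0)"

text \<open>Functions on \<open>X\<close> are represented by functions on the ambient type vanishing off \<open>X\<close>.\<close>

definition C0 :: "'x::topological_space set \<Rightarrow> ('x \<Rightarrow> complex) star_alg" where
  "C0 X =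
     \<lparr> acarrier = {g. continuous_on X g \<and> (\<forall>p. p \<notin> X \<longrightarrow> g p = 0) \<and>
         (\<forall>e>0. \<exists>K. compact K \<and> K \<subseteq> X \<and> (\<forall>p\<in>X - K. cmod (g p) < e))},
       azero = (\<lambda>p. 0),
       aadd = (\<lambda>g h p. g p + h p),
       ascale = (\<lambda>c g p. c * g p),
       amult = (\<lambda>g h p. g p * h p),
       astar = (\<lambda>g p. cnj (g p)),
       anorm = (\<lambda>g. SUP p. cmod (g p)) \<rparr>"

definition lt ::
  "'x set \<Rightarrow> (real \<Rightarrow> 'x \<Rightarrow> 'x) \<Rightarrow> real \<Rightarrow> ('x \<Rightarrow> complex) \<Rightarrow> 'x \<Rightarrow> complex" where
  "lt X act s g p = (if p \<in> X then g (act (- s) p) else 0)"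

definition unitary_rep :: "'h hspace \<Rightarrow> (real \<Rightarrow> 'h \<Rightarrow> 'h) \<Rightarrow> bool" where
  "unitary_rep H U \<longleftrightarrow>
     (\<forall>t. bounded_operator H (U t)) \<and>
     (\<forall>t. \<forall>x\<in>hcarrier H. \<forall>y\<in>hcarrier H. hinner H (U t x) (U t y) = hinner H x y) \<and>
     (\<forall>x\<in>hcarrier H. U 0 x = x) \<and>
     (\<forall>s t. \<forall>x\<in>hcarrier H. U (s + t) x = U s (U t x)) \<and>
     (\<forall>x\<in>hcarrier H. \<forall>t. ((\<lambda>s. hdist H (U s x) (U t x)) \<longlongrightarrow> 0) (at t))"

definition covariant_rep ::
  "'x::topological_space set \<Rightarrow> (real \<Rightarrow> 'x \<Rightarrow> 'x) \<Rightarrow> 'h hspace \<Rightarrow>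
   (('x \<Rightarrow> complex) \<Rightarrow> 'h \<Rightarrow> 'h) \<Rightarrow> (real \<Rightarrow> 'h \<Rightarrow> 'h) \<Rightarrow> bool" where
  "covariant_rep X act H \<pi> U \<longleftrightarrow>
     hilbert_space H \<and> star_rep (C0 X) H \<pi> \<and> unitary_rep H U \<and>
     (\<forall>s. \<forall>g\<in>acarrier (C0 X). \<forall>x\<in>hcarrier H.
        \<pi> (lt X act s g) x = U s (\<pi> g (U (- s) x)))"

definition Cc :: "'x::topological_space set \<Rightarrow> (real \<Rightarrow> 'x \<Rightarrow> complex) set" where
  "Cc X = {f. continuous_on (UNIV \<times> X) (\<lambda>(t, p). f t p) \<and>
     (\<exists>K. compact K \<and> K \<subseteq> UNIV \<times> X \<and> (\<forall>t p. (t, p) \<notin> K \<longrightarrow> f t p = 0))}"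

text \<open>The universal norm: the supremum of the operator norms of the integrated forms
  \<open>\<integral> \<pi> (f t) U\<^sub>t dt\<close> over all covariant representations \<open>(\<pi>, U)\<close>, where the operator norm is
  expressed by matrix coefficients over the unit ball. The Hilbert spaces range over all those
  whose underlying set is contained in the type \<open>l2\<close>. This type has at least the cardinality of the
  continuum, so for second countable locally compact \<open>X\<close> no covariant representation is lost:
  the operator norms are determined by cyclic representations, which are separable.\<close>

definition cp_norm ::
  "'x::topological_space set \<Rightarrow> (real \<Rightarrow> 'x \<Rightarrow> 'x) \<Rightarrow> (real \<Rightarrow> 'x \<Rightarrow> complex) \<Rightarrow> real" where
  "cp_norm X act f =
     Sup {cmod (LINT t|lborel. hinner H (\<pi> (f t) (U t \<xi>)) \<eta>) | (H :: l2 hspace) \<pi> U \<xi> \<eta>.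
       covariant_rep X act H \<pi> U \<and> \<xi> \<in> hcarrier H \<and> \<eta> \<in> hcarrier H \<and>
       hnorm H \<xi> \<le> 1 \<and> hnorm H \<eta> \<le> 1}"

definition Cc_alg ::
  "'x::topological_space set \<Rightarrow> (real \<Rightarrow> 'x \<Rightarrow> 'x) \<Rightarrow> (real \<Rightarrow> 'x \<Rightarrow> complex) star_alg" where
  "Cc_alg X act =
     \<lparr> acarrier = Cc X,
       azero = (\<lambda>t p. 0),
       aadd = (\<lambda>f g t p. f t p + g t p),
       ascale = (\<lambda>c f t p. c * f t p),
       amult = (\<lambda>f g t p. LINT r|lborel. f r p * lt X act r (g (t - r)) p),
       astar = (\<lambda>f t p. cnj (lt X act t (f (- t)) p)),
       anorm = cp_norm X act \<rparr>"

definition crossed_product ::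
  "'x::topological_space set \<Rightarrow> (real \<Rightarrow> 'x \<Rightarrow> 'x) \<Rightarrow>
   (nat \<Rightarrow> real \<Rightarrow> 'x \<Rightarrow> complex) set star_alg" where
  "crossed_product X act = completion (Cc_alg X act)"

text \<open>The integrated form of \<open>(\<pi>, U)\<close>: the integral is taken weakly on compactly supported
  functions, and then extended to the completion by continuity.\<close>

definition integrated_Cc ::
  "'h hspace \<Rightarrow> (('x \<Rightarrow> complex) \<Rightarrow> 'h \<Rightarrow> 'h) \<Rightarrow> (real \<Rightarrow> 'h \<Rightarrow> 'h) \<Rightarrow>
   (real \<Rightarrow> 'x \<Rightarrow> complex) \<Rightarrow> 'h \<Rightarrow> 'h" where
  "integrated_Cc H \<pi> U f \<xi> = (THE \<zeta>. \<zeta> \<in> hcarrier H \<and>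
     (\<forall>\<eta>\<in>hcarrier H. hinner H \<zeta> \<eta> = (LINT t|lborel. hinner H (\<pi> (f t) (U t \<xi>)) \<eta>)))"

definition integrated_form ::
  "'h hspace \<Rightarrow> (('x \<Rightarrow> complex) \<Rightarrow> 'h \<Rightarrow> 'h) \<Rightarrow> (real \<Rightarrow> 'h \<Rightarrow> 'h) \<Rightarrow>
   (nat \<Rightarrow> real \<Rightarrow> 'x \<Rightarrow> complex) set \<Rightarrow> 'h \<Rightarrow> 'h" where
  "integrated_form H \<pi> U a \<xi> = (THE \<zeta>. \<zeta> \<in> hcarrier H \<and>
     (\<forall>F\<in>a. (\<lambda>k. hdist H (integrated_Cc H \<pi> U (F k) \<xi>) \<zeta>) \<longlonglongrightarrow> 0))"

definition eps_tilde ::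
  "(real \<Rightarrow> 'x \<Rightarrow> 'x) \<Rightarrow> 'x \<Rightarrow> ('x \<Rightarrow> complex) \<Rightarrow> l2 \<Rightarrow> l2" where
  "eps_tilde act x g \<xi> = l2_class (\<lambda>s. g (act s x) * l2_fun \<xi> s)"

definition left_regular :: "real \<Rightarrow> l2 \<Rightarrow> l2" where
  "left_regular t \<xi> = l2_class (\<lambda>s. l2_fun \<xi> (s - t))"

definition Ind_eps ::
  "(real \<Rightarrow> 'x \<Rightarrow> 'x) \<Rightarrow> 'x \<Rightarrow> ((nat \<Rightarrow> real \<Rightarrow> 'x \<Rightarrow> complex) set, l2) repn" where
  "Ind_eps act x = (L2R, integrated_form L2R (eps_tilde act x) left_regular)"

section \<open>Rieffel's free transformation groups\<close>

text \<open>\<open>b n j\<close> stands for \<open>b\<^sub>n\<^sup>j\<close>, so \<open>b n 0\<close> is \<open>b\<^sub>n\<close>. The values \<open>b 0 j\<close>, \<open>L 0\<close> and \<open>b n j\<close> for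
  \<open>j > L n\<close> are not used.\<close>

definition rieffel_point :: "(nat \<Rightarrow> nat \<Rightarrow> real) \<Rightarrow> nat \<Rightarrow> real ^ 3" where
  "rieffel_point b n = (if n = 0 then 0 else vector [b n 0, 0, 0])"

definition rieffel_group ::
  "(real ^ 3) set \<Rightarrow> (real \<Rightarrow> real ^ 3 \<Rightarrow> real ^ 3) \<Rightarrow> (nat \<Rightarrow> nat \<Rightarrow> real) \<Rightarrow> (nat \<Rightarrow> nat) \<Rightarrow> bool"
  where
  "rieffel_group X act b L \<longleftrightarrow>
     (\<forall>n\<ge>1. b (n + 1) 0 < b n 0) \<and>
     (\<lambda>n. b n 0) \<longlonglongrightarrow> 0 \<and>
     (\<forall>n\<ge>1. L n \<ge> 1 \<longrightarrow> b (n + 1) 0 < b n (L n) \<and> (\<forall>j<L n. b n (j + 1) < b n j)) \<and>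
     closed X \<and>
     X = (\<Union>n. range (\<lambda>t. act t (rieffel_point b n))) \<and>
     free_real_action X act \<and>
     (\<forall>s. act s (rieffel_point b 0) = vector [0, s, 0]) \<and>
     (\<forall>n\<ge>1. L n = 0 \<longrightarrow> (\<forall>s. act s (rieffel_point b n) = vector [b n 0, s, 0])) \<and>
     (\<forall>n\<ge>1. L n \<ge> 1 \<longrightarrow>
        (\<forall>t\<le>real n. act t (rieffel_point b n) = vector [b n 0, t, 0]) \<and>
        (\<forall>s>- real n.
           act (s + real (L n) * (2 * real n + 1)) (rieffel_point b n) = vector [b n (L n), s, 0]) \<and>
        (\<forall>j\<in>{1..<L n}. \<forall>s. - real n < s \<and> s \<le> real n \<longrightarrow>
           act (s + real j * (2 * real n + 1)) (rieffel_point b n) = vector [b n j, s, 0]) \<and>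
        (\<forall>j<L n. \<forall>s. 0 < s \<and> s \<le> 1 \<longrightarrow>
           act (s + real n + real j * (2 * real n + 1)) (rieffel_point b n) =
             vector [(1 - s) * b n j + s * b n (j + 1),
                     real n * cos (pi * s), real n * sin (pi * s)]))"

end

theory Submission
  imports Defs
begin

text \<open>Let \<open>\<phi>\<close> be the vector state of \<open>\<pi>\<^sub>0 = Ind \<epsilon>\<close> at \<open>x\<^sub>0\<close> given by the unit vector \<open>\<xi>\<close>, and let
  \<open>g\<close> be a continuous unit vector supported in \<open>[-R, R]\<close> and close to \<open>\<xi>\<close>. For large \<open>n\<close> the orbit
  of \<open>x\<^sub>n\<close> runs through the part \<open>\<bar>y\<bar> \<le> R\<close> of a neighbourhood of the orbit of \<open>x\<^sub>0\<close> exactly \<open>L\<^sub>n + 1\<close>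
  times, around the times \<open>j (2n + 1)\<close>. The translates of \<open>g\<close> by these times are orthonormal, and
  their vector states under \<open>\<pi>\<^sub>n\<close> converge to that of \<open>g\<close> under \<open>\<pi>\<^sub>0\<close>, uniformly in \<open>j\<close>; this gives
  the lower bounds. Conversely, the function \<open>f(t, (x, y, z)) = \<chi>(x, z) g(y) cnj (g (y - t))\<close> acts
  under \<open>\<pi>\<^sub>0\<close> as the projection onto \<open>g\<close> and, for large \<open>n\<close>, under \<open>\<pi>\<^sub>n\<close> as the projection onto the
  span of the \<open>L\<^sub>n + 1\<close> translates of \<open>g\<close>, so that its trace bounds the number of orthonormal vectors
  whose states are close to \<open>\<phi>\<close>.\<close>

section \<open>Hilbert spaces\<close>

text \<open>Elements of the crossed product are classes of Cauchy sequences, so almost nothing is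
  computed with them directly. Everything is read off the scalars
  \<open>mc x f \<xi> \<eta>\<close>, the matrix coefficients of the induced representation at
  \<open>x\<close> for \<open>f\<close> in \<open>Cc X\<close>. For vectors of norm at most 1 they
  change by no more than the universal norm of the change in \<open>f\<close>, whatever
  \<open>x\<close> is. Hence a finite set of algebra elements can be traded for compactly supported
  functions once, before \<open>n\<close> varies. The projection of the upper bound appears only
  through its quadratic form, a sum of squared inner products that Fubini extracts from the kernel.
  One neighbourhood cannot serve all \<open>n\<close> in the upper bound: summands above 1 - 2 delta
  only give a count of at most (L_n + 1) / (1 - 2 delta), which admits L_n + 2 once L_n is large. So
  delta is fixed by a number \<open>K\<close>, and the estimate is claimed for those
  \<open>n\<close> with \<open>L n + 1 \<le> K\<close>. This suffices: an infinite liminf or limsup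
  needs no upper bound, and a finite one is itself taken as \<open>K\<close>.\<close>

definition hminus :: "'h hspace \<Rightarrow> 'h \<Rightarrow> 'h \<Rightarrow> 'h" where
  "hminus H x y = hadd H x (hscale H (-1) y)"

lemma hdist_eq_hnorm_hminus: "hdist H x y = hnorm H (hminus H x y)"
  by (simp add: hdist_def hminus_def)

locale hilbert =
  fixes H :: "'h hspace"
  assumes hilbert: "hilbert_space H"
begin

abbreviation C where "C \<equiv> hcarrier H"

lemma zero_closed [simp]: "hzero H \<in> C"
  and add_closed [simp]: "x \<in> C \<Longrightarrow> y \<in> C \<Longrightarrow> hadd H x y \<in> C"
  and scale_closed [simp]: "x \<in> C \<Longrightarrow> hscale H c x \<in> C"
  and hadd_assoc: "x \<in> C \<Longrightarrow> y \<in> C \<Longrightarrow> z \<in> C \<Longrightarrow> hadd H (hadd H x y) z = hadd H x (hadd H y z)"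
  and hadd_commute: "x \<in> C \<Longrightarrow> y \<in> C \<Longrightarrow> hadd H x y = hadd H y x"
  and hadd_zero: "x \<in> C \<Longrightarrow> hadd H (hzero H) x = x"
  and hadd_minus: "x \<in> C \<Longrightarrow> hadd H x (hscale H (-1) x) = hzero H"
  and inner_add_left: "x \<in> C \<Longrightarrow> y \<in> C \<Longrightarrow> z \<in> C \<Longrightarrow>
    hinner H (hadd H x y) z = hinner H x z + hinner H y z"
  and inner_scale_left: "x \<in> C \<Longrightarrow> y \<in> C \<Longrightarrow> hinner H (hscale H c x) y = c * hinner H x y"
  and inner_nonneg: "x \<in> C \<Longrightarrow> 0 \<le> Re (hinner H x x)"
  and inner_eq_0: "x \<in> C \<Longrightarrow> hinner H x x = 0 \<Longrightarrow> x = hzero H"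
  using hilbert unfolding hilbert_space_def by meson+

lemma inner_cnj: "x \<in> C \<Longrightarrow> y \<in> C \<Longrightarrow> hinner H y x = cnj (hinner H x y)"
  using hilbert unfolding hilbert_space_def by blast

lemma complete:
  assumes "\<And>k. u k \<in> C" "\<And>e. e > 0 \<Longrightarrow> \<exists>M. \<forall>m\<ge>M. \<forall>n\<ge>M. hdist H (u m) (u n) < e"
  obtains x where "x \<in> C" "(\<lambda>k. hdist H (u k) x) \<longlonglongrightarrow> 0"
proof -
  have "\<exists>x\<in>C. (\<lambda>k. hdist H (u k) x) \<longlonglongrightarrow> 0"
    using hilbert assms unfolding hilbert_space_def by blast
  then show ?thesis using that by blast
qed

lemma hminus_closed [simp]: "x \<in> C \<Longrightarrow> y \<in> C \<Longrightarrow> hminus H x y \<in> C"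
  by (simp add: hminus_def)

lemma inner_add_right: "x \<in> C \<Longrightarrow> y \<in> C \<Longrightarrow> z \<in> C \<Longrightarrow>
    hinner H x (hadd H y z) = hinner H x y + hinner H x z"
  by (metis add_closed complex_cnj_add inner_add_left inner_cnj)

lemma inner_scale_right: "x \<in> C \<Longrightarrow> y \<in> C \<Longrightarrow> hinner H x (hscale H c y) = cnj c * hinner H x y"
  by (metis scale_closed complex_cnj_mult inner_scale_left inner_cnj)

lemma inner_diff_left: "x \<in> C \<Longrightarrow> y \<in> C \<Longrightarrow> z \<in> C \<Longrightarrow>
    hinner H (hminus H x y) z = hinner H x z - hinner H y z"
  by (simp add: hminus_def inner_add_left inner_scale_left)

lemma inner_diff_right: "x \<in> C \<Longrightarrow> y \<in> C \<Longrightarrow> z \<in> C \<Longrightarrow>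
    hinner H x (hminus H y z) = hinner H x y - hinner H x z"
  by (simp add: hminus_def inner_add_right inner_scale_right)

lemma inner_self: "x \<in> C \<Longrightarrow> hinner H x x = of_real ((hnorm H x)\<^sup>2)"
  using inner_cnj[of x x] inner_nonneg[of x]
  by (simp add: hnorm_def complex_eq_iff)

lemma hnorm_nonneg [simp]: "x \<in> C \<Longrightarrow> 0 \<le> hnorm H x"
  by (simp add: hnorm_def inner_nonneg)

lemma hnorm_scale: assumes "x \<in> C" shows "hnorm H (hscale H c x) = cmod c * hnorm H x"
proof -
  have "of_real ((hnorm H (hscale H c x))\<^sup>2) = (of_real ((cmod c * hnorm H x)\<^sup>2) :: complex)"
    using assms inner_self[of "hscale H c x"] inner_self[of x] complex_norm_square[of c]
    by (simp add: inner_scale_left inner_scale_right power_mult_distrib mult.assoc mult.left_commute)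
  then have "(hnorm H (hscale H c x))\<^sup>2 = (cmod c * hnorm H x)\<^sup>2"
    using of_real_eq_iff by blast
  then show ?thesis using assms by (simp add: power2_eq_iff_nonneg)
qed

lemma hnorm_zero_iff: "x \<in> C \<Longrightarrow> hnorm H x = 0 \<longleftrightarrow> x = hzero H"
  using inner_eq_0[of x] hadd_zero[of "hzero H"] inner_add_left[of "hzero H" "hzero H" "hzero H"]
  by (auto simp: inner_self)

lemma hminus_eq_zero: assumes "x \<in> C" "y \<in> C" "hminus H x y = hzero H" shows "x = y"
proof -
  have "y = hadd H (hminus H x y) y" using assms by (simp add: hadd_zero)
  also have "\<dots> = hadd H x (hadd H (hscale H (-1) y) y)"
    using assms(1,2) by (simp add: hminus_def hadd_assoc)
  also have "hadd H (hscale H (-1) y) y = hzero H"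
    using assms by (metis hadd_commute hadd_minus scale_closed)
  also have "hadd H x (hzero H) = x" using assms by (metis hadd_commute hadd_zero zero_closed)
  finally show ?thesis by simp
qed

lemma hdist_zero: "x \<in> C \<Longrightarrow> y \<in> C \<Longrightarrow> hdist H x y = 0 \<longleftrightarrow> x = y"
  using hminus_eq_zero[of x y] hadd_minus[of x]
  by (auto simp: hdist_eq_hnorm_hminus hnorm_zero_iff) (simp add: hminus_def)

lemma inner_ext: assumes "x \<in> C" "y \<in> C" "\<And>z. z \<in> C \<Longrightarrow> hinner H x z = hinner H y z"
  shows "x = y"
  by (rule hminus_eq_zero[OF assms(1,2)], rule inner_eq_0) (simp_all add: assms inner_diff_left)

lemma Cauchy_Schwarz: assumes x: "x \<in> C" and y: "y \<in> C"
  shows "cmod (hinner H x y) \<le> hnorm H x * hnorm H y"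
proof -
  define w where "w = hinner H x y"
  have yx: "hinner H y x = cnj w" using inner_cnj[OF x y] by (simp add: w_def)
  have ww: "w * cnj w = of_real ((cmod w)\<^sup>2)" using complex_norm_square[of w] by simp
  \<comment> \<open>Positivity of the squared norm of x - r w y. The factor w = <x, y> turns the
    cross terms into the real number 2 r |w|^2, so a real parameter r suffices.\<close>
  have *: "0 \<le> (hnorm H x)\<^sup>2 - 2 * r * (cmod w)\<^sup>2 + r\<^sup>2 * (cmod w)\<^sup>2 * (hnorm H y)\<^sup>2" for r
  proof -
    let ?v = "hminus H x (hscale H (of_real r * w) y)"
    have "hinner H ?v ?v = of_real ((hnorm H x)\<^sup>2) - 2 * of_real r * (w * cnj w)
        + (of_real r)\<^sup>2 * (w * cnj w) * of_real ((hnorm H y)\<^sup>2)"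
      using x y inner_self[OF x] inner_self[OF y]
      by (simp add: inner_diff_left inner_diff_right inner_scale_left inner_scale_right
          yx w_def[symmetric] algebra_simps power2_eq_square)
    also have "\<dots> = of_real ((hnorm H x)\<^sup>2 - 2 * r * (cmod w)\<^sup>2 + r\<^sup>2 * (cmod w)\<^sup>2 * (hnorm H y)\<^sup>2)"
      by (simp add: ww)
    finally show ?thesis using inner_nonneg[of ?v] x y by simp
  qed
  have "(cmod w)\<^sup>2 \<le> (hnorm H x)\<^sup>2 * (hnorm H y)\<^sup>2"
  proof (cases "hnorm H y = 0")
    case True
    have "cmod w = 0"
    proof (rule ccontr)
      assume "cmod w \<noteq> 0"
      \<comment> \<open>If y has norm 0, the inequality says 2 r |w|^2 <= norm(x)^2 for every r;
        this r makes the left side 2 (norm(x)^2 + 1).\<close>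
      then show False
        using *[of "((hnorm H x)\<^sup>2 + 1) / (cmod w)\<^sup>2"] True
        by simp (smt (verit) zero_le_power2)
    qed
    then show ?thesis by simp
  next
    case False
    define b where "b = (hnorm H y)\<^sup>2"
    have b: "b > 0" using False by (simp add: b_def)
    have "0 \<le> (hnorm H x)\<^sup>2 - 2 * (1 / b) * (cmod w)\<^sup>2 + (1 / b)\<^sup>2 * (cmod w)\<^sup>2 * b"
      using *[of "1 / b"] by (simp add: b_def)
    also have "\<dots> = (hnorm H x)\<^sup>2 - (cmod w)\<^sup>2 / b"
      using b by (simp add: power2_eq_square)
    finally have "(cmod w)\<^sup>2 / b \<le> (hnorm H x)\<^sup>2" by simp
    then show ?thesis using b by (simp add: pos_divide_le_eq flip: b_def)
  qed
  then show ?thesis using x y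
    by (intro power2_le_imp_le[of "cmod (hinner H x y)"]) (auto simp: w_def power_mult_distrib)
qed

lemma hnorm_add: assumes x: "x \<in> C" and y: "y \<in> C"
  shows "hnorm H (hadd H x y) \<le> hnorm H x + hnorm H y"
proof -
  have "hinner H (hadd H x y) (hadd H x y) =
      of_real ((hnorm H x)\<^sup>2 + (hnorm H y)\<^sup>2) + (hinner H x y + cnj (hinner H x y))"
    using x y inner_self[OF x] inner_self[OF y] inner_cnj[OF x y]
    by (simp add: inner_add_left inner_add_right)
  then have "Re (hinner H (hadd H x y) (hadd H x y)) =
      (hnorm H x)\<^sup>2 + (hnorm H y)\<^sup>2 + 2 * Re (hinner H x y)" by simp
  then have "(hnorm H (hadd H x y))\<^sup>2 = (hnorm H x)\<^sup>2 + (hnorm H y)\<^sup>2 + 2 * Re (hinner H x y)"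
    using inner_self[of "hadd H x y"] x y by simp
  also have "\<dots> \<le> (hnorm H x + hnorm H y)\<^sup>2"
    using Cauchy_Schwarz[OF x y] complex_Re_le_cmod[of "hinner H x y"] by (simp add: power2_sum)
  finally show ?thesis by (rule power2_le_imp_le) (use x y in simp)
qed

lemma hdist_nonneg [simp]: "x \<in> C \<Longrightarrow> y \<in> C \<Longrightarrow> 0 \<le> hdist H x y"
  by (simp add: hdist_eq_hnorm_hminus)

lemma hdist_commute: assumes "x \<in> C" "y \<in> C" shows "hdist H x y = hdist H y x"
proof -
  have "hminus H x y = hscale H (-1) (hminus H y x)"
    by (rule inner_ext) (simp_all add: assms inner_diff_left inner_scale_left)
  then have "hnorm H (hminus H x y) = hnorm H (hscale H (-1) (hminus H y x))" by (rule arg_cong)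
  also have "\<dots> = hnorm H (hminus H y x)" using hnorm_scale[of "hminus H y x" "-1"] assms by simp
  finally show ?thesis by (simp only: hdist_eq_hnorm_hminus)
qed

lemma hdist_triangle: assumes "x \<in> C" "y \<in> C" "z \<in> C"
  shows "hdist H x z \<le> hdist H x y + hdist H y z"
proof -
  have "hminus H x z = hadd H (hminus H x y) (hminus H y z)"
    by (rule inner_ext) (simp_all add: assms inner_diff_left inner_add_left)
  then show ?thesis using assms hnorm_add[of "hminus H x y" "hminus H y z"]
    by (simp add: hdist_eq_hnorm_hminus)
qed

lemma hnorm_triangle_hdist: assumes "x \<in> C" "y \<in> C"
  shows "hnorm H x \<le> hdist H x y + hnorm H y"
proof -
  have *: "hadd H (hminus H x y) y = x"
    by (rule inner_ext) (simp_all add: assms inner_diff_left inner_add_left)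
  show ?thesis using hnorm_add[of "hminus H x y" y] assms
    unfolding * hdist_eq_hnorm_hminus by simp
qed

lemma inner_diff_bound: assumes "x \<in> C" "y \<in> C" "x' \<in> C" "y' \<in> C"
  shows "cmod (hinner H x y - hinner H x' y') \<le> hdist H x x' * hnorm H y + hnorm H x' * hdist H y y'"
proof -
  have "hinner H x y - hinner H x' y' = hinner H (hminus H x x') y + hinner H x' (hminus H y y')"
    using assms by (simp add: inner_diff_left inner_diff_right)
  then have "cmod (hinner H x y - hinner H x' y') \<le> cmod (hinner H (hminus H x x') y)
      + cmod (hinner H x' (hminus H y y'))"
    by (metis norm_triangle_ineq)
  also have "\<dots> \<le> hdist H x x' * hnorm H y + hnorm H x' * hdist H y y'"
    using assms by (intro add_mono) (auto simp: hdist_eq_hnorm_hminus intro!: Cauchy_Schwarz)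
  finally show ?thesis .
qed

lemma Bessel: assumes E: "finite E" "E \<subseteq> C" "orthonormal H E" and x: "x \<in> C"
  shows "(\<Sum>e\<in>E. (cmod (hinner H x e))\<^sup>2) \<le> (hnorm H x)\<^sup>2"
proof -
  \<comment> \<open>\<open>v\<close> is x minus its projection onto the span of \<open>E\<close>.
    The second condition, that x - v is orthogonal to everything orthogonal to \<open>E\<close>,
    stands in for membership of x - v in the span and avoids finite sums of vectors in
    \<open>H\<close>.\<close>
  have "\<exists>v\<in>C. (\<forall>e\<in>E. hinner H v e = 0) \<and> (\<forall>z\<in>C. (\<forall>e\<in>E. hinner H z e = 0) \<longrightarrow> hinner H z v = hinner H z x) \<and>
     (hnorm H v)\<^sup>2 = (hnorm H x)\<^sup>2 - (\<Sum>e\<in>E. (cmod (hinner H x e))\<^sup>2)"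
    using E
  proof (induction E rule: finite_induct)
    case empty
    then show ?case using x by auto
  next
    case (insert f E)
    then have "orthonormal H E" by (simp add: orthonormal_def)
    with insert obtain v where v: "v \<in> C" "\<And>e. e \<in> E \<Longrightarrow> hinner H v e = 0"
      "\<And>z. z \<in> C \<Longrightarrow> (\<forall>e\<in>E. hinner H z e = 0) \<Longrightarrow> hinner H z v = hinner H z x"
      "(hnorm H v)\<^sup>2 = (hnorm H x)\<^sup>2 - (\<Sum>e\<in>E. (cmod (hinner H x e))\<^sup>2)" by auto
    have f: "f \<in> C" "hinner H f f = 1" "\<And>e. e \<in> E \<Longrightarrow> hinner H f e = 0"
      "\<And>e. e \<in> E \<Longrightarrow> hinner H e f = 0" and EC: "E \<subseteq> C"
      using insert.prems insert.hyps by (auto simp: orthonormal_def)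
    have fv: "hinner H f v = hinner H f x" using v(3)[of f] f by auto
    have vf: "hinner H v f = hinner H x f"
      using fv inner_cnj[OF f(1) v(1)] inner_cnj[OF f(1) x] by simp
    define w where "w = hinner H x f"
    let ?v = "hminus H v (hscale H w f)"
    have "hinner H ?v ?v = of_real ((hnorm H v)\<^sup>2) - w * cnj w"
      using f(1,2) v(1) inner_self[OF v(1)] vf fv inner_cnj[OF x f(1)]
      by (simp add: inner_diff_left inner_diff_right inner_scale_left inner_scale_right flip: w_def)
    then have "of_real ((hnorm H ?v)\<^sup>2) = (of_real ((hnorm H v)\<^sup>2 - (cmod w)\<^sup>2) :: complex)"
      using inner_self[of ?v] f(1) v(1) complex_norm_square[of w] by simp
    then have "(hnorm H ?v)\<^sup>2 = (hnorm H v)\<^sup>2 - (cmod w)\<^sup>2" using of_real_eq_iff by blast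
    then have "(hnorm H ?v)\<^sup>2 = (hnorm H x)\<^sup>2 - (\<Sum>e\<in>insert f E. (cmod (hinner H x e))\<^sup>2)"
      using insert.hyps v(4) by (simp add: w_def)
    moreover have "\<forall>e\<in>insert f E. hinner H ?v e = 0"
      using EC f v by (auto simp: inner_diff_left inner_scale_left subset_iff w_def vf)
    moreover have "\<forall>z\<in>C. (\<forall>e\<in>insert f E. hinner H z e = 0) \<longrightarrow> hinner H z ?v = hinner H z x"
      using f v by (auto simp: inner_diff_right inner_scale_right)
    moreover have "?v \<in> C" using f v by simp
    ultimately show ?case by blast
  qed
  then show ?thesis by (metis diff_ge_0_iff_ge zero_le_power2)
qed

end

section \<open>The space of square-integrable functions\<close>

lemma square_integrable_measurable [measurable_dest]:
  "square_integrable f \<Longrightarrow> f \<in> borel_measurable borel"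
  by (simp add: square_integrable_def)

lemma borel_measurable_cnj [measurable (raw)]:
  "f \<in> borel_measurable M \<Longrightarrow> (\<lambda>x. cnj (f x)) \<in> borel_measurable M"
  by (rule borel_measurable_continuous_on[OF continuous_on_cnj[OF continuous_on_id]])

lemma square_integrable_zero [simp]: "square_integrable (\<lambda>s. 0)"
  by (simp add: square_integrable_def)

lemma square_integrable_dominated:
  assumes [measurable]: "f \<in> borel_measurable borel" and g: "integrable lborel g"
    and "AE s in lborel. (cmod (f s))\<^sup>2 \<le> g s"
  shows "square_integrable f"
proof -
  have "integrable lborel (\<lambda>s. (cmod (f s))\<^sup>2)"
    by (rule Bochner_Integration.integrable_bound[OF g]) (use assms(3) in auto)
  then show ?thesis by (simp add: square_integrable_def)
qed

lemma square_integrable_bounded_mult: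
  assumes g: "square_integrable g" and [measurable]: "h \<in> borel_measurable borel"
    and h: "\<And>s. cmod (h s) \<le> c"
  shows "square_integrable (\<lambda>s. h s * g s)"
proof (rule square_integrable_dominated[where g = "\<lambda>s. c\<^sup>2 * (cmod (g s))\<^sup>2"])
  show "(\<lambda>s. h s * g s) \<in> borel_measurable borel" using g by measurable
  show "integrable lborel (\<lambda>s. c\<^sup>2 * (cmod (g s))\<^sup>2)"
    using g by (simp add: square_integrable_def)
  show "AE s in lborel. (cmod (h s * g s))\<^sup>2 \<le> c\<^sup>2 * (cmod (g s))\<^sup>2"
    using h by (auto simp: norm_mult power_mult_distrib intro!: mult_right_mono power_mono)
qed

lemma square_integrable_scale [simp]: "square_integrable f \<Longrightarrow> square_integrable (\<lambda>s. c * f s)"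
  by (rule square_integrable_bounded_mult[where c = "cmod c"]) auto

lemma square_integrable_add [simp]:
  assumes "square_integrable f" "square_integrable g"
  shows "square_integrable (\<lambda>s. f s + g s)"
proof (rule square_integrable_dominated[where g = "\<lambda>s. 2 * (cmod (f s))\<^sup>2 + 2 * (cmod (g s))\<^sup>2"])
  show "(\<lambda>s. f s + g s) \<in> borel_measurable borel" using assms by measurable
  show "integrable lborel (\<lambda>s. 2 * (cmod (f s))\<^sup>2 + 2 * (cmod (g s))\<^sup>2)"
    using assms by (simp add: square_integrable_def)
  have "(cmod (f s + g s))\<^sup>2 \<le> 2 * (cmod (f s))\<^sup>2 + 2 * (cmod (g s))\<^sup>2" for s
  proof -
    have "(cmod (f s + g s))\<^sup>2 \<le> (cmod (f s) + cmod (g s))\<^sup>2"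
      by (intro power_mono norm_triangle_ineq) auto
    also have "\<dots> \<le> 2 * (cmod (f s))\<^sup>2 + 2 * (cmod (g s))\<^sup>2"
      using zero_le_power2[of "cmod (f s) - cmod (g s)"] unfolding power2_sum power2_diff by linarith
    finally show ?thesis .
  qed
  then show "AE s in lborel. (cmod (f s + g s))\<^sup>2 \<le> 2 * (cmod (f s))\<^sup>2 + 2 * (cmod (g s))\<^sup>2"
    by simp
qed

lemma square_integrable_diff [simp]:
  "square_integrable f \<Longrightarrow> square_integrable g \<Longrightarrow> square_integrable (\<lambda>s. f s - g s)"
  using square_integrable_add[OF _ square_integrable_scale[of g "-1"], of f] by simp

lemma square_integrable_uminus [simp]: "square_integrable f \<Longrightarrow> square_integrable (\<lambda>s. - f s)"
  using square_integrable_scale[of f "-1"] by simp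

lemma square_integrable_shift [simp]:
  assumes "square_integrable f" shows "square_integrable (\<lambda>s. f (s - t))"
proof -
  have "integrable lborel (\<lambda>s. (cmod (f s))\<^sup>2)" using assms by (simp add: square_integrable_def)
  from lborel_integrable_real_affine[OF this, of 1 "-t"]
  have "integrable lborel (\<lambda>s. (cmod (f (s - t)))\<^sup>2)" by simp
  moreover have "(\<lambda>s. f (s - t)) \<in> borel_measurable borel"
    using square_integrable_measurable[OF assms] by (rule measurable_compose[rotated]) simp
  ultimately show ?thesis by (simp add: square_integrable_def)
qed

lemma lborel_integral_shift:
  fixes f :: "real \<Rightarrow> 'a :: {banach, second_countable_topology}"
  shows "(LINT s|lborel. f (s - t)) = (LINT s|lborel. f s)"
  using lborel_integral_real_affine[of 1 f "-t"] by simp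

lemma integrable_mult_cnj [simp]:
  assumes "square_integrable f" "square_integrable g"
  shows "integrable lborel (\<lambda>s. f s * cnj (g s))"
proof (rule Bochner_Integration.integrable_bound)
  show "integrable lborel (\<lambda>s. (cmod (f s))\<^sup>2 + (cmod (g s))\<^sup>2)"
    using assms by (simp add: square_integrable_def)
  show "(\<lambda>s. f s * cnj (g s)) \<in> borel_measurable lborel" using assms by measurable
  have "cmod (f s) * cmod (g s) \<le> (cmod (f s))\<^sup>2 + (cmod (g s))\<^sup>2" for s
    using sum_squares_bound[of "cmod (f s)" "cmod (g s)"]
      mult_nonneg_nonneg[OF norm_ge_zero norm_ge_zero, of "f s" "g s"] unfolding mult.assoc by linarith
  then show "AE s in lborel. norm (f s * cnj (g s)) \<le> norm ((cmod (f s))\<^sup>2 + (cmod (g s))\<^sup>2)"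
    by (simp add: norm_mult)
qed

lemma continuous_compact_support_bounded:
  fixes f :: "real \<Rightarrow> complex"
  assumes f: "continuous_on UNIV f" and supp: "\<And>s. r < \<bar>s\<bar> \<Longrightarrow> f s = 0"
  obtains c where "0 \<le> c" "\<And>s. cmod (f s) \<le> c"
proof -
  have "continuous_on {-r..r} f" using f continuous_on_subset by blast
  then have "bounded (f ` {-r..r})" by (intro compact_imp_bounded compact_continuous_image) auto
  then obtain c where c: "\<And>s. s \<in> {-r..r} \<Longrightarrow> cmod (f s) \<le> c"
    unfolding bounded_iff by blast
  have "cmod (f s) \<le> max 0 c" for s
    using c[of s] supp[of s] by (cases "\<bar>s\<bar> \<le> r") (auto simp: le_max_iff_disj abs_le_iff)
  then show ?thesis using that[of "max 0 c"] by simp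
qed

lemma integrable_indicator_Icc: "integrable lborel (\<lambda>s. c * indicator {a..b::real} s :: real)"
  by (intro integrable_mult_right integrable_real_indicator) (auto simp: emeasure_lborel_Icc_eq)

lemma square_integrable_continuous_compact_support:
  assumes f: "continuous_on UNIV f" and supp: "\<And>s. r < \<bar>s\<bar> \<Longrightarrow> f s = 0"
  shows "square_integrable f"
proof -
  obtain c where c: "0 \<le> c" "\<And>s. cmod (f s) \<le> c" using continuous_compact_support_bounded[OF assms] by blast
  have "(cmod (f s))\<^sup>2 \<le> c\<^sup>2 * indicator {-r..r} s" for s
    using c(2)[of s] supp[of s] by (auto simp: indicator_def intro!: power_mono)
  then show ?thesis
    using borel_measurable_continuous_onI[OF f] integrable_indicator_Icc
    by (intro square_integrable_dominated[where g = "\<lambda>s. c\<^sup>2 * indicator {-r..r} s"]) auto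
qed

section \<open>Classes of square-integrable functions and the operations on them\<close>

lemma l2_class_cong: "AE s in lborel. f s = g s \<Longrightarrow> l2_class f = l2_class g"
  unfolding l2_class_def by (auto elim!: eventually_elim2)

text \<open>The representative picked by \<open>l2_fun\<close> is an arbitrary member of the class.
  These two facts let it be replaced by any chosen function up to a null set in the formulas for
  \<open>L2R\<close> below.\<close>

lemma
  assumes "square_integrable f"
  shows square_integrable_l2_fun: "square_integrable (l2_fun (l2_class f))"
    and l2_fun_class: "AE s in lborel. l2_fun (l2_class f) s = f s"
proof -
  have "f \<in> l2_class f" using assms by (simp add: l2_class_def)
  then have "l2_fun (l2_class f) \<in> l2_class f"
    unfolding l2_fun_def by (rule someI[of "\<lambda>g. g \<in> l2_class f"])
  then show "square_integrable (l2_fun (l2_class f))" "AE s in lborel. l2_fun (l2_class f) s = f s"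
    by (auto simp: l2_class_def)
qed

lemma hcarrier_L2R: "hcarrier L2R = l2_class ` {f. square_integrable f}"
  by (simp add: L2R_def)

lemma l2_class_closed [simp]: "square_integrable f \<Longrightarrow> l2_class f \<in> hcarrier L2R"
  by (simp add: hcarrier_L2R)

lemma hcarrier_L2R_cases:
  assumes "\<xi> \<in> hcarrier L2R" obtains f where "square_integrable f" "\<xi> = l2_class f"
  using assms by (auto simp: hcarrier_L2R)

lemma hzero_L2R: "hzero L2R = l2_class (\<lambda>s. 0)"
  by (simp add: L2R_def)

lemma hadd_L2R:
  assumes "square_integrable f" "square_integrable g"
  shows "hadd L2R (l2_class f) (l2_class g) = l2_class (\<lambda>s. f s + g s)"
  using l2_fun_class[OF assms(1)] l2_fun_class[OF assms(2)]
  by (auto simp: L2R_def intro!: l2_class_cong elim!: eventually_elim2)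

lemma hscale_L2R:
  assumes "square_integrable f"
  shows "hscale L2R c (l2_class f) = l2_class (\<lambda>s. c * f s)"
  using l2_fun_class[OF assms(1)]
  by (auto simp: L2R_def intro!: l2_class_cong elim!: eventually_mono)

lemma hminus_L2R:
  assumes "square_integrable f" "square_integrable g"
  shows "hminus L2R (l2_class f) (l2_class g) = l2_class (\<lambda>s. f s - g s)"
  using assms hadd_L2R[of f "\<lambda>s. -1 * g s"]
  by (simp add: hminus_def hscale_L2R square_integrable_scale[of g "-1", simplified])

lemma hinner_L2R:
  assumes "square_integrable f" "square_integrable g"
  shows "hinner L2R (l2_class f) (l2_class g) = (LINT s|lborel. f s * cnj (g s))"
proof -
  note [measurable] = assms[THEN square_integrable_l2_fun] assms
  show ?thesis
    unfolding L2R_def hspace.simps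
    by (rule integral_cong_AE, measurable)
      (use l2_fun_class[OF assms(1)] l2_fun_class[OF assms(2)] in \<open>auto elim!: eventually_elim2\<close>)
qed

lemma hnorm_L2R:
  assumes "square_integrable f"
  shows "hnorm L2R (l2_class f) = sqrt (LINT s|lborel. (cmod (f s))\<^sup>2)"
proof -
  have "(LINT s|lborel. f s * cnj (f s)) = (LINT s|lborel. of_real ((cmod (f s))\<^sup>2))"
    by (simp only: complex_norm_square)
  also have "\<dots> = of_real (LINT s|lborel. (cmod (f s))\<^sup>2)"
    by (rule integral_complex_of_real)
  finally show ?thesis using assms by (simp add: hnorm_def hinner_L2R)
qed

lemma hdist_L2R:
  assumes "square_integrable f" "square_integrable g"
  shows "hdist L2R (l2_class f) (l2_class g) = sqrt (LINT s|lborel. (cmod (f s - g s))\<^sup>2)"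
  using assms by (simp add: hdist_eq_hnorm_hminus hminus_L2R hnorm_L2R)

lemma eps_tilde_l2_class:
  assumes "square_integrable f"
  shows "eps_tilde act x g (l2_class f) = l2_class (\<lambda>s. g (act s x) * f s)"
  unfolding eps_tilde_def
  by (rule l2_class_cong) (use l2_fun_class[OF assms] in \<open>auto elim!: eventually_mono\<close>)

lemma left_regular_l2_class:
  assumes "square_integrable f"
  shows "left_regular t (l2_class f) = l2_class (\<lambda>s. f (s - t))"
proof -
  note [measurable] = assms assms[THEN square_integrable_l2_fun]
  \<comment> \<open>Translation preserves null sets, so the arbitrary representative still agrees
    almost everywhere after the shift. The form \<open>- t + 1 * s\<close> is that of an affine
    substitution with slope 1.\<close>
  have "AE s in lborel. l2_fun (l2_class f) (- t + 1 * s) = f (- t + 1 * s)"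
    by (rule AE_borel_affine[OF _ _ l2_fun_class[OF assms]]) (simp, measurable)
  then show ?thesis
    unfolding left_regular_def by (intro l2_class_cong) (auto elim!: eventually_mono)
qed

subsection \<open>Completeness\<close>

lemma nn_integral_eq_hdist_L2R:
  assumes "square_integrable f" "square_integrable g"
  shows "(\<integral>\<^sup>+s. ennreal ((cmod (f s - g s))\<^sup>2) \<partial>lborel) = ennreal ((hdist L2R (l2_class f) (l2_class g))\<^sup>2)"
proof -
  have "integrable lborel (\<lambda>s. (cmod (f s - g s))\<^sup>2)"
    using square_integrable_diff[OF assms] by (simp add: square_integrable_def)
  then show ?thesis using assms
    by (subst nn_integral_eq_integral) (auto simp: hdist_L2R)
qed

text \<open>The inequality of arithmetic and geometric means, with weight w = 2^(k/2), gives 2 |d_k|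
  <= 2^k |d_k|^2 + 2^(-k), and both terms on the right are summable. It turns bounds on integrals of
  squares into pointwise convergence.\<close>

lemma summable_of_weighted_squares:
  fixes d :: "nat \<Rightarrow> complex"
  assumes "(\<Sum>k. ennreal (2 ^ k * (cmod (d k))\<^sup>2)) < \<infinity>"
  shows "summable d"
proof -
  have "summable (\<lambda>k. 2 ^ k * (cmod (d k))\<^sup>2)"
    by (rule summable_suminf_not_top) (use assms in auto)
  moreover have "summable (\<lambda>k. (1 / 2 :: real) ^ k)" by simp
  ultimately have "summable (\<lambda>k. 2 ^ k * (cmod (d k))\<^sup>2 + (1 / 2) ^ k)" by (rule summable_add)
  then show ?thesis
  proof (rule summable_comparison_test[rotated], intro exI[of _ 0] allI impI)
    fix k :: nat
    define a where "a = cmod (d k)"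
    define w :: real where "w = sqrt (2 ^ k)"
    have w: "w\<^sup>2 = 2 ^ k" "w > 0" by (auto simp: w_def)
    have "2 * ((w * a) * (1 / w)) \<le> (w * a)\<^sup>2 + (1 / w)\<^sup>2"
      using sum_squares_bound[of "w * a" "1 / w"] by (simp only: mult.assoc)
    then have "2 * a \<le> 2 ^ k * a\<^sup>2 + (1 / 2) ^ k"
      using w by (simp add: power_mult_distrib power_divide less_imp_neq[OF w(2), symmetric])
    moreover have "0 \<le> a" by (simp add: a_def)
    ultimately have "a \<le> 2 ^ k * a\<^sup>2 + (1 / 2) ^ k" by linarith
    then show "cmod (d k) \<le> 2 ^ k * (cmod (d k))\<^sup>2 + (1 / 2) ^ k" by (simp add: a_def)
  qed
qed

text \<open>Riesz-Fischer. Along a subsequence with successive distances below 2^(-k), the weighted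
  squares 2^k |d_k|^2 have integrals at most 2^(-k); so the differences are absolutely summable
  almost everywhere, and Fatou's lemma transfers the Cauchy estimates to the pointwise
  limit.\<close>

lemma L2R_complete:
  assumes f: "\<And>k. square_integrable (f k)"
    and Cauchy: "\<And>e. e > 0 \<Longrightarrow> \<exists>M. \<forall>m\<ge>M. \<forall>n\<ge>M. hdist L2R (l2_class (f m)) (l2_class (f n)) < e"
  shows "\<exists>g. square_integrable g \<and> (\<lambda>k. hdist L2R (l2_class (f k)) (l2_class g)) \<longlonglongrightarrow> 0"
proof -
  note [measurable] = f
  let ?D = "\<lambda>m n. hdist L2R (l2_class (f m)) (l2_class (f n))"
  have Dnn: "0 \<le> ?D m n" for m n using f by (simp add: hdist_L2R)
  have "\<exists>M. \<forall>m\<ge>M. \<forall>n\<ge>M. ?D m n < (1 / 2) ^ k" for k using Cauchy[of "(1 / 2) ^ k"] by simp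
  then obtain M where M: "\<And>k m n. m \<ge> M k \<Longrightarrow> n \<ge> M k \<Longrightarrow> ?D m n < (1 / 2) ^ k" by metis
  \<comment> \<open>Partial sums dominate each \<open>M i\<close>, so both \<open>r k\<close> and
    \<open>r (Suc k)\<close> lie beyond \<open>M k\<close>; the extra \<open>k\<close> makes
    \<open>r k\<close> tend to infinity, which the Fatou step below uses.\<close>
  define r where "r k = (\<Sum>i\<le>k. M i) + k" for k
  have rM: "M k \<le> r k" "M k \<le> r (Suc k)" for k
    using member_le_sum[of k "{..k}" M] by (auto simp: r_def)
  have rk: "k \<le> r k" for k by (simp add: r_def)
  define d where "d k s = f (r (Suc k)) s - f (r k) s" for k s
  have [measurable]: "d k \<in> borel_measurable borel" for k unfolding d_def by measurable
  have "(\<integral>\<^sup>+s. (\<Sum>k. ennreal (2 ^ k * (cmod (d k s))\<^sup>2)) \<partial>lborel) =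
      (\<Sum>k. (\<integral>\<^sup>+s. ennreal (2 ^ k * (cmod (d k s))\<^sup>2) \<partial>lborel))"
    by (rule nn_integral_suminf) measurable
  also have "\<dots> \<le> (\<Sum>k. ennreal ((1 / 2) ^ k))"
  proof (intro suminf_le allI summableI)
    fix k
    have "(\<integral>\<^sup>+s. ennreal (2 ^ k * (cmod (d k s))\<^sup>2) \<partial>lborel)
        = ennreal (2 ^ k) * (\<integral>\<^sup>+s. ennreal ((cmod (d k s))\<^sup>2) \<partial>lborel)"
      by (simp add: ennreal_mult nn_integral_cmult)
    also have "\<dots> = ennreal (2 ^ k * (?D (r (Suc k)) (r k))\<^sup>2)"
      unfolding d_def using f by (simp add: nn_integral_eq_hdist_L2R ennreal_mult)
    also have "\<dots> \<le> ennreal (2 ^ k * ((1 / 2) ^ k)\<^sup>2)"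
      using M[of k "r (Suc k)" "r k"] rM Dnn
      by (intro ennreal_leI mult_left_mono power_mono) (auto intro: less_imp_le)
    also have "2 ^ k * ((1 / 2) ^ k)\<^sup>2 = ((1 / 2) ^ k :: real)"
      by (simp add: power2_eq_square power_divide)
    finally show "(\<integral>\<^sup>+s. ennreal (2 ^ k * (cmod (d k s))\<^sup>2) \<partial>lborel) \<le> ennreal ((1 / 2) ^ k)" .
  qed
  also have "\<dots> = ennreal (\<Sum>k. (1 / 2) ^ k)"
    by (rule suminf_ennreal2) auto
  finally have "(\<integral>\<^sup>+s. (\<Sum>k. ennreal (2 ^ k * (cmod (d k s))\<^sup>2)) \<partial>lborel) \<noteq> \<infinity>"
    by (auto simp: top_unique)
  then have "AE s in lborel. (\<Sum>k. ennreal (2 ^ k * (cmod (d k s))\<^sup>2)) \<noteq> \<infinity>"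
    by (intro nn_integral_noteq_infinite) measurable
  then have AEconv: "AE s in lborel. convergent (\<lambda>k. f (r k) s)"
  proof (rule eventually_mono)
    fix s assume "(\<Sum>k. ennreal (2 ^ k * (cmod (d k s))\<^sup>2)) \<noteq> \<infinity>"
    then have "summable (\<lambda>k. d k s)"
      by (intro summable_of_weighted_squares) (simp add: less_top)
    then have "(\<lambda>n. \<Sum>k<n. d k s) \<longlonglongrightarrow> (\<Sum>k. d k s)" by (rule summable_LIMSEQ)
    moreover have "(\<Sum>k<n. d k s) = f (r n) s - f (r 0) s" for n
      unfolding d_def by (rule sum_lessThan_telescope)
    ultimately have "(\<lambda>n. f (r n) s - f (r 0) s + f (r 0) s) \<longlonglongrightarrow> (\<Sum>k. d k s) + f (r 0) s"
      by (intro tendsto_add) auto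
    then show "convergent (\<lambda>k. f (r k) s)" by (auto simp: convergent_def)
  qed
  define g where "g s = lim (\<lambda>k. f (r k) s)" for s
  have [measurable]: "g \<in> borel_measurable borel" unfolding g_def by measurable
  have AElim: "AE s in lborel. (\<lambda>k. f (r k) s) \<longlonglongrightarrow> g s"
    using AEconv by (auto simp: g_def convergent_LIMSEQ_iff)
  \<comment> \<open>Fatou's lemma with \<open>f m\<close> fixed and the subsequence as the moving
    term. It is used twice: with e = 1 to see that \<open>g\<close> is square integrable, then with
    small e for convergence of the whole sequence.\<close>
  have bound: "(\<integral>\<^sup>+s. ennreal ((cmod (f m s - g s))\<^sup>2) \<partial>lborel) \<le> ennreal (e\<^sup>2)"
    if e: "e > 0" and mM: "\<And>m' n. m' \<ge> K \<Longrightarrow> n \<ge> K \<Longrightarrow> ?D m' n < e" and mK: "m \<ge> K" for m K e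
  proof -
    have "(\<integral>\<^sup>+s. ennreal ((cmod (f m s - g s))\<^sup>2) \<partial>lborel)
       = (\<integral>\<^sup>+s. liminf (\<lambda>k. ennreal ((cmod (f m s - f (r k) s))\<^sup>2)) \<partial>lborel)"
    proof (rule nn_integral_cong_AE, use AElim in eventually_elim)
      case (elim s)
      have "(\<lambda>k. ennreal ((cmod (f m s - f (r k) s))\<^sup>2)) \<longlonglongrightarrow> ennreal ((cmod (f m s - g s))\<^sup>2)"
        using elim by (intro tendsto_ennrealI tendsto_intros)
      then show ?case by (intro lim_imp_Liminf[symmetric]) simp_all
    qed
    also have "\<dots> \<le> liminf (\<lambda>k. (\<integral>\<^sup>+s. ennreal ((cmod (f m s - f (r k) s))\<^sup>2) \<partial>lborel))"
      by (rule nn_integral_liminf) measurable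
    also have "\<dots> \<le> limsup (\<lambda>k. (\<integral>\<^sup>+s. ennreal ((cmod (f m s - f (r k) s))\<^sup>2) \<partial>lborel))"
      by (rule Liminf_le_Limsup) simp
    also have "\<dots> \<le> ennreal (e\<^sup>2)"
    proof (rule Limsup_bounded, rule eventually_sequentiallyI[of K])
      fix k assume "K \<le> k"
      then have "r k \<ge> K" using rk[of k] by simp
      then have "?D m (r k) \<le> e" using mM[of m "r k"] mK by simp
      then show "(\<integral>\<^sup>+s. ennreal ((cmod (f m s - f (r k) s))\<^sup>2) \<partial>lborel) \<le> ennreal (e\<^sup>2)"
        using f Dnn by (simp add: nn_integral_eq_hdist_L2R power_mono)
    qed
    finally show ?thesis .
  qed
  have g: "square_integrable g"
  proof -
    obtain K where K: "\<And>m n. m \<ge> K \<Longrightarrow> n \<ge> K \<Longrightarrow> ?D m n < 1" using Cauchy[of 1] by auto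
    have "(\<integral>\<^sup>+s. ennreal (norm ((cmod (f K s - g s))\<^sup>2)) \<partial>lborel) < \<infinity>"
      using bound[of 1 K K] K by (auto simp: le_less_trans)
    then have "integrable lborel (\<lambda>s. (cmod (f K s - g s))\<^sup>2)"
      unfolding integrable_iff_bounded by auto
    then have "square_integrable (\<lambda>s. f K s - g s)" by (simp add: square_integrable_def)
    from square_integrable_diff[OF f[of K] this] show ?thesis by simp
  qed
  have "(\<lambda>k. hdist L2R (l2_class (f k)) (l2_class g)) \<longlonglongrightarrow> 0"
  proof (rule LIMSEQ_I)
    fix e :: real assume "e > 0"
    then obtain K where K: "\<And>m n. m \<ge> K \<Longrightarrow> n \<ge> K \<Longrightarrow> ?D m n < e / 2"
      using Cauchy[of "e / 2"] by auto
    have "norm (hdist L2R (l2_class (f m)) (l2_class g) - 0) < e" if "m \<ge> K" for m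
    proof -
      have "ennreal ((hdist L2R (l2_class (f m)) (l2_class g))\<^sup>2) \<le> ennreal ((e / 2)\<^sup>2)"
        using bound[of "e / 2" K m] K that \<open>e > 0\<close> f g by (simp flip: nn_integral_eq_hdist_L2R)
      then have "(hdist L2R (l2_class (f m)) (l2_class g))\<^sup>2 \<le> (e / 2)\<^sup>2" by simp
      then have "hdist L2R (l2_class (f m)) (l2_class g) \<le> e / 2"
        using \<open>e > 0\<close> power2_le_imp_le[of _ "e / 2"] by simp
      moreover have "0 \<le> hdist L2R (l2_class (f m)) (l2_class g)"
        using f g by (simp add: hdist_L2R)
      ultimately show ?thesis using \<open>e > 0\<close> by simp
    qed
    then show "\<exists>K. \<forall>m\<ge>K. norm (hdist L2R (l2_class (f m)) (l2_class g) - 0) < e" by blast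
  qed
  with g show ?thesis by blast
qed

lemma hilbert_space_L2R: "hilbert_space L2R"
proof -
  have zero: "x = hzero L2R" if x: "x \<in> hcarrier L2R" and "hinner L2R x x = 0" for x
  proof -
    obtain f where f: "square_integrable f" "x = l2_class f" using x by (auto simp: hcarrier_L2R)
    then have "hnorm L2R x = 0" using that by (simp add: hnorm_def)
    then have "(LINT s|lborel. (cmod (f s))\<^sup>2) = 0" using f by (simp add: hnorm_L2R)
    moreover have "integrable lborel (\<lambda>s. (cmod (f s))\<^sup>2)"
      using f by (simp add: square_integrable_def)
    ultimately have "AE s in lborel. (cmod (f s))\<^sup>2 = 0"
      by (subst (asm) integral_nonneg_eq_0_iff_AE) auto
    then show ?thesis unfolding f hzero_L2R by (intro l2_class_cong) auto
  qed
  have nonneg: "0 \<le> Re (hinner L2R x x)" if x: "x \<in> hcarrier L2R" for x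
  proof -
    obtain f where f: "square_integrable f" "x = l2_class f" using x by (auto simp: hcarrier_L2R)
    have "hnorm L2R x \<ge> 0" using f by (simp add: hnorm_L2R)
    then show ?thesis by (simp add: hnorm_def)
  qed
  have complete: "\<exists>x\<in>hcarrier L2R. (\<lambda>k. hdist L2R (u k) x) \<longlonglongrightarrow> 0"
    if u: "\<forall>k. u k \<in> hcarrier L2R"
      and Cauchy: "\<forall>e>0. \<exists>M. \<forall>m\<ge>M. \<forall>n\<ge>M. hdist L2R (u m) (u n) < e" for u :: "nat \<Rightarrow> l2"
  proof -
    have "\<forall>k. \<exists>f. square_integrable f \<and> u k = l2_class f" using u by (auto simp: hcarrier_L2R)
    then obtain f where f: "\<And>k. square_integrable (f k)" "\<And>k. u k = l2_class (f k)" by metis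
    show ?thesis using L2R_complete[of f] f Cauchy by auto
  qed
  show ?thesis
    unfolding hilbert_space_def
  proof (intro conjI ballI allI impI)
    fix x y assume "x \<in> hcarrier L2R" "y \<in> hcarrier L2R"
    then obtain f g where "square_integrable f" "square_integrable g"
      and [simp]: "x = l2_class f" "y = l2_class g"
      by (auto simp: hcarrier_L2R)
    then show "hinner L2R y x = cnj (hinner L2R x y)"
      using Bochner_Integration.integral_cnj[of lborel "\<lambda>s. f s * cnj (g s)"] by (simp add: hinner_L2R mult.commute)
  qed (use zero nonneg complete in \<open>auto elim!: hcarrier_L2R_cases
     simp: hzero_L2R hadd_L2R hscale_L2R hinner_L2R algebra_simps\<close>)
qed

interpretation L2R: hilbert L2R
  by unfold_locales (rule hilbert_space_L2R)

subsection \<open>Density of continuous functions with compact support\<close>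

text \<open>Measurability in the sense of \<open>measurable_on\<close> supplies continuous functions
  converging almost everywhere but without any control. Truncating their values and their support
  makes dominated convergence applicable without changing the limit.\<close>

lemma bounded_support_L2_approx:
  fixes f :: "real \<Rightarrow> complex"
  assumes [measurable]: "f \<in> borel_measurable borel" and c: "c > 0" "\<And>s. cmod (f s) \<le> c"
    and supp: "\<And>s. r < \<bar>s\<bar> \<Longrightarrow> f s = 0" and e: "e > 0"
  obtains g where "continuous_on UNIV g" "\<And>s. r + 1 < \<bar>s\<bar> \<Longrightarrow> g s = 0"
    "(LINT s|lborel. (cmod (f s - g s))\<^sup>2) < e"
proof -
  have "f \<in> borel_measurable lebesgue" by (intro measurable_completion) simp
  then have "f measurable_on UNIV" by (rule lebesgue_measurable_imp_measurable_on) simp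
  then obtain N G where N: "negligible N" and G: "\<And>k. continuous_on UNIV (G k)"
    and lim: "\<And>s. s \<notin> N \<Longrightarrow> (\<lambda>k. G k s) \<longlonglongrightarrow> f s"
    unfolding measurable_on_def by auto
  have "N \<in> null_sets lebesgue" using N negligible_iff_null_sets by blast
  then have "AE s in lebesgue. s \<notin> N" by (rule AE_not_in)
  then have AEN: "AE s in lborel. s \<notin> N" by (simp add: AE_completion_iff)
  define cut :: "real \<Rightarrow> real" where "cut s = max 0 (min 1 (r + 1 - \<bar>s\<bar>))" for s
  \<comment> \<open>Division by \<open>max 1 (cmod (G k s) / c)\<close> is the radial retraction
    onto the disc of radius c, continuous because the denominator is at least 1. The factor
    \<open>cut\<close> is 1 where |s| <= r and 0 where |s| >= r + 1. Both leave the limit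
    \<open>f\<close> unchanged.\<close>
  define h where "h k s = of_real (cut s / max 1 (cmod (G k s) / c)) * G k s" for k s
  have cont: "continuous_on UNIV (h k)" for k
    unfolding h_def cut_def using c(1) G by (intro continuous_intros) auto
  have [measurable]: "h k \<in> borel_measurable borel" for k
    by (rule borel_measurable_continuous_onI[OF cont])
  have hz: "h k s = 0" if "r + 1 < \<bar>s\<bar>" for k s
    using that by (simp add: h_def cut_def)
  have hb: "cmod (h k s) \<le> c" for k s
  proof -
    have "cmod (h k s) = cut s * (cmod (G k s) / max 1 (cmod (G k s) / c))"
      by (simp add: h_def norm_mult norm_divide cut_def)
    also have "\<dots> \<le> 1 * c"
    proof (rule mult_mono)
      have "cmod (G k s) / c \<le> max 1 (cmod (G k s) / c)" by simp
      then have "cmod (G k s) \<le> c * max 1 (cmod (G k s) / c)"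
        using c(1) by (simp only: pos_divide_le_eq mult.commute)
      then show "cmod (G k s) / max 1 (cmod (G k s) / c) \<le> c"
        by (subst pos_divide_le_eq) auto
    qed (use c(1) in \<open>auto simp: cut_def\<close>)
    finally show ?thesis by simp
  qed
  have hlim: "(\<lambda>k. h k s) \<longlonglongrightarrow> f s" if "s \<notin> N" for s
  proof -
    have "(\<lambda>k. h k s) \<longlonglongrightarrow> of_real (cut s / max 1 (cmod (f s) / c)) * f s"
      unfolding h_def using lim[OF that] c(1) by (intro tendsto_intros) auto
    also have "max 1 (cmod (f s) / c) = 1" using c(1) c(2)[of s] by (intro max_absorb1) (simp add: divide_le_eq)
    also have "of_real (cut s / 1) * f s = f s"
      using supp[of s] by (cases "\<bar>s\<bar> \<le> r") (auto simp: cut_def)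
    finally show ?thesis .
  qed
  have "(\<lambda>k. LINT s|lborel. (cmod (f s - h k s))\<^sup>2) \<longlonglongrightarrow> (LINT s|(lborel::real measure). 0)"
  proof (rule integral_dominated_convergence)
    show "integrable lborel (\<lambda>s. (2 * c)\<^sup>2 * indicator {-(r + 1)..r + 1} s :: real)"
      by (rule integrable_indicator_Icc)
    show "AE s in lborel. (\<lambda>k. (cmod (f s - h k s))\<^sup>2) \<longlonglongrightarrow> 0"
      using AEN
    proof eventually_elim
      case (elim s)
      have "(\<lambda>k. (cmod (f s - h k s))\<^sup>2) \<longlonglongrightarrow> (cmod (f s - f s))\<^sup>2"
        by (intro tendsto_intros hlim elim)
      then show ?case by simp
    qed
    show "AE s in lborel. norm ((cmod (f s - h k s))\<^sup>2) \<le> (2 * c)\<^sup>2 * indicator {-(r + 1)..r + 1} s" for k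
    proof (rule AE_I2)
      fix s
      have "cmod (f s - h k s) \<le> 2 * c"
        using norm_triangle_ineq4[of "f s" "h k s"] c(2)[of s] hb[of k s] by linarith
      then have "(cmod (f s - h k s))\<^sup>2 \<le> (2 * c)\<^sup>2" by (intro power_mono) auto
      then show "norm ((cmod (f s - h k s))\<^sup>2) \<le> (2 * c)\<^sup>2 * indicator {-(r + 1)..r + 1} s"
        using supp[of s] hz[of s k] by (cases "\<bar>s\<bar> \<le> r + 1") (auto simp: indicator_def)
    qed
  qed simp_all
  then have "\<forall>\<^sub>F k in sequentially. (LINT s|lborel. (cmod (f s - h k s))\<^sup>2) < e"
    using e by (intro order_tendstoD(2)) auto
  then obtain k where "(LINT s|lborel. (cmod (f s - h k s))\<^sup>2) < e"
    by (auto simp: eventually_sequentially)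
  then show ?thesis using that[of "h k"] cont hz by blast
qed

text \<open>Truncating \<open>f\<close> both in its argument and in its values reduces to the
  bounded, boundedly supported case; each of the two approximations is allowed e / 2.\<close>

lemma L2R_dense:
  assumes \<xi>: "\<xi> \<in> hcarrier L2R" and e: "e > 0"
  obtains g r where "continuous_on UNIV g" "\<And>s. r < \<bar>s\<bar> \<Longrightarrow> g s = 0"
    "hdist L2R \<xi> (l2_class g) < e"
proof -
  obtain f where f: "square_integrable f" "\<xi> = l2_class f" using \<xi> by (rule hcarrier_L2R_cases)
  note [measurable] = f(1)
  define F where "F n s = (if \<bar>s\<bar> \<le> real n \<and> cmod (f s) \<le> real n then f s else 0)" for n :: nat and s
  have [measurable]: "F n \<in> borel_measurable borel" for n unfolding F_def by measurable
  have "(\<lambda>n. LINT s|lborel. (cmod (f s - F n s))\<^sup>2) \<longlonglongrightarrow> (LINT s|(lborel::real measure). 0)"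
  proof (rule integral_dominated_convergence)
    show "integrable lborel (\<lambda>s. (cmod (f s))\<^sup>2)" using f by (simp add: square_integrable_def)
    show "AE s in lborel. (\<lambda>n. (cmod (f s - F n s))\<^sup>2) \<longlonglongrightarrow> 0"
    proof (rule AE_I2, rule tendsto_eventually, rule eventually_sequentiallyI)
      fix s n assume "nat \<lceil>max \<bar>s\<bar> (cmod (f s))\<rceil> \<le> n"
      then have "\<bar>s\<bar> \<le> real n" "cmod (f s) \<le> real n" by linarith+
      then show "(cmod (f s - F n s))\<^sup>2 = 0" by (simp add: F_def)
    qed
    show "AE s in lborel. norm ((cmod (f s - F n s))\<^sup>2) \<le> (cmod (f s))\<^sup>2" for n
      by (auto simp: F_def)
  qed simp_all
  then have "\<forall>\<^sub>F n in sequentially. (LINT s|lborel. (cmod (f s - F n s))\<^sup>2) < (e / 2)\<^sup>2"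
    using e by (intro order_tendstoD(2)) auto
  \<comment> \<open>The index \<open>n\<close> also serves as the bound on the values in the
    approximation below, where that bound has to be positive.\<close>
  then have "\<forall>\<^sub>F n in sequentially. (LINT s|lborel. (cmod (f s - F n s))\<^sup>2) < (e / 2)\<^sup>2 \<and> 0 < n"
    by (intro eventually_conj eventually_gt_at_top)
  then obtain n where n: "(LINT s|lborel. (cmod (f s - F n s))\<^sup>2) < (e / 2)\<^sup>2" "0 < n"
    by (auto simp: eventually_sequentially)
  obtain g where g: "continuous_on UNIV g" "\<And>s. real n + 1 < \<bar>s\<bar> \<Longrightarrow> g s = 0"
    "(LINT s|lborel. (cmod (F n s - g s))\<^sup>2) < (e / 2)\<^sup>2"
    by (rule bounded_support_L2_approx[of "F n" "real n" "real n" "(e / 2)\<^sup>2"])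
      (use n(2) e in \<open>auto simp: F_def\<close>)
  have sg: "square_integrable g"
    by (rule square_integrable_continuous_compact_support[OF g(1,2)])
  have sF: "square_integrable (F n)"
    by (rule square_integrable_dominated[where g = "\<lambda>s. (cmod (f s))\<^sup>2"])
      (use f in \<open>auto simp: F_def square_integrable_def\<close>)
  have "hdist L2R \<xi> (l2_class g) \<le> hdist L2R \<xi> (l2_class (F n)) + hdist L2R (l2_class (F n)) (l2_class g)"
    using \<xi> sg sF by (intro L2R.hdist_triangle) auto
  also have "\<dots> < e / 2 + e / 2"
  proof (rule add_strict_mono)
    show "hdist L2R \<xi> (l2_class (F n)) < e / 2"
      unfolding f(2) hdist_L2R[OF f(1) sF] using n e by (intro real_less_lsqrt) auto
    show "hdist L2R (l2_class (F n)) (l2_class g) < e / 2"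
      unfolding hdist_L2R[OF sF sg] using g(3) e by (intro real_less_lsqrt) auto
  qed
  finally show ?thesis using that g by auto
qed

subsection \<open>The regular representation\<close>

lemma left_regular_closed [simp]: "\<xi> \<in> hcarrier L2R \<Longrightarrow> left_regular t \<xi> \<in> hcarrier L2R"
  by (auto elim!: hcarrier_L2R_cases simp: left_regular_l2_class)

lemma inner_left_regular:
  assumes "\<xi> \<in> hcarrier L2R" "\<eta> \<in> hcarrier L2R"
  shows "hinner L2R (left_regular t \<xi>) (left_regular t \<eta>) = hinner L2R \<xi> \<eta>"
  using assms
  by (auto elim!: hcarrier_L2R_cases simp: left_regular_l2_class hinner_L2R
      lborel_integral_shift[where f = "\<lambda>s. f s * cnj (g s)" for f g])

lemma left_regular_add:
  assumes "\<xi> \<in> hcarrier L2R" "\<eta> \<in> hcarrier L2R"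
  shows "left_regular t (hadd L2R \<xi> \<eta>) = hadd L2R (left_regular t \<xi>) (left_regular t \<eta>)"
  using assms by (auto elim!: hcarrier_L2R_cases simp: left_regular_l2_class hadd_L2R)

lemma left_regular_scale:
  assumes "\<xi> \<in> hcarrier L2R"
  shows "left_regular t (hscale L2R c \<xi>) = hscale L2R c (left_regular t \<xi>)"
  using assms by (auto elim!: hcarrier_L2R_cases simp: left_regular_l2_class hscale_L2R)

lemma hdist_left_regular:
  assumes "\<xi> \<in> hcarrier L2R" "\<eta> \<in> hcarrier L2R"
  shows "hdist L2R (left_regular t \<xi>) (left_regular t \<eta>) = hdist L2R \<xi> \<eta>"
  using assms inner_left_regular[of "hminus L2R \<xi> \<eta>" "hminus L2R \<xi> \<eta>" t]
  by (simp add: hdist_eq_hnorm_hminus hminus_def left_regular_add left_regular_scale hnorm_def)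

text \<open>A convergent sequence of shifts is bounded, so all translates of \<open>g\<close> live
  in one interval [-R, R], where a constant dominates; pointwise convergence is continuity of
  \<open>g\<close>.\<close>

lemma left_regular_continuous_Cc:
  assumes g: "continuous_on UNIV g" "\<And>s. r < \<bar>s\<bar> \<Longrightarrow> g s = 0"
  shows "((\<lambda>s. hdist L2R (left_regular s (l2_class g)) (left_regular t (l2_class g))) \<longlongrightarrow> 0) (at t)"
  unfolding tendsto_at_iff_sequentially
proof (intro allI impI)
  fix S :: "nat \<Rightarrow> real" assume S: "S \<longlonglongrightarrow> t"
  have sg: "square_integrable g"
    by (rule square_integrable_continuous_compact_support[OF g])
  note [measurable] = sg
  obtain c where "0 \<le> c" and c: "\<And>s. cmod (g s) \<le> c" using continuous_compact_support_bounded[OF g] by blast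
  from S have "bounded (range S)" by (rule convergent_imp_bounded)
  then obtain b where b: "\<And>k. \<bar>S k\<bar> \<le> b" by (auto simp: bounded_iff)
  define R where "R = r + max b \<bar>t\<bar>"
  have R: "g (u - S k) = 0" "g (u - t) = 0" if "R < \<bar>u\<bar>" for u k
    using that b[of k] g(2)[of "u - S k"] g(2)[of "u - t"] by (auto simp: R_def max_def split: if_splits)
  have [measurable]: "(\<lambda>u. g (u - s)) \<in> borel_measurable borel" for s
    using square_integrable_shift[OF sg] by (rule square_integrable_measurable)
  have "(\<lambda>k. LINT u|lborel. (cmod (g (u - S k) - g (u - t)))\<^sup>2) \<longlonglongrightarrow> (LINT u|(lborel::real measure). 0)"
  proof (rule integral_dominated_convergence)
    show "integrable lborel (\<lambda>u. (2 * c)\<^sup>2 * indicator {-R..R} u :: real)"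
      by (rule integrable_indicator_Icc)
    show "AE u in lborel. (\<lambda>k. (cmod (g (u - S k) - g (u - t)))\<^sup>2) \<longlonglongrightarrow> 0"
    proof (rule AE_I2)
      fix u
      have "isCont g (u - t)" using g(1) by (simp add: continuous_on_eq_continuous_at)
      then have "(\<lambda>k. g (u - S k)) \<longlonglongrightarrow> g (u - t)"
        by (rule isCont_tendsto_compose) (intro tendsto_intros S)
      then have "(\<lambda>k. (cmod (g (u - S k) - g (u - t)))\<^sup>2) \<longlonglongrightarrow> (cmod (g (u - t) - g (u - t)))\<^sup>2"
        by (intro tendsto_intros)
      then show "(\<lambda>k. (cmod (g (u - S k) - g (u - t)))\<^sup>2) \<longlonglongrightarrow> 0" by simp
    qed
    show "AE u in lborel. norm ((cmod (g (u - S k) - g (u - t)))\<^sup>2) \<le> (2 * c)\<^sup>2 * indicator {-R..R} u" for k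
    proof (rule AE_I2)
      fix u
      have "cmod (g (u - S k) - g (u - t)) \<le> 2 * c"
        using norm_triangle_ineq4[of "g (u - S k)" "g (u - t)"] c[of "u - S k"] c[of "u - t"] by linarith
      then have "(cmod (g (u - S k) - g (u - t)))\<^sup>2 \<le> (2 * c)\<^sup>2" by (intro power_mono) auto
      then show "norm ((cmod (g (u - S k) - g (u - t)))\<^sup>2) \<le> (2 * c)\<^sup>2 * indicator {-R..R} u"
        using R(1)[of u k] R(2)[of u] by (cases "\<bar>u\<bar> \<le> R") (auto simp: indicator_def)
    qed
  qed simp_all
  then have "(\<lambda>k. sqrt (LINT u|lborel. (cmod (g (u - S k) - g (u - t)))\<^sup>2)) \<longlonglongrightarrow> sqrt 0"
    by (intro tendsto_real_sqrt) simp
  then show "((\<lambda>s. hdist L2R (left_regular s (l2_class g)) (left_regular t (l2_class g))) \<circ> S) \<longlonglongrightarrow> 0"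
    using sg by (simp add: o_def left_regular_l2_class hdist_L2R)
qed

text \<open>A three-epsilon argument: translations are isometric, so an approximation of the vector
  by a continuous one is equally good at all times.\<close>

lemma left_regular_continuous:
  assumes \<xi>: "\<xi> \<in> hcarrier L2R"
  shows "((\<lambda>s. hdist L2R (left_regular s \<xi>) (left_regular t \<xi>)) \<longlongrightarrow> 0) (at t)"
proof (rule tendstoI)
  fix e :: real assume e: "e > 0"
  obtain g r where g: "continuous_on UNIV g" "\<And>s. r < \<bar>s\<bar> \<Longrightarrow> g s = 0"
    "hdist L2R \<xi> (l2_class g) < e / 3"
    by (rule L2R_dense[OF \<xi>, of "e / 3"]) (use e in auto)
  let ?g = "l2_class g"
  have gC: "?g \<in> hcarrier L2R"
    using square_integrable_continuous_compact_support[OF g(1,2)] by simp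
  have "\<forall>\<^sub>F s in at t. hdist L2R (left_regular s ?g) (left_regular t ?g) < e / 3"
    using left_regular_continuous_Cc[OF g(1,2)] by (rule order_tendstoD(2)) (use e in auto)
  then show "\<forall>\<^sub>F s in at t. dist (hdist L2R (left_regular s \<xi>) (left_regular t \<xi>)) 0 < e"
  proof eventually_elim
    case (elim s)
    have "hdist L2R (left_regular s \<xi>) (left_regular t \<xi>)
        \<le> hdist L2R (left_regular s \<xi>) (left_regular s ?g)
          + hdist L2R (left_regular s ?g) (left_regular t \<xi>)"
      by (intro L2R.hdist_triangle) (use \<xi> gC in auto)
    also have "hdist L2R (left_regular s ?g) (left_regular t \<xi>)
        \<le> hdist L2R (left_regular s ?g) (left_regular t ?g)
          + hdist L2R (left_regular t ?g) (left_regular t \<xi>)"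
      by (intro L2R.hdist_triangle) (use \<xi> gC in auto)
    finally have "hdist L2R (left_regular s \<xi>) (left_regular t \<xi>) < e"
      using elim g(3) \<xi> gC hdist_left_regular[of \<xi> ?g s] hdist_left_regular[of ?g \<xi> t]
        L2R.hdist_commute[of \<xi> ?g] by simp
    then show ?case using \<xi> by simp
  qed
qed

lemma unitary_rep_left_regular: "unitary_rep L2R left_regular"
  unfolding unitary_rep_def bounded_operator_def
proof (intro conjI allI ballI)
  fix t
  show "\<exists>C. \<forall>x\<in>hcarrier L2R. hnorm L2R (left_regular t x) \<le> C * hnorm L2R x"
    by (intro exI[of _ 1]) (auto simp: hnorm_def inner_left_regular)
  fix x assume "x \<in> hcarrier L2R"
  then show "((\<lambda>s. hdist L2R (left_regular s x) (left_regular t x)) \<longlongrightarrow> 0) (at t)"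
    by (rule left_regular_continuous)
qed (auto simp: inner_left_regular left_regular_add left_regular_scale,
    auto elim!: hcarrier_L2R_cases simp: left_regular_l2_class algebra_simps)

section \<open>Covariant representations\<close>

lemma C0_carrier: "g \<in> acarrier (C0 X) \<longleftrightarrow> continuous_on X g \<and> (\<forall>p. p \<notin> X \<longrightarrow> g p = 0) \<and>
    (\<forall>e>0. \<exists>K. compact K \<and> K \<subseteq> X \<and> (\<forall>p\<in>X - K. cmod (g p) < e))"
  by (simp add: C0_def)

text \<open>Vanishing at infinity is inherited from a dominating function, so the functions built
  from \<open>g\<close> below need no compact sets of their own. The divisor |c| + 1 covers c =
  0.\<close>

lemma C0_dominated:
  assumes h: "h \<in> acarrier (C0 X)" and g: "continuous_on X g" and le: "\<And>p. cmod (g p) \<le> c * cmod (h p)"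
  shows "g \<in> acarrier (C0 X)"
  unfolding C0_carrier
proof (intro conjI allI impI g)
  fix p assume "p \<notin> X"
  then show "g p = 0" using h le[of p] by (simp add: C0_carrier)
next
  fix e :: real assume e: "e > 0"
  then have "e / (\<bar>c\<bar> + 1) > 0" by simp
  then obtain K where K: "compact K" "K \<subseteq> X" "\<forall>p\<in>X - K. cmod (h p) < e / (\<bar>c\<bar> + 1)"
    using h unfolding C0_carrier by blast
  have "cmod (g p) < e" if p: "p \<in> X - K" for p
  proof -
    have "cmod (g p) \<le> (\<bar>c\<bar> + 1) * cmod (h p)"
      by (rule order_trans[OF le]) (intro mult_right_mono, auto)
    also have "\<dots> < (\<bar>c\<bar> + 1) * (e / (\<bar>c\<bar> + 1))"
      using K(3) p by (intro mult_strict_left_mono) auto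
    finally show ?thesis by simp
  qed
  with K show "\<exists>K. compact K \<and> K \<subseteq> X \<and> (\<forall>p\<in>X - K. cmod (g p) < e)" by blast
qed

lemma C0_scale: "g \<in> acarrier (C0 X) \<Longrightarrow> (\<lambda>p. c * g p) \<in> acarrier (C0 X)"
  by (rule C0_dominated[where c = "cmod c"]) (auto simp: C0_carrier norm_mult intro!: continuous_intros)

lemma C0_add:
  assumes "g \<in> acarrier (C0 X)" "h \<in> acarrier (C0 X)"
  shows "(\<lambda>p. g p + h p) \<in> acarrier (C0 X)"
  unfolding C0_carrier
proof (intro conjI allI impI)
  show "continuous_on X (\<lambda>p. g p + h p)"
    using assms by (intro continuous_intros) (auto simp: C0_carrier)
  show "g p + h p = 0" if "p \<notin> X" for p using assms that by (simp add: C0_carrier)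
  fix e :: real assume "e > 0"
  then have "e / 2 > 0" by simp
  then obtain K K' where K: "compact K" "K \<subseteq> X" "\<forall>p\<in>X - K. cmod (g p) < e / 2"
    and K': "compact K'" "K' \<subseteq> X" "\<forall>p\<in>X - K'. cmod (h p) < e / 2"
    using assms unfolding C0_carrier by meson
  have "\<forall>p\<in>X - (K \<union> K'). cmod (g p + h p) < e"
  proof
    fix p assume "p \<in> X - (K \<union> K')"
    then have "cmod (g p) < e / 2" "cmod (h p) < e / 2" using K K' by auto
    then show "cmod (g p + h p) < e" using norm_triangle_ineq[of "g p" "h p"] by linarith
  qed
  then show "\<exists>K. compact K \<and> K \<subseteq> X \<and> (\<forall>p\<in>X - K. cmod (g p + h p) < e)"
    using K K' by (intro exI[of _ "K \<union> K'"]) auto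
qed

lemma C0_diff:
  "g \<in> acarrier (C0 X) \<Longrightarrow> h \<in> acarrier (C0 X) \<Longrightarrow> (\<lambda>p. g p - h p) \<in> acarrier (C0 X)"
  using C0_add[of g X "\<lambda>p. -1 * h p"] C0_scale[of h X "-1"] by simp

lemma C0_bounded:
  assumes "g \<in> acarrier (C0 X)"
  obtains c where "0 \<le> c" "\<And>p. cmod (g p) \<le> c"
proof -
  obtain K where K: "compact K" "K \<subseteq> X" "\<forall>p\<in>X - K. cmod (g p) < 1"
    using assms unfolding C0_carrier by (metis zero_less_one)
  have "continuous_on K g" using assms K(2) continuous_on_subset by (auto simp: C0_carrier)
  then have "bounded (g ` K)" using K(1) by (intro compact_imp_bounded compact_continuous_image)
  then obtain c where c: "\<forall>p\<in>K. cmod (g p) \<le> c" by (auto simp: bounded_iff)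
  have "cmod (g p) \<le> max 1 c" for p
    using c K(3) assms by (cases "p \<in> X") (force simp: le_max_iff_disj C0_carrier less_imp_le)+
  then show ?thesis using that[of "max 1 c"] by simp
qed

text \<open>With \<open>k = c - sqrt (c\<^sup>2 - \<bar>g\<bar>\<^sup>2)\<close> one has \<open>\<bar>g\<bar>\<^sup>2 = 2 c k - k\<^sup>2\<close>, whence
  \<open>c\<^sup>2 \<parallel>\<xi>\<parallel>\<^sup>2 - \<parallel>\<pi> g \<xi>\<parallel>\<^sup>2 = \<parallel>c \<xi> - \<pi> k \<xi>\<parallel>\<^sup>2\<close>.\<close>

lemma star_rep_C0_contractive:
  assumes H: "hilbert_space H" and rep: "star_rep (C0 X) H \<pi>"
    and g: "g \<in> acarrier (C0 X)" and c: "\<And>p. cmod (g p) \<le> c" and \<xi>: "\<xi> \<in> hcarrier H"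
  shows "hnorm H (\<pi> g \<xi>) \<le> c * hnorm H \<xi>"
proof -
  interpret hilbert H by (rule hilbert.intro) (rule H)
  have c0: "0 \<le> c" using c[of undefined] norm_ge_zero order_trans by blast
  define k where "k p = c - sqrt (c\<^sup>2 - (cmod (g p))\<^sup>2)" for p
  let ?k = "\<lambda>p. of_real (k p) :: complex"
  have sq: "0 \<le> c\<^sup>2 - (cmod (g p))\<^sup>2" for p using c[of p] by (simp add: power_mono)
  have kg: "2 * c * k p - (k p)\<^sup>2 = (cmod (g p))\<^sup>2" for p
    using sq[of p] by (simp add: k_def power2_diff algebra_simps) (simp add: power2_eq_square)
  \<comment> \<open>This bound places k in \<open>C0 X\<close>. The square root of c^2 - |g|^2 alone
    need not vanish at infinity; its difference from c does, and the constant c then acts as a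
    scalar on the Hilbert space.\<close>
  have k_bound: "\<bar>k p\<bar> \<le> cmod (g p)" for p
  proof -
    have "(c - cmod (g p))\<^sup>2 \<le> c\<^sup>2 - (cmod (g p))\<^sup>2"
      using mult_left_mono[OF c[of p], of "cmod (g p)"]
      by (simp add: power2_diff power2_eq_square algebra_simps)
    then have "c - cmod (g p) \<le> sqrt (c\<^sup>2 - (cmod (g p))\<^sup>2)" by (rule real_le_rsqrt)
    moreover have "sqrt (c\<^sup>2 - (cmod (g p))\<^sup>2) \<le> c" using c0 by (intro real_le_lsqrt) auto
    ultimately show ?thesis by (simp add: k_def)
  qed
  have k: "?k \<in> acarrier (C0 X)"
  proof (rule C0_dominated[OF g, where c = 1])
    show "continuous_on X ?k"
      unfolding k_def using g by (intro continuous_intros) (auto simp: C0_carrier)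
  qed (use k_bound in simp)
  have add: "\<And>a b x. a \<in> acarrier (C0 X) \<Longrightarrow> b \<in> acarrier (C0 X) \<Longrightarrow> x \<in> C \<Longrightarrow>
      \<pi> (\<lambda>p. a p + b p) x = hadd H (\<pi> a x) (\<pi> b x)"
    and scale: "\<And>c a x. a \<in> acarrier (C0 X) \<Longrightarrow> x \<in> C \<Longrightarrow> \<pi> (\<lambda>p. c * a p) x = hscale H c (\<pi> a x)"
    and mult: "\<And>a b x. a \<in> acarrier (C0 X) \<Longrightarrow> b \<in> acarrier (C0 X) \<Longrightarrow> x \<in> C \<Longrightarrow>
      \<pi> (\<lambda>p. a p * b p) x = \<pi> a (\<pi> b x)"
    and star: "\<And>a x y. a \<in> acarrier (C0 X) \<Longrightarrow> x \<in> C \<Longrightarrow> y \<in> C \<Longrightarrow>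
      hinner H (\<pi> (\<lambda>p. cnj (a p)) x) y = hinner H x (\<pi> a y)"
    and closed: "\<And>a x. a \<in> acarrier (C0 X) \<Longrightarrow> x \<in> C \<Longrightarrow> \<pi> a x \<in> C"
    using rep by (simp_all add: star_rep_def bounded_operator_def C0_def)
  have kk: "(\<lambda>p. ?k p * ?k p) \<in> acarrier (C0 X)"
  proof (rule C0_dominated[OF k, where c = c])
    show "continuous_on X (\<lambda>p. ?k p * ?k p)"
      using k by (intro continuous_intros) (auto simp: C0_carrier)
    show "cmod (?k p * ?k p) \<le> c * cmod (?k p)" for p
      using mult_right_mono[OF order_trans[OF k_bound c[of p]], of "\<bar>k p\<bar>"] by (simp add: norm_mult)
  qed
  have gs: "(\<lambda>p. cnj (g p)) \<in> acarrier (C0 X)"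
    by (rule C0_dominated[OF g, where c = 1]) (use g in \<open>auto simp: C0_carrier intro!: continuous_intros\<close>)
  have gg: "(\<lambda>p. cnj (g p) * g p) = (\<lambda>p. of_real (2 * c) * ?k p + (-1) * (?k p * ?k p))"
  proof
    fix p
    have "cnj (g p) * g p = of_real ((cmod (g p))\<^sup>2)"
      using complex_norm_square[of "g p"] by (simp add: mult.commute)
    also have "\<dots> = of_real (2 * c * k p - (k p)\<^sup>2)" by (simp only: kg)
    finally show "cnj (g p) * g p = of_real (2 * c) * ?k p + (-1) * (?k p * ?k p)"
      by (simp add: power2_eq_square)
  qed
  have "\<pi> (\<lambda>p. cnj (g p)) (\<pi> g \<xi>) = hadd H (hscale H (of_real (2 * c)) (\<pi> ?k \<xi>)) (hscale H (-1) (\<pi> ?k (\<pi> ?k \<xi>)))"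
    unfolding mult[OF gs g \<xi>, symmetric] gg
    by (simp only: add[OF C0_scale[OF k] C0_scale[OF kk] \<xi>] scale[OF k \<xi>] scale[OF kk \<xi>] mult[OF k k \<xi>])
  then have "hinner H (\<pi> (\<lambda>p. cnj (g p)) (\<pi> g \<xi>)) \<xi> =
      of_real (2 * c) * hinner H (\<pi> ?k \<xi>) \<xi> - hinner H (\<pi> ?k (\<pi> ?k \<xi>)) \<xi>"
    using closed[OF k] \<xi> by (simp add: inner_add_left inner_scale_left)
  also have "hinner H (\<pi> (\<lambda>p. cnj (g p)) (\<pi> g \<xi>)) \<xi> = hinner H (\<pi> g \<xi>) (\<pi> g \<xi>)"
    using star[OF g closed[OF g \<xi>] \<xi>] .
  also have "hinner H (\<pi> ?k (\<pi> ?k \<xi>)) \<xi> = hinner H (\<pi> ?k \<xi>) (\<pi> ?k \<xi>)"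
    using star[OF k closed[OF k \<xi>] \<xi>] by simp
  finally have gk: "hinner H (\<pi> g \<xi>) (\<pi> g \<xi>) =
      of_real (2 * c) * hinner H (\<pi> ?k \<xi>) \<xi> - hinner H (\<pi> ?k \<xi>) (\<pi> ?k \<xi>)" .
  let ?v = "hminus H (hscale H (of_real c) \<xi>) (\<pi> ?k \<xi>)"
  have sym: "hinner H \<xi> (\<pi> ?k \<xi>) = hinner H (\<pi> ?k \<xi>) \<xi>" using star[OF k \<xi> \<xi>] by simp
  have "hinner H ?v ?v = (of_real c)\<^sup>2 * hinner H \<xi> \<xi> - hinner H (\<pi> g \<xi>) (\<pi> g \<xi>)"
    unfolding gk using \<xi> closed[OF k \<xi>] sym
    by (simp add: inner_diff_left inner_diff_right inner_scale_left inner_scale_right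
        power2_eq_square algebra_simps)
  then have "Re (hinner H ?v ?v) = c\<^sup>2 * (hnorm H \<xi>)\<^sup>2 - (hnorm H (\<pi> g \<xi>))\<^sup>2"
    using \<xi> closed[OF g \<xi>] by (simp add: inner_self flip: of_real_power of_real_mult)
  moreover have "0 \<le> Re (hinner H ?v ?v)" using \<xi> closed[OF k \<xi>] by (intro inner_nonneg) auto
  ultimately have "(hnorm H (\<pi> g \<xi>))\<^sup>2 \<le> (c * hnorm H \<xi>)\<^sup>2" by (simp add: power_mult_distrib)
  then show ?thesis by (rule power2_le_imp_le) (use c0 \<xi> in simp)
qed

lemma Cc_slice:
  assumes "f \<in> Cc X" shows "f t \<in> acarrier (C0 X)"
proof -
  from assms obtain K where cont: "continuous_on (UNIV \<times> X) (\<lambda>(t, p). f t p)"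
    and K: "compact K" "K \<subseteq> UNIV \<times> X" "\<And>t p. (t, p) \<notin> K \<Longrightarrow> f t p = 0"
    by (auto simp: Cc_def)
  have "continuous_on X (\<lambda>p. case (t, p) of (t, p) \<Rightarrow> f t p)"
    by (rule continuous_on_compose2[OF cont]) (auto intro!: continuous_intros)
  then have cont': "continuous_on X (f t)" by simp
  have "\<exists>K. compact K \<and> K \<subseteq> X \<and> (\<forall>p\<in>X - K. cmod (f t p) < e)" if "e > 0" for e
  proof (intro exI[of _ "snd ` K"] conjI ballI)
    show "compact (snd ` K)" using K(1) by (intro compact_continuous_image continuous_intros)
    show "snd ` K \<subseteq> X" using K(2) by auto
    fix p assume "p \<in> X - snd ` K"
    then have "(t, p) \<notin> K" by force
    then show "cmod (f t p) < e" using K(3) that by simp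
  qed
  moreover have "f t p = 0" if "p \<notin> X" for p using K(2,3) that by blast
  ultimately show ?thesis using cont' by (simp add: C0_carrier)
qed

lemma Cc_bounds:
  assumes "f \<in> Cc X"
  shows "\<exists>T M. 0 \<le> M \<and> 0 \<le> T \<and> (\<forall>t p. cmod (f t p) \<le> M * indicator {-T..T} t)"
proof -
  from assms obtain K where cont: "continuous_on (UNIV \<times> X) (\<lambda>(t, p). f t p)"
    and K: "compact K" "K \<subseteq> UNIV \<times> X" "\<And>t p. (t, p) \<notin> K \<Longrightarrow> f t p = 0"
    by (auto simp: Cc_def)
  have "bounded (fst ` K)" using K(1) by (intro compact_imp_bounded compact_continuous_image continuous_intros)
  then obtain T where T: "\<And>q. q \<in> K \<Longrightarrow> \<bar>fst q\<bar> \<le> T" by (auto simp: bounded_iff)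
  have "bounded ((\<lambda>(t, p). f t p) ` K)"
    using K cont by (intro compact_imp_bounded compact_continuous_image) (auto intro: continuous_on_subset)
  then obtain M where M: "\<And>q. q \<in> K \<Longrightarrow> cmod (case q of (t, p) \<Rightarrow> f t p) \<le> M"
    unfolding bounded_iff by blast
  have "cmod (f t p) \<le> max 0 M * indicator {-(max 0 T)..max 0 T} t" for t p
  proof (cases "(t, p) \<in> K")
    case True
    then show ?thesis using T[OF True] M[OF True] by (auto simp: indicator_def le_max_iff_disj)
  next
    case False
    then show ?thesis using K(3) by (simp add: indicator_def)
  qed
  then show ?thesis by (intro exI[of _ "max 0 T"] exI[of _ "max 0 M"]) simp
qed

text \<open>Uniformity in p comes from compactness of [t - 1, t + 1] times the projection of the
  support; at points outside that projection both values vanish. This makes the slices of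
  \<open>f\<close> continuous in t for the supremum norm.\<close>

lemma Cc_equicontinuous:
  fixes X :: "'x::metric_space set"
  assumes "f \<in> Cc X" and e: "e > 0"
  shows "\<forall>\<^sub>F s in at t. \<forall>p. cmod (f s p - f t p) \<le> e"
proof -
  from assms obtain K where cont: "continuous_on (UNIV \<times> X) (\<lambda>(t, p). f t p)"
    and K: "compact K" "K \<subseteq> UNIV \<times> X" "\<And>t p. (t, p) \<notin> K \<Longrightarrow> f t p = 0"
    by (auto simp: Cc_def)
  let ?Q = "{t - 1..t + 1} \<times> snd ` K"
  have "compact ?Q" using K(1)
    by (intro compact_Times compact_continuous_image continuous_intros) auto
  moreover have "continuous_on ?Q (\<lambda>(t, p). f t p)"
    by (rule continuous_on_subset[OF cont]) (use K(2) in auto)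
  ultimately have "uniformly_continuous_on ?Q (\<lambda>(t, p). f t p)"
    by (intro compact_uniformly_continuous)
  then obtain d where d: "d > 0" "\<And>q q'. q \<in> ?Q \<Longrightarrow> q' \<in> ?Q \<Longrightarrow> dist q' q < d \<Longrightarrow>
      dist (case q' of (t, p) \<Rightarrow> f t p) (case q of (t, p) \<Rightarrow> f t p) < e"
    using e unfolding uniformly_continuous_on_def by metis
  have "\<forall>p. cmod (f s p - f t p) \<le> e" if s: "dist s t < min d 1" for s
  proof
    fix p
    show "cmod (f s p - f t p) \<le> e"
    proof (cases "p \<in> snd ` K")
      case True
      have "dist (s, p) (t, p) < d" using s by (simp add: dist_Pair_Pair)
      moreover have "(s, p) \<in> ?Q" "(t, p) \<in> ?Q" using True s by (auto simp: dist_real_def)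
      ultimately show ?thesis using d(2)[of "(t, p)" "(s, p)"] by (simp add: dist_norm)
    next
      case False
      then have "(s, p) \<notin> K" "(t, p) \<notin> K" by force+
      then show ?thesis using K(3) e by simp
    qed
  qed
  then show ?thesis using d(1) by (auto simp: eventually_at intro!: exI[of _ "min d 1"])
qed

lemma integral_bound_Icc:
  fixes h :: "real \<Rightarrow> complex"
  assumes h: "\<And>t. cmod (h t) \<le> B * indicator {-T..T} t" and "0 \<le> T"
  shows "cmod (LINT t|lborel. h t) \<le> B * (2 * T)"
proof -
  have "cmod (LINT t|lborel. h t) \<le> (LINT t|lborel. cmod (h t))" by (rule integral_norm_bound)
  also have "\<dots> \<le> (LINT t|lborel. B * indicator {-T..T} t)"
    by (rule integral_mono'[OF integrable_indicator_Icc])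
      (use h order_trans[OF norm_ge_zero h] in auto)
  also have "\<dots> = B * (2 * T)" using assms(2) by (simp add: measure_def)
  finally show ?thesis .
qed

locale covariant =
  fixes X :: "'x::metric_space set" and act :: "real \<Rightarrow> 'x \<Rightarrow> 'x"
    and H :: "'h hspace" and \<pi> :: "('x \<Rightarrow> complex) \<Rightarrow> 'h \<Rightarrow> 'h" and U :: "real \<Rightarrow> 'h \<Rightarrow> 'h"
  assumes covariant: "covariant_rep X act H \<pi> U"
begin

sublocale hilbert H
  using covariant by unfold_locales (simp add: covariant_rep_def)

definition coef :: "(real \<Rightarrow> 'x \<Rightarrow> complex) \<Rightarrow> 'h \<Rightarrow> 'h \<Rightarrow> real \<Rightarrow> complex" where
  "coef f \<xi> \<eta> t = hinner H (\<pi> (f t) (U t \<xi>)) \<eta>"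

lemma rep: "star_rep (C0 X) H \<pi>"
  using covariant by (simp add: covariant_rep_def)

lemma rep_contractive: "g \<in> acarrier (C0 X) \<Longrightarrow> (\<And>p. cmod (g p) \<le> c) \<Longrightarrow> \<xi> \<in> C \<Longrightarrow>
    hnorm H (\<pi> g \<xi>) \<le> c * hnorm H \<xi>"
  by (rule star_rep_C0_contractive[OF hilbert rep])

lemma rep_closed [simp]: "g \<in> acarrier (C0 X) \<Longrightarrow> \<xi> \<in> C \<Longrightarrow> \<pi> g \<xi> \<in> C"
  and rep_hadd: "g \<in> acarrier (C0 X) \<Longrightarrow> \<xi> \<in> C \<Longrightarrow> \<eta> \<in> C \<Longrightarrow>
    \<pi> g (hadd H \<xi> \<eta>) = hadd H (\<pi> g \<xi>) (\<pi> g \<eta>)"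
  and rep_hscale: "g \<in> acarrier (C0 X) \<Longrightarrow> \<xi> \<in> C \<Longrightarrow> \<pi> g (hscale H c \<xi>) = hscale H c (\<pi> g \<xi>)"
  and rep_add: "g \<in> acarrier (C0 X) \<Longrightarrow> h \<in> acarrier (C0 X) \<Longrightarrow> \<xi> \<in> C \<Longrightarrow>
    \<pi> (\<lambda>p. g p + h p) \<xi> = hadd H (\<pi> g \<xi>) (\<pi> h \<xi>)"
  and rep_scale: "g \<in> acarrier (C0 X) \<Longrightarrow> \<xi> \<in> C \<Longrightarrow> \<pi> (\<lambda>p. c * g p) \<xi> = hscale H c (\<pi> g \<xi>)"
  using rep by (simp_all add: star_rep_def bounded_operator_def C0_def)

lemma rep_hminus: "g \<in> acarrier (C0 X) \<Longrightarrow> \<xi> \<in> C \<Longrightarrow> \<eta> \<in> C \<Longrightarrow>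
    \<pi> g (hminus H \<xi> \<eta>) = hminus H (\<pi> g \<xi>) (\<pi> g \<eta>)"
  by (simp add: hminus_def rep_hadd rep_hscale)

lemma rep_diff: "g \<in> acarrier (C0 X) \<Longrightarrow> h \<in> acarrier (C0 X) \<Longrightarrow> \<xi> \<in> C \<Longrightarrow>
    \<pi> (\<lambda>p. g p - h p) \<xi> = hminus H (\<pi> g \<xi>) (\<pi> h \<xi>)"
  using rep_add[of g "\<lambda>p. -1 * h p" \<xi>] rep_scale[of h \<xi> "-1"] C0_scale[of h X "-1"]
  by (simp add: hminus_def)

lemma U_closed [simp]: "\<xi> \<in> C \<Longrightarrow> U t \<xi> \<in> C"
  and U_hadd: "\<xi> \<in> C \<Longrightarrow> \<eta> \<in> C \<Longrightarrow> U t (hadd H \<xi> \<eta>) = hadd H (U t \<xi>) (U t \<eta>)"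
  and U_hscale: "\<xi> \<in> C \<Longrightarrow> U t (hscale H c \<xi>) = hscale H c (U t \<xi>)"
  and inner_U: "\<xi> \<in> C \<Longrightarrow> \<eta> \<in> C \<Longrightarrow> hinner H (U t \<xi>) (U t \<eta>) = hinner H \<xi> \<eta>"
  and U_continuous: "\<xi> \<in> C \<Longrightarrow> ((\<lambda>s. hdist H (U s \<xi>) (U t \<xi>)) \<longlongrightarrow> 0) (at t)"
  using covariant by (simp_all add: covariant_rep_def unitary_rep_def bounded_operator_def)

lemma hnorm_U: "\<xi> \<in> C \<Longrightarrow> hnorm H (U t \<xi>) = hnorm H \<xi>"
  by (simp add: hnorm_def inner_U)

lemma U_hminus: "\<xi> \<in> C \<Longrightarrow> \<eta> \<in> C \<Longrightarrow> U t (hminus H \<xi> \<eta>) = hminus H (U t \<xi>) (U t \<eta>)"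
  by (simp add: hminus_def U_hadd U_hscale)

lemma hnorm_rep_U:
  assumes f: "f \<in> Cc X" and M: "\<And>p. cmod (f t p) \<le> M" and \<xi>: "\<xi> \<in> C"
  shows "hnorm H (\<pi> (f t) (U t \<xi>)) \<le> M * hnorm H \<xi>"
  using rep_contractive[OF Cc_slice[OF f] M, of "U t \<xi>"] \<xi> by (simp add: hnorm_U)

lemma coef_bound:
  assumes f: "f \<in> Cc X" and M: "\<And>p. cmod (f t p) \<le> M" and \<xi>: "\<xi> \<in> C" and \<eta>: "\<eta> \<in> C"
  shows "cmod (coef f \<xi> \<eta> t) \<le> M * (hnorm H \<xi> * hnorm H \<eta>)"
proof -
  have "cmod (coef f \<xi> \<eta> t) \<le> hnorm H (\<pi> (f t) (U t \<xi>)) * hnorm H \<eta>"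
    unfolding coef_def using Cc_slice[OF f] \<xi> \<eta> by (intro Cauchy_Schwarz) auto
  also have "\<dots> \<le> M * hnorm H \<xi> * hnorm H \<eta>"
    using hnorm_rep_U[OF f M \<xi>] \<eta> by (intro mult_right_mono) auto
  finally show ?thesis by (simp add: mult.assoc)
qed

lemma coef_vector_diff_bound:
  assumes f: "f \<in> Cc X" and M: "\<And>p. cmod (f t p) \<le> M" and C: "\<xi> \<in> C" "\<eta> \<in> C"
  shows "cmod (coef f \<xi> \<xi> t - coef f \<eta> \<eta> t) \<le> M * (hdist H \<xi> \<eta> * (hnorm H \<xi> + hnorm H \<eta>))"
proof -
  note fC = Cc_slice[OF f, of t]
  have "hdist H (\<pi> (f t) (U t \<xi>)) (\<pi> (f t) (U t \<eta>)) = hnorm H (\<pi> (f t) (U t (hminus H \<xi> \<eta>)))"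
    using C fC by (simp only: hdist_eq_hnorm_hminus U_hminus rep_hminus U_closed)
  also have "\<dots> \<le> M * hdist H \<xi> \<eta>"
    unfolding hdist_eq_hnorm_hminus using C by (intro hnorm_rep_U[OF f M]) auto
  finally have 1: "hdist H (\<pi> (f t) (U t \<xi>)) (\<pi> (f t) (U t \<eta>)) \<le> M * hdist H \<xi> \<eta>" .
  have "cmod (coef f \<xi> \<xi> t - coef f \<eta> \<eta> t) \<le>
      hdist H (\<pi> (f t) (U t \<xi>)) (\<pi> (f t) (U t \<eta>)) * hnorm H \<xi>
      + hnorm H (\<pi> (f t) (U t \<eta>)) * hdist H \<xi> \<eta>"
    unfolding coef_def using C fC by (intro inner_diff_bound) auto
  also have "\<dots> \<le> (M * hdist H \<xi> \<eta>) * hnorm H \<xi> + (M * hnorm H \<eta>) * hdist H \<xi> \<eta>"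
    by (intro add_mono mult_right_mono[OF 1] mult_right_mono[OF hnorm_rep_U[OF f M C(2)]])
      (simp_all add: C)
  finally show ?thesis by (simp add: algebra_simps)
qed

text \<open>The change from t to s is split into the change of the vector \<open>U t \<xi>\<close>
  under a fixed slice and the change of the slice on a fixed vector. Continuity provides the
  measurability needed to integrate \<open>coef\<close>.\<close>

lemma coef_continuous:
  assumes f: "f \<in> Cc X" and \<xi>: "\<xi> \<in> C" and \<eta>: "\<eta> \<in> C"
  shows "continuous_on UNIV (coef f \<xi> \<eta>)"
  unfolding continuous_on_def
proof (intro ballI)
  fix t :: real
  obtain T M where M: "0 \<le> M" "\<And>t p. cmod (f t p) \<le> M * indicator {-T..T} t"
    using Cc_bounds[OF f] by blast
  have M': "cmod (f s p) \<le> M" for s p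
    by (rule order_trans[OF M(2)]) (use M(1) in \<open>simp add: indicator_def\<close>)
  \<comment> \<open>The estimate below ends at e (M + norm xi) norm eta; the added 1 makes this
    strictly less than e B = e' and keeps B positive.\<close>
  define B where "B = (M + hnorm H \<xi>) * hnorm H \<eta> + 1"
  have B: "B > 0" using M(1) \<xi> \<eta> by (auto simp: B_def intro!: add_nonneg_pos mult_nonneg_nonneg)
  have "(coef f \<xi> \<eta> \<longlongrightarrow> coef f \<xi> \<eta> t) (at t)"
  proof (rule tendstoI)
    fix e' :: real assume "e' > 0"
    define e where "e = e' / B"
    have e: "e > 0" using B \<open>e' > 0\<close> by (simp add: e_def)
    have "\<forall>\<^sub>F s in at t. hdist H (U s \<xi>) (U t \<xi>) < e"
      using U_continuous[OF \<xi>, of t] e by (rule order_tendstoD(2))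
    then show "\<forall>\<^sub>F s in at t. dist (coef f \<xi> \<eta> s) (coef f \<xi> \<eta> t) < e'"
      using Cc_equicontinuous[OF f e, of t]
    proof eventually_elim
      case (elim s)
      note slice = Cc_slice[OF f]
      have "hdist H (\<pi> (f s) (U s \<xi>)) (\<pi> (f s) (U t \<xi>)) = hnorm H (\<pi> (f s) (hminus H (U s \<xi>) (U t \<xi>)))"
        using \<xi> slice by (simp add: hdist_eq_hnorm_hminus rep_hminus)
      also have "\<dots> \<le> M * hdist H (U s \<xi>) (U t \<xi>)"
        unfolding hdist_eq_hnorm_hminus using \<xi> slice M' by (intro rep_contractive) auto
      also have "\<dots> \<le> M * e" using elim M(1) by (intro mult_left_mono) auto
      finally have 1: "hdist H (\<pi> (f s) (U s \<xi>)) (\<pi> (f s) (U t \<xi>)) \<le> M * e" .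
      have "hdist H (\<pi> (f s) (U t \<xi>)) (\<pi> (f t) (U t \<xi>)) = hnorm H (\<pi> (\<lambda>p. f s p - f t p) (U t \<xi>))"
        using \<xi> slice by (simp add: hdist_eq_hnorm_hminus rep_diff)
      also have "\<dots> \<le> e * hnorm H (U t \<xi>)"
        using \<xi> slice elim by (intro rep_contractive C0_diff) auto
      finally have 2: "hdist H (\<pi> (f s) (U t \<xi>)) (\<pi> (f t) (U t \<xi>)) \<le> e * hnorm H \<xi>"
        using \<xi> by (simp add: hnorm_U)
      have "hdist H (\<pi> (f s) (U s \<xi>)) (\<pi> (f t) (U t \<xi>)) \<le> e * (M + hnorm H \<xi>)"
        using hdist_triangle[of "\<pi> (f s) (U s \<xi>)" "\<pi> (f s) (U t \<xi>)" "\<pi> (f t) (U t \<xi>)"] 1 2 \<xi> slice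
        by (simp add: algebra_simps)
      moreover have "dist (coef f \<xi> \<eta> s) (coef f \<xi> \<eta> t) \<le>
          hdist H (\<pi> (f s) (U s \<xi>)) (\<pi> (f t) (U t \<xi>)) * hnorm H \<eta>"
        unfolding dist_norm coef_def hdist_eq_hnorm_hminus
        using \<xi> \<eta> slice by (subst inner_diff_left[symmetric]) (auto intro!: Cauchy_Schwarz)
      ultimately have "dist (coef f \<xi> \<eta> s) (coef f \<xi> \<eta> t) \<le> e * (M + hnorm H \<xi>) * hnorm H \<eta>"
        using mult_right_mono hnorm_nonneg[OF \<eta>] order_trans by blast
      also have "\<dots> < e * B" using e by (simp add: B_def algebra_simps)
      also have "\<dots> = e'" using B by (simp add: e_def)
      finally show ?case .
    qed
  qed
  then show "(coef f \<xi> \<eta> \<longlongrightarrow> coef f \<xi> \<eta> t) (at t within UNIV)" by simp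
qed

text \<open>This is the matrix coefficient of the integrated form. As a scalar integral it makes
  sense in every covariant representation, before a vector representing it is known to
  exist.\<close>

definition mcoef :: "(real \<Rightarrow> 'x \<Rightarrow> complex) \<Rightarrow> 'h \<Rightarrow> 'h \<Rightarrow> complex" where
  "mcoef f \<xi> \<eta> = (LINT t|lborel. coef f \<xi> \<eta> t)"

lemma integrable_coef:
  assumes f: "f \<in> Cc X" and C: "\<xi> \<in> C" "\<eta> \<in> C"
  shows "integrable lborel (coef f \<xi> \<eta>)"
proof -
  obtain T M where M: "\<And>t p. cmod (f t p) \<le> M * indicator {-T..T} t"
    using Cc_bounds[OF f] by blast
  show ?thesis
  proof (rule Bochner_Integration.integrable_bound)
    show "integrable lborel (\<lambda>t. (M * (hnorm H \<xi> * hnorm H \<eta>)) * indicator {-T..T} t)"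
      by (rule integrable_indicator_Icc)
    show "coef f \<xi> \<eta> \<in> borel_measurable lborel"
      using borel_measurable_continuous_onI[OF coef_continuous[OF f C]] by simp
    show "AE t in lborel. norm (coef f \<xi> \<eta> t) \<le>
        norm (M * (hnorm H \<xi> * hnorm H \<eta>) * indicator {-T..T} t)"
    proof (rule AE_I2)
      fix t
      have "norm (coef f \<xi> \<eta> t) \<le> M * indicator {-T..T} t * (hnorm H \<xi> * hnorm H \<eta>)"
        by (rule coef_bound[OF f M C])
      then show "norm (coef f \<xi> \<eta> t) \<le> norm (M * (hnorm H \<xi> * hnorm H \<eta>) * indicator {-T..T} t)"
        by (simp add: mult_ac order_trans[OF _ abs_ge_self])
    qed
  qed
qed

lemma mcoef_bound:
  assumes f: "f \<in> Cc X" and M: "\<And>t p. cmod (f t p) \<le> M * indicator {-T..T} t" "0 \<le> T"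
    and C: "\<xi> \<in> C" "\<eta> \<in> C"
  shows "cmod (mcoef f \<xi> \<eta>) \<le> M * (hnorm H \<xi> * hnorm H \<eta>) * (2 * T)"
  unfolding mcoef_def
  by (rule integral_bound_Icc[OF _ M(2)]) (use coef_bound[OF f M(1) C] in \<open>simp add: mult_ac\<close>)

text \<open>The constants depend on \<open>f\<close> alone. This is what allows the vector defining
  the state to be replaced by a nearby continuous one with compact support.\<close>

lemma mcoef_vector_diff_bound:
  assumes f: "f \<in> Cc X" and M: "\<And>t p. cmod (f t p) \<le> M * indicator {-T..T} t" "0 \<le> T"
    and C: "\<xi> \<in> C" "\<eta> \<in> C"
  shows "cmod (mcoef f \<xi> \<xi> - mcoef f \<eta> \<eta>) \<le> M * (hdist H \<xi> \<eta> * (hnorm H \<xi> + hnorm H \<eta>)) * (2 * T)"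
proof -
  have "mcoef f \<xi> \<xi> - mcoef f \<eta> \<eta> = (LINT t|lborel. coef f \<xi> \<xi> t - coef f \<eta> \<eta> t)"
    unfolding mcoef_def using C by (intro Bochner_Integration.integral_diff[symmetric] integrable_coef[OF f])
  also have "cmod \<dots> \<le> M * (hdist H \<xi> \<eta> * (hnorm H \<xi> + hnorm H \<eta>)) * (2 * T)"
    by (rule integral_bound_Icc[OF _ M(2)])
      (use coef_vector_diff_bound[OF f M(1) C] in \<open>simp add: mult_ac\<close>)
  finally show ?thesis .
qed

lemma mcoef_add:
  assumes "f \<in> Cc X" "g \<in> Cc X" "\<xi> \<in> C" "\<eta> \<in> C"
  shows "mcoef (\<lambda>t p. f t p + g t p) \<xi> \<eta> = mcoef f \<xi> \<eta> + mcoef g \<xi> \<eta>"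
proof -
  have "coef (\<lambda>t p. f t p + g t p) \<xi> \<eta> = (\<lambda>t. coef f \<xi> \<eta> t + coef g \<xi> \<eta> t)"
    using assms by (intro ext) (simp add: coef_def rep_add Cc_slice inner_add_left)
  then show ?thesis
    unfolding mcoef_def using assms by (simp add: integrable_coef)
qed

lemma mcoef_scale:
  assumes "f \<in> Cc X" "\<xi> \<in> C" "\<eta> \<in> C"
  shows "mcoef (\<lambda>t p. c * f t p) \<xi> \<eta> = c * mcoef f \<xi> \<eta>"
proof -
  have "coef (\<lambda>t p. c * f t p) \<xi> \<eta> = (\<lambda>t. c * coef f \<xi> \<eta> t)"
    using assms by (intro ext) (simp add: coef_def rep_scale Cc_slice inner_scale_left)
  then show ?thesis
    unfolding mcoef_def by simp
qed

end

lemma covariant_mcoef_eq: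
  assumes "covariant_rep X act H \<pi> U"
  shows "covariant.mcoef H \<pi> U f \<xi> \<eta> = (LINT t|lborel. hinner H (\<pi> (f t) (U t \<xi>)) \<eta>)"
proof -
  interpret covariant X act H \<pi> U by (rule covariant.intro[OF assms])
  show ?thesis by (simp add: mcoef_def coef_def)
qed

text \<open>The real supremum is meaningful because the set is bounded: representations of
  \<open>C0 X\<close> are contractive and \<open>U\<close> is isometric, so
  \<open>M * (2 * T)\<close> bounds all coefficients in all covariant representations at
  once.\<close>

lemma cp_norm_upper:
  fixes H :: "l2 hspace"
  assumes cov: "covariant_rep X act H \<pi> U" and f: "f \<in> Cc X"
    and v: "\<xi> \<in> hcarrier H" "\<eta> \<in> hcarrier H" "hnorm H \<xi> \<le> 1" "hnorm H \<eta> \<le> 1"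
  shows "cmod (covariant.mcoef H \<pi> U f \<xi> \<eta>) \<le> cp_norm X act f"
  unfolding cp_norm_def covariant_mcoef_eq[OF cov]
proof (rule cSup_upper)
  show "cmod (LINT t|lborel. hinner H (\<pi> (f t) (U t \<xi>)) \<eta>) \<in>
    {cmod (LINT t|lborel. hinner H (\<pi> (f t) (U t \<xi>)) \<eta>) | (H :: l2 hspace) \<pi> U \<xi> \<eta>.
       covariant_rep X act H \<pi> U \<and> \<xi> \<in> hcarrier H \<and> \<eta> \<in> hcarrier H \<and>
       hnorm H \<xi> \<le> 1 \<and> hnorm H \<eta> \<le> 1}" (is "_ \<in> ?S")
    using cov v by blast
  obtain T M where M: "0 \<le> M" "0 \<le> T" "\<And>t p. cmod (f t p) \<le> M * indicator {-T..T} t"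
    using Cc_bounds[OF f] by blast
  show "bdd_above ?S"
  proof (rule bdd_aboveI[of _ "M * (2 * T)"])
    fix y assume "y \<in> ?S"
    then obtain H :: "l2 hspace" and \<pi> U \<xi> \<eta> where y: "y = cmod (LINT t|lborel. hinner H (\<pi> (f t) (U t \<xi>)) \<eta>)"
      and cov': "covariant_rep X act H \<pi> U" and C: "\<xi> \<in> hcarrier H" "\<eta> \<in> hcarrier H"
      and n: "hnorm H \<xi> \<le> 1" "hnorm H \<eta> \<le> 1" by blast
    interpret covariant X act H \<pi> U by (rule covariant.intro[OF cov'])
    have "y \<le> M * (hnorm H \<xi> * hnorm H \<eta>) * (2 * T)"
      using mcoef_bound[OF f M(3,2) C] by (simp add: y mcoef_def coef_def)
    also have "\<dots> \<le> M * 1 * (2 * T)"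
      using M n C by (intro mult_right_mono mult_left_mono mult_le_one) auto
    finally show "y \<le> M * (2 * T)" by simp
  qed
qed

lemma Cc_add:
  assumes "f \<in> Cc X" "g \<in> Cc X" shows "(\<lambda>t p. f t p + g t p) \<in> Cc X"
proof -
  from assms obtain K K' where
    *: "continuous_on (UNIV \<times> X) (\<lambda>(t, p). f t p)" "continuous_on (UNIV \<times> X) (\<lambda>(t, p). g t p)"
    and K: "compact K" "K \<subseteq> UNIV \<times> X" "\<And>t p. (t, p) \<notin> K \<Longrightarrow> f t p = 0"
    and K': "compact K'" "K' \<subseteq> UNIV \<times> X" "\<And>t p. (t, p) \<notin> K' \<Longrightarrow> g t p = 0"
    by (auto simp: Cc_def)
  have "continuous_on (UNIV \<times> X) (\<lambda>(t, p). f t p + g t p)"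
    using continuous_on_add[OF *] by (simp add: case_prod_unfold)
  then show ?thesis
    unfolding Cc_def using K K' by (intro CollectI conjI exI[of _ "K \<union> K'"]) auto
qed

lemma Cc_scale:
  assumes "f \<in> Cc X" shows "(\<lambda>t p. c * f t p) \<in> Cc X"
proof -
  from assms obtain K where
    *: "continuous_on (UNIV \<times> X) (\<lambda>(t, p). f t p)"
    and K: "compact K" "K \<subseteq> UNIV \<times> X" "\<And>t p. (t, p) \<notin> K \<Longrightarrow> f t p = 0"
    by (auto simp: Cc_def)
  have "continuous_on (UNIV \<times> X) (\<lambda>(t, p). c * f t p)"
    using continuous_on_mult_left[OF *, of c] by (simp add: case_prod_unfold)
  then show ?thesis
    unfolding Cc_def using K by (intro CollectI conjI exI[of _ K]) auto
qed

section \<open>Free actions of the line, the regular covariant representations, and the universal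
  norm\<close>

locale transformation_group =
  fixes X :: "'x::metric_space set" and act :: "real \<Rightarrow> 'x \<Rightarrow> 'x"
  assumes action: "free_real_action X act" and nonempty: "X \<noteq> {}"
begin

lemma act_closed [simp]: "p \<in> X \<Longrightarrow> act t p \<in> X"
  and act_add: "p \<in> X \<Longrightarrow> act s (act t p) = act (s + t) p"
  and act_continuous: "continuous_on (UNIV \<times> X) (\<lambda>(t, p). act t p)"
  using action by (auto simp: free_real_action_def)

lemma orbit_continuous: "x \<in> X \<Longrightarrow> continuous_on S (\<lambda>s. act s x)"
  using continuous_on_compose2[OF act_continuous, of S "\<lambda>s. (s, x)"]
    continuous_on_Pair[OF continuous_on_id continuous_on_const, of S x]
  by (simp add: image_subset_iff)

lemma C0_orbit_continuous: "g \<in> acarrier (C0 X) \<Longrightarrow> x \<in> X \<Longrightarrow> continuous_on S (\<lambda>s. g (act s x))"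
  using continuous_on_compose2[OF _ orbit_continuous, of X g x S]
  by (auto simp: C0_carrier image_subset_iff)

lemma square_integrable_orbit:
  assumes "g \<in> acarrier (C0 X)" "x \<in> X" "square_integrable f"
  shows "square_integrable (\<lambda>s. g (act s x) * f s)"
proof -
  obtain c where "\<And>p. cmod (g p) \<le> c" using C0_bounded[OF assms(1)] by blast
  then show ?thesis
    using assms by (intro square_integrable_bounded_mult[where c = c])
      (auto intro: borel_measurable_continuous_onI C0_orbit_continuous)
qed

lemma hnorm_eps_tilde:
  assumes g: "g \<in> acarrier (C0 X)" and c: "\<And>p. cmod (g p) \<le> c" and x: "x \<in> X" and f: "square_integrable f"
  shows "hnorm L2R (eps_tilde act x g (l2_class f)) \<le> c * hnorm L2R (l2_class f)"
proof -
  have c0: "0 \<le> c" using c[of x] norm_ge_zero order_trans by blast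
  have "(LINT s|lborel. (cmod (g (act s x) * f s))\<^sup>2) \<le> (LINT s|lborel. c\<^sup>2 * (cmod (f s))\<^sup>2)"
    using f square_integrable_orbit[OF g x f] c
    by (intro integral_mono) (auto simp: square_integrable_def norm_mult power_mult_distrib
        intro!: mult_right_mono power_mono)
  also have "\<dots> = c\<^sup>2 * (LINT s|lborel. (cmod (f s))\<^sup>2)" by simp
  finally have "sqrt (LINT s|lborel. (cmod (g (act s x) * f s))\<^sup>2) \<le> c * sqrt (LINT s|lborel. (cmod (f s))\<^sup>2)"
    using c0 by (metis real_sqrt_le_iff real_sqrt_mult real_sqrt_abs abs_of_nonneg)
  then show ?thesis
    using f square_integrable_orbit[OF g x f] by (simp add: eps_tilde_l2_class hnorm_L2R)
qed

lemma star_rep_eps_tilde: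
  assumes x: "x \<in> X"
  shows "star_rep (C0 X) L2R (eps_tilde act x)"
  unfolding star_rep_def bounded_operator_def
proof (intro conjI ballI allI)
  fix g assume g: "g \<in> acarrier (C0 X)"
  note orb = square_integrable_orbit[OF g x]
  show "\<exists>c. \<forall>\<xi>\<in>hcarrier L2R. hnorm L2R (eps_tilde act x g \<xi>) \<le> c * hnorm L2R \<xi>"
  proof -
    obtain c where "\<And>p. cmod (g p) \<le> c" using C0_bounded[OF g] by blast
    then show ?thesis using hnorm_eps_tilde[OF g _ x] by (auto elim!: hcarrier_L2R_cases)
  qed
  show "eps_tilde act x g \<xi> \<in> hcarrier L2R" if "\<xi> \<in> hcarrier L2R" for \<xi>
    using that orb by (auto elim!: hcarrier_L2R_cases simp: eps_tilde_l2_class)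
  show "eps_tilde act x g (hadd L2R \<xi> \<eta>) = hadd L2R (eps_tilde act x g \<xi>) (eps_tilde act x g \<eta>)"
    if "\<xi> \<in> hcarrier L2R" "\<eta> \<in> hcarrier L2R" for \<xi> \<eta>
    using that orb by (auto elim!: hcarrier_L2R_cases simp: eps_tilde_l2_class hadd_L2R algebra_simps)
  show "eps_tilde act x g (hscale L2R c \<xi>) = hscale L2R c (eps_tilde act x g \<xi>)"
    if "\<xi> \<in> hcarrier L2R" for c \<xi>
    using that orb by (auto elim!: hcarrier_L2R_cases simp: eps_tilde_l2_class hscale_L2R algebra_simps)
  show "eps_tilde act x (ascale (C0 X) c g) \<xi> = hscale L2R c (eps_tilde act x g \<xi>)"
    if "\<xi> \<in> hcarrier L2R" for c \<xi>
    using that orb by (auto elim!: hcarrier_L2R_cases simp: eps_tilde_l2_class hscale_L2R algebra_simps C0_def)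
  fix \<xi> assume \<xi>: "\<xi> \<in> hcarrier L2R"
  show "eps_tilde act x (aadd (C0 X) g h) \<xi> = hadd L2R (eps_tilde act x g \<xi>) (eps_tilde act x h \<xi>)"
    "eps_tilde act x (amult (C0 X) g h) \<xi> = eps_tilde act x g (eps_tilde act x h \<xi>)"
    if h: "h \<in> acarrier (C0 X)" for h
    using \<xi> orb square_integrable_orbit[OF h x]
    by (auto elim!: hcarrier_L2R_cases simp: eps_tilde_l2_class hadd_L2R algebra_simps)
      (auto simp: C0_def algebra_simps)
  fix \<eta> assume "\<eta> \<in> hcarrier L2R"
  then obtain u v where uv: "square_integrable u" "\<xi> = l2_class u" "square_integrable v" "\<eta> = l2_class v"
    using \<xi> by (auto simp: hcarrier_L2R)
  have "(\<lambda>p. cnj (g p)) \<in> acarrier (C0 X)"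
    by (rule C0_dominated[OF g, where c = 1]) (use g in \<open>auto simp: C0_carrier intro!: continuous_intros\<close>)
  from square_integrable_orbit[OF this x]
  show "hinner L2R (eps_tilde act x (astar (C0 X) g) \<xi>) \<eta> = hinner L2R \<xi> (eps_tilde act x g \<eta>)"
    using uv orb by (simp add: eps_tilde_l2_class hinner_L2R C0_def mult_ac)
qed

lemma covariant_rep_regular:
  assumes x: "x \<in> X"
  shows "covariant_rep X act L2R (eps_tilde act x) left_regular"
  unfolding covariant_rep_def
proof (intro conjI allI ballI hilbert_space_L2R star_rep_eps_tilde x unitary_rep_left_regular)
  fix s g \<xi> assume g: "g \<in> acarrier (C0 X)" and "\<xi> \<in> hcarrier L2R"
  then obtain u where u: "square_integrable u" "\<xi> = l2_class u" by (auto simp: hcarrier_L2R)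
  have "lt X act s g (act r x) = g (act (r - s) x)" for r
    using x act_add[of x "-s" r] by (simp add: lt_def)
  then show "eps_tilde act x (lt X act s g) \<xi> =
      left_regular s (eps_tilde act x g (left_regular (- s) \<xi>))"
    using u square_integrable_orbit[OF g x square_integrable_shift[OF u(1), of "-s"]]
      square_integrable_shift[OF u(1), of "-s"] left_regular_l2_class[OF u(1), of "-s"]
    by (simp add: eps_tilde_l2_class left_regular_l2_class)
qed

abbreviation mc :: "'x \<Rightarrow> (real \<Rightarrow> 'x \<Rightarrow> complex) \<Rightarrow> l2 \<Rightarrow> l2 \<Rightarrow> complex" where
  "mc x \<equiv> covariant.mcoef L2R (eps_tilde act x) left_regular"

abbreviation intCc :: "'x \<Rightarrow> (real \<Rightarrow> 'x \<Rightarrow> complex) \<Rightarrow> l2 \<Rightarrow> l2" where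
  "intCc x \<equiv> integrated_Cc L2R (eps_tilde act x) left_regular"

lemma covariant_regular: "x \<in> X \<Longrightarrow> covariant X act L2R (eps_tilde act x) left_regular"
  by (rule covariant.intro) (rule covariant_rep_regular)

text \<open>The concrete kernel form on which all later computations rest: \<open>f t\<close> is
  evaluated along the orbit of x, and one vector is shifted by t.\<close>

lemma mc_eq:
  assumes x: "x \<in> X" and f: "f \<in> Cc X" and u: "square_integrable u" "square_integrable v"
  shows "mc x f (l2_class u) (l2_class v) = (LINT t|lborel. LINT s|lborel. f t (act s x) * u (s - t) * cnj (v s))"
  unfolding covariant_mcoef_eq[OF covariant_rep_regular[OF x]]
  using u square_integrable_orbit[OF Cc_slice[OF f] x]
  by (simp add: left_regular_l2_class eps_tilde_l2_class hinner_L2R)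

subsection \<open>The norm of the crossed product\<close>

abbreviation D where "D \<equiv> Cc_alg X act"

text \<open>A bound on every member bounds a real supremum only if the set is nonempty; the regular
  representation at any point of X, with zero vectors, provides a member.\<close>

lemma cp_norm_least:
  assumes "\<And>(H :: l2 hspace) \<pi> U \<xi> \<eta>. covariant_rep X act H \<pi> U \<Longrightarrow> \<xi> \<in> hcarrier H \<Longrightarrow> \<eta> \<in> hcarrier H \<Longrightarrow>
       hnorm H \<xi> \<le> 1 \<Longrightarrow> hnorm H \<eta> \<le> 1 \<Longrightarrow> cmod (covariant.mcoef H \<pi> U f \<xi> \<eta>) \<le> c"
  shows "cp_norm X act f \<le> c"
  unfolding cp_norm_def
proof (rule cSup_least)
  obtain x where x: "x \<in> X" using nonempty by blast
  have "hnorm L2R (hzero L2R) \<le> 1"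
    using L2R.hnorm_zero_iff[of "hzero L2R"] by simp
  then show "{cmod (LINT t|lborel. hinner H (\<pi> (f t) (U t \<xi>)) \<eta>) | (H :: l2 hspace) \<pi> U \<xi> \<eta>.
       covariant_rep X act H \<pi> U \<and> \<xi> \<in> hcarrier H \<and> \<eta> \<in> hcarrier H \<and>
       hnorm H \<xi> \<le> 1 \<and> hnorm H \<eta> \<le> 1} \<noteq> {}"
    using covariant_rep_regular[OF x] L2R.zero_closed by blast
qed (use assms covariant_mcoef_eq in fastforce)

lemma cp_norm_nonneg:
  assumes f: "f \<in> Cc X" shows "0 \<le> cp_norm X act f"
proof -
  obtain x where x: "x \<in> X" using nonempty by blast
  have "hnorm L2R (hzero L2R) \<le> 1"
    using L2R.hnorm_zero_iff[of "hzero L2R"] by simp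
  then show ?thesis
    using cp_norm_upper[OF covariant_rep_regular[OF x] f L2R.zero_closed L2R.zero_closed]
      norm_ge_zero order_trans by blast
qed

lemma cp_norm_add:
  assumes f: "f \<in> Cc X" "g \<in> Cc X"
  shows "cp_norm X act (\<lambda>t p. f t p + g t p) \<le> cp_norm X act f + cp_norm X act g"
proof (rule cp_norm_least)
  fix H :: "l2 hspace" and \<pi> U \<xi> \<eta> assume cov: "covariant_rep X act H \<pi> U"
    and v: "\<xi> \<in> hcarrier H" "\<eta> \<in> hcarrier H" "hnorm H \<xi> \<le> 1" "hnorm H \<eta> \<le> 1"
  interpret covariant X act H \<pi> U by (rule covariant.intro[OF cov])
  show "cmod (mcoef (\<lambda>t p. f t p + g t p) \<xi> \<eta>) \<le> cp_norm X act f + cp_norm X act g"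
    unfolding mcoef_add[OF f v(1,2)]
    by (rule norm_triangle_le) (intro add_mono cp_norm_upper[OF cov _ v] f)
qed

lemma cp_norm_scale:
  assumes f: "f \<in> Cc X"
  shows "cp_norm X act (\<lambda>t p. c * f t p) \<le> cmod c * cp_norm X act f"
proof (rule cp_norm_least)
  fix H :: "l2 hspace" and \<pi> U \<xi> \<eta> assume cov: "covariant_rep X act H \<pi> U"
    and v: "\<xi> \<in> hcarrier H" "\<eta> \<in> hcarrier H" "hnorm H \<xi> \<le> 1" "hnorm H \<eta> \<le> 1"
  interpret covariant X act H \<pi> U by (rule covariant.intro[OF cov])
  show "cmod (mcoef (\<lambda>t p. c * f t p) \<xi> \<eta>) \<le> cmod c * cp_norm X act f"
    unfolding mcoef_scale[OF f v(1,2)] norm_mult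
    by (intro mult_left_mono cp_norm_upper[OF cov f v]) simp
qed

lemma D_simps: "acarrier D = Cc X" "aadd D f g = (\<lambda>t p. f t p + g t p)"
  "ascale D c f = (\<lambda>t p. c * f t p)" "anorm D = cp_norm X act"
  by (simp_all add: Cc_alg_def)

lemma adist_D: "adist D f g = cp_norm X act (\<lambda>t p. f t p + (-1) * g t p)"
  by (simp add: adist_def D_simps)

lemma adist_nonneg: "f \<in> Cc X \<Longrightarrow> g \<in> Cc X \<Longrightarrow> 0 \<le> adist D f g"
  unfolding adist_D by (intro cp_norm_nonneg Cc_add Cc_scale)

lemma adist_self: assumes "f \<in> Cc X" shows "adist D f f = 0"
  using cp_norm_scale[OF assms, of 0] cp_norm_nonneg[OF Cc_scale[OF assms, of 0]] by (simp add: adist_D)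

lemma adist_commute_le:
  assumes "f \<in> Cc X" "g \<in> Cc X"
  shows "adist D f g \<le> adist D g f"
  using cp_norm_scale[OF Cc_add[OF assms(2) Cc_scale[OF assms(1), of "-1"]], of "-1"]
  by (simp add: adist_D algebra_simps)

lemma adist_commute: "f \<in> Cc X \<Longrightarrow> g \<in> Cc X \<Longrightarrow> adist D f g = adist D g f"
  using adist_commute_le[of f g] adist_commute_le[of g f] by simp

lemma adist_add:
  assumes "f \<in> Cc X" "g \<in> Cc X" "f' \<in> Cc X" "g' \<in> Cc X"
  shows "adist D (\<lambda>t p. f t p + g t p) (\<lambda>t p. f' t p + g' t p) \<le> adist D f f' + adist D g g'"
  using cp_norm_add[OF Cc_add[OF assms(1) Cc_scale[OF assms(3), of "-1"]]
      Cc_add[OF assms(2) Cc_scale[OF assms(4), of "-1"]]]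
  by (simp add: adist_D algebra_simps)

lemma adist_scale:
  assumes "f \<in> Cc X" "g \<in> Cc X"
  shows "adist D (\<lambda>t p. c * f t p) (\<lambda>t p. c * g t p) \<le> cmod c * adist D f g"
  using cp_norm_scale[OF Cc_add[OF assms(1) Cc_scale[OF assms(2), of "-1"]], of c]
  by (simp add: adist_D algebra_simps)

lemma cp_norm_diff_le:
  assumes "f \<in> Cc X" "g \<in> Cc X"
  shows "\<bar>cp_norm X act f - cp_norm X act g\<bar> \<le> adist D f g"
proof -
  have "cp_norm X act f \<le> adist D f g + cp_norm X act g" if "f \<in> Cc X" "g \<in> Cc X" for f g
    using cp_norm_add[OF Cc_add[OF that(1) Cc_scale[OF that(2), of "-1"]] that(2)] by (simp add: adist_D)
  from this[OF assms] this[OF assms(2,1)] show ?thesis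
    using adist_commute[OF assms] by linarith
qed

text \<open>The Lipschitz constant 1 is the same for all points x and all vectors in the unit ball.
  This uniformity survives the passage to the completion.\<close>

lemma mc_diff:
  assumes x: "x \<in> X" and f: "f \<in> Cc X" "g \<in> Cc X"
    and v: "\<xi> \<in> hcarrier L2R" "\<eta> \<in> hcarrier L2R" "hnorm L2R \<xi> \<le> 1" "hnorm L2R \<eta> \<le> 1"
  shows "cmod (mc x f \<xi> \<eta> - mc x g \<xi> \<eta>) \<le> adist D f g"
proof -
  interpret covariant X act L2R "eps_tilde act x" left_regular by (rule covariant_regular[OF x])
  have "mc x f \<xi> \<eta> - mc x g \<xi> \<eta> = mc x (\<lambda>t p. f t p + (-1) * g t p) \<xi> \<eta>"
    unfolding mcoef_add[OF f(1) Cc_scale[OF f(2)] v(1,2)] mcoef_scale[OF f(2) v(1,2)] by simp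
  then show ?thesis
    unfolding adist_D
    using cp_norm_upper[OF covariant Cc_add[OF f(1) Cc_scale[OF f(2), of "-1"]] v] by simp
qed

end

section \<open>The integrated form of an induced representation\<close>

lemma nn_integral_square_integrable:
  assumes "square_integrable f"
  obtains c where "0 \<le> c" "\<And>t. (\<integral>\<^sup>+s. ennreal ((cmod (f (s - t)))\<^sup>2) \<partial>lborel) = ennreal c"
proof -
  let ?c = "LINT s|lborel. (cmod (f s))\<^sup>2"
  have "(\<integral>\<^sup>+s. ennreal ((cmod (f (s - t)))\<^sup>2) \<partial>lborel) = ennreal ?c" for t
  proof -
    have "integrable lborel (\<lambda>s. (cmod (f (s - t)))\<^sup>2)"
      using square_integrable_shift[OF assms, of t] by (simp add: square_integrable_def)
    then show ?thesis
      by (simp add: nn_integral_eq_integral lborel_integral_shift[where f = "\<lambda>s. (cmod (f s))\<^sup>2"])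
  qed
  then show ?thesis using that[of ?c] by simp
qed

lemma nn_integral_indicator_Icc:
  assumes "0 \<le> T" "0 \<le> M"
  shows "(\<integral>\<^sup>+t. ennreal (M * indicator {-T..T} t) \<partial>lborel) = ennreal (M * (2 * T))"
  using assms by (simp add: ennreal_mult nn_integral_cmult ennreal_indicator emeasure_lborel_Icc_eq)

lemma measurable_shift2 [measurable]:
  fixes u :: "real \<Rightarrow> complex"
  assumes "u \<in> borel_measurable borel"
  shows "(\<lambda>q. u (fst q - snd q)) \<in> borel_measurable (borel \<Otimes>\<^sub>M borel)"
  by (rule measurable_compose[OF _ assms]) measurable

context
  fixes k :: "real \<Rightarrow> real \<Rightarrow> complex" and M T :: real
  assumes k_measurable [measurable]: "(\<lambda>q. k (fst q) (snd q)) \<in> borel_measurable (borel \<Otimes>\<^sub>M borel)"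
    and k_bound: "\<And>s t. cmod (k s t) \<le> M * indicator {-T..T} t"
    and MT: "0 \<le> M" "0 \<le> T"
begin

text \<open>For fixed s, Cauchy-Schwarz over the window [-T, T] bounds the square of the integral by
  M^2 2T times the integral of |u(s - t)|^2 over the window. Tonelli and translation invariance then
  give a finite integral in s.\<close>

lemma square_integrable_kernel:
  assumes u: "square_integrable u"
  shows "square_integrable (\<lambda>s. LINT t|lborel. k s t * u (s - t))"
proof -
  note [measurable] = u
  obtain c where c: "0 \<le> c" "\<And>t. (\<integral>\<^sup>+s. ennreal ((cmod (u (s - t)))\<^sup>2) \<partial>lborel) = ennreal c"
    using nn_integral_square_integrable[OF u] by blast
  have [measurable]: "(\<lambda>q. u (fst q - snd q)) \<in> borel_measurable (borel \<Otimes>\<^sub>M borel)"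
    by (rule measurable_shift2) (use u in measurable)
  have [measurable]: "(\<lambda>q. u (snd q - fst q)) \<in> borel_measurable (borel \<Otimes>\<^sub>M borel)"
    by (rule measurable_compose[of "\<lambda>q. snd q - fst q" _ borel]) (measurable, use u in measurable)
  let ?z = "\<lambda>s. LINT t|lborel. k s t * u (s - t)"
  let ?I = "\<lambda>t. indicator {-T..T} t :: real"
  have zm [measurable]: "?z \<in> borel_measurable borel"
  proof -
    have "(\<lambda>q. k (fst q) (snd q) * u (fst q - snd q)) \<in> borel_measurable (borel \<Otimes>\<^sub>M lborel)"
      by measurable
    then have "case_prod (\<lambda>s t. k s t * u (s - t)) \<in> borel_measurable (borel \<Otimes>\<^sub>M lborel)"
      by (simp add: case_prod_unfold)
    then show ?thesis by (rule lborel.borel_measurable_lebesgue_integral)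
  qed
  have pt: "ennreal ((cmod (?z s))\<^sup>2) \<le> ennreal (M\<^sup>2 * (2 * T)) * (\<integral>\<^sup>+t. ennreal (?I t * (cmod (u (s - t)))\<^sup>2) \<partial>lborel)" for s
  proof -
    have [measurable]: "(\<lambda>t. u (s - t)) \<in> borel_measurable borel"
      by (rule measurable_compose[of "\<lambda>t. s - t" borel borel]) (use u in \<open>auto simp: square_integrable_def\<close>)
    have "ennreal (cmod (?z s)) \<le> (\<integral>\<^sup>+t. ennreal (cmod (k s t * u (s - t))) \<partial>lborel)"
      using integral_norm_bound_ennreal[of lborel "\<lambda>t. k s t * u (s - t)"]
      by (cases "integrable lborel (\<lambda>t. k s t * u (s - t))") (auto simp: not_integrable_integral_eq)
    also have "\<dots> \<le> (\<integral>\<^sup>+t. ennreal (M * ?I t) * ennreal (?I t * cmod (u (s - t))) \<partial>lborel)"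
    proof (rule nn_integral_mono)
      fix t
      have "cmod (k s t * u (s - t)) \<le> (M * ?I t) * cmod (u (s - t))"
        unfolding norm_mult by (rule mult_right_mono[OF k_bound]) simp
      \<comment> \<open>The indicator equals its own square, so each Cauchy-Schwarz factor receives
        a copy; the first factor would otherwise have infinite integral for M > 0.\<close>
      also have "\<dots> = (M * ?I t) * (?I t * cmod (u (s - t)))" by (simp add: indicator_def)
      finally show "ennreal (cmod (k s t * u (s - t))) \<le> ennreal (M * ?I t) * ennreal (?I t * cmod (u (s - t)))"
        using MT by (simp add: ennreal_mult[symmetric] ennreal_leI)
    qed
    finally have "(ennreal (cmod (?z s)))\<^sup>2 \<le> (\<integral>\<^sup>+t. ennreal (M * ?I t) * ennreal (?I t * cmod (u (s - t))) \<partial>lborel)\<^sup>2"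
      by (rule power_mono) simp
    also have "\<dots> \<le> (\<integral>\<^sup>+t. (ennreal (M * ?I t))\<^sup>2 \<partial>lborel) * (\<integral>\<^sup>+t. (ennreal (?I t * cmod (u (s - t))))\<^sup>2 \<partial>lborel)"
      by (rule Cauchy_Schwarz_nn_integral) measurable
    also have "(\<lambda>t. (ennreal (M * ?I t))\<^sup>2) = (\<lambda>t. ennreal (M\<^sup>2 * ?I t))"
      using MT by (auto simp: ennreal_power indicator_def fun_eq_iff)
    also have "(\<lambda>t. (ennreal (?I t * cmod (u (s - t))))\<^sup>2) = (\<lambda>t. ennreal (?I t * (cmod (u (s - t)))\<^sup>2))"
      by (auto simp: ennreal_power indicator_def fun_eq_iff)
    also have "(\<integral>\<^sup>+t. ennreal (M\<^sup>2 * ?I t) \<partial>lborel) = ennreal (M\<^sup>2 * (2 * T))"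
      using MT by (intro nn_integral_indicator_Icc) auto
    finally show ?thesis by (simp add: ennreal_power)
  qed
  have "(\<integral>\<^sup>+s. ennreal ((cmod (?z s))\<^sup>2) \<partial>lborel) \<le>
      (\<integral>\<^sup>+s. ennreal (M\<^sup>2 * (2 * T)) * (\<integral>\<^sup>+t. ennreal (?I t * (cmod (u (s - t)))\<^sup>2) \<partial>lborel) \<partial>lborel)"
    by (rule nn_integral_mono) (rule pt)
  also have "\<dots> = ennreal (M\<^sup>2 * (2 * T)) * (\<integral>\<^sup>+s. (\<integral>\<^sup>+t. ennreal (?I t * (cmod (u (s - t)))\<^sup>2) \<partial>lborel) \<partial>lborel)"
    by (rule nn_integral_cmult) measurable
  also have "(\<integral>\<^sup>+s. (\<integral>\<^sup>+t. ennreal (?I t * (cmod (u (s - t)))\<^sup>2) \<partial>lborel) \<partial>lborel)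
      = (\<integral>\<^sup>+t. (\<integral>\<^sup>+s. ennreal (?I t * (cmod (u (s - t)))\<^sup>2) \<partial>lborel) \<partial>lborel)"
    by (rule lborel_pair.Fubini') measurable
  also have "\<dots> = (\<integral>\<^sup>+t. ennreal (?I t) * ennreal c \<partial>lborel)"
  proof (rule nn_integral_cong)
    fix t
    have [measurable]: "(\<lambda>s. u (s - t)) \<in> borel_measurable borel"
      using square_integrable_shift[OF u] by (rule square_integrable_measurable)
    show "(\<integral>\<^sup>+s. ennreal (?I t * (cmod (u (s - t)))\<^sup>2) \<partial>lborel) = ennreal (?I t) * ennreal c"
      unfolding c(2)[of t, symmetric]
      by (subst nn_integral_cmult[symmetric]) (auto simp: ennreal_mult)
  qed
  also have "\<dots> = ennreal (2 * T) * ennreal c"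
    using nn_integral_indicator_Icc[OF MT(2), of 1] by (subst nn_integral_multc) auto
  finally have "(\<integral>\<^sup>+s. ennreal (norm ((cmod (?z s))\<^sup>2)) \<partial>lborel) < \<infinity>"
    by (simp add: ennreal_mult_less_top le_less_trans)
  then have "integrable lborel (\<lambda>s. (cmod (?z s))\<^sup>2)"
    unfolding integrable_iff_bounded by (auto intro: borel_measurable_power borel_measurable_norm)
  then show ?thesis by (simp add: square_integrable_def)
qed

text \<open>Absolute integrability on the product follows from |u||v| <= |u|^2 + |v|^2: by
  translation invariance the double integral is at most M 2T times the sum of the squared norms of u
  and v.\<close>

lemma kernel_Fubini:
  assumes u: "square_integrable u" and v: "square_integrable v"
  shows "(LINT s|lborel. (LINT t|lborel. k s t * u (s - t)) * cnj (v s)) =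
    (LINT t|lborel. LINT s|lborel. k s t * u (s - t) * cnj (v s))"
proof -
  note [measurable] = u v
  obtain c where c: "0 \<le> c" "\<And>t. (\<integral>\<^sup>+s. ennreal ((cmod (u (s - t)))\<^sup>2) \<partial>lborel) = ennreal c"
    using nn_integral_square_integrable[OF u] by blast
  obtain c' where c': "0 \<le> c'" "\<And>t. (\<integral>\<^sup>+s. ennreal ((cmod (v (s - t)))\<^sup>2) \<partial>lborel) = ennreal c'"
    using nn_integral_square_integrable[OF v] by blast
  have [measurable]: "(\<lambda>q. u (fst q - snd q)) \<in> borel_measurable (borel \<Otimes>\<^sub>M borel)"
    by (rule measurable_shift2) (use u in measurable)
  have [measurable]: "(\<lambda>q. v (fst q)) \<in> borel_measurable (borel \<Otimes>\<^sub>M borel)"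
    by (rule measurable_compose[OF measurable_fst]) (use v in measurable)
  let ?F = "\<lambda>s t. k s t * u (s - t) * cnj (v s)"
  let ?I = "\<lambda>t. indicator {-T..T} t :: real"
  have Fm [measurable]: "(\<lambda>(s, t). ?F s t) \<in> borel_measurable (lborel \<Otimes>\<^sub>M lborel)"
    unfolding case_prod_unfold by measurable
  have "(\<integral>\<^sup>+q. ennreal (norm (case q of (s, t) \<Rightarrow> ?F s t)) \<partial>(lborel \<Otimes>\<^sub>M lborel))
      = (\<integral>\<^sup>+t. (\<integral>\<^sup>+s. ennreal (norm (?F s t)) \<partial>lborel) \<partial>lborel)"
    using lborel_pair.nn_integral_snd[of "\<lambda>q. ennreal (norm (case q of (s, t) \<Rightarrow> ?F s t))"] by simp
  also have "\<dots> \<le> (\<integral>\<^sup>+t. ennreal (M * ?I t) * ennreal (c + c') \<partial>lborel)"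
  proof (rule nn_integral_mono)
    fix t
    have [measurable]: "(\<lambda>s. u (s - t)) \<in> borel_measurable borel"
      using square_integrable_shift[OF u] by (rule square_integrable_measurable)
    \<comment> \<open>Writing v(s) as v(s - 0) lets the translation-invariant value
      \<open>c'\<close> be read off in the same form as for u.\<close>
    have "(\<integral>\<^sup>+s. ennreal (norm (?F s t)) \<partial>lborel) \<le>
       (\<integral>\<^sup>+s. ennreal (M * ?I t) * (ennreal ((cmod (u (s - t)))\<^sup>2) + ennreal ((cmod (v (s - 0)))\<^sup>2)) \<partial>lborel)"
    proof (rule nn_integral_mono)
      fix s
      have "cmod (u (s - t)) * cmod (v s) \<le> (cmod (u (s - t)))\<^sup>2 + (cmod (v s))\<^sup>2"
        using sum_squares_bound[of "cmod (u (s - t))" "cmod (v s)"]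
          mult_nonneg_nonneg[OF norm_ge_zero norm_ge_zero, of "u (s - t)" "v s"] unfolding mult.assoc by linarith
      then have "norm (?F s t) \<le> M * ?I t * ((cmod (u (s - t)))\<^sup>2 + (cmod (v s))\<^sup>2)"
        unfolding norm_mult complex_mod_cnj mult.assoc
        by (subst mult.assoc[symmetric]) (rule mult_mono[OF k_bound], use MT in auto)
      then show "ennreal (norm (?F s t)) \<le>
          ennreal (M * ?I t) * (ennreal ((cmod (u (s - t)))\<^sup>2) + ennreal ((cmod (v (s - 0)))\<^sup>2))"
        using MT by (simp flip: ennreal_plus ennreal_mult add: ennreal_leI)
    qed
    also have "\<dots> = ennreal (M * ?I t) * (\<integral>\<^sup>+s. (ennreal ((cmod (u (s - t)))\<^sup>2) + ennreal ((cmod (v (s - 0)))\<^sup>2)) \<partial>lborel)"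
      by (rule nn_integral_cmult) simp
    also have "(\<integral>\<^sup>+s. (ennreal ((cmod (u (s - t)))\<^sup>2) + ennreal ((cmod (v (s - 0)))\<^sup>2)) \<partial>lborel) = ennreal (c + c')"
      using c(1) c'(1) by (subst nn_integral_add) (simp_all only: c(2) c'(2) ennreal_plus, auto)
    finally show "(\<integral>\<^sup>+s. ennreal (norm (?F s t)) \<partial>lborel) \<le> ennreal (M * ?I t) * ennreal (c + c')" .
  qed
  also have "\<dots> = ennreal (M * (2 * T)) * ennreal (c + c')"
    using nn_integral_indicator_Icc[OF MT(2,1)] by (subst nn_integral_multc) auto
  finally have "(\<integral>\<^sup>+q. ennreal (norm (case q of (s, t) \<Rightarrow> ?F s t)) \<partial>(lborel \<Otimes>\<^sub>M lborel)) < \<infinity>"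
    by (simp add: ennreal_mult_less_top le_less_trans)
  then have "integrable (lborel \<Otimes>\<^sub>M lborel) (\<lambda>(s, t). ?F s t)"
    unfolding integrable_iff_bounded using Fm by simp
  from lborel_pair.Fubini_integral[OF this]
  show ?thesis by simp
qed

end

context transformation_group
begin

text \<open>The witness is the function sending s to the integral over t of f(t, s x) u(s - t).
  Since \<open>integrated_Cc\<close> is a definite description, existence has to be proved before
  the operator can be used; uniqueness is nondegeneracy of the inner product.\<close>

lemma intCc_exists:
  assumes x: "x \<in> X" and f: "f \<in> Cc X" and \<xi>: "\<xi> \<in> hcarrier L2R"
  shows "\<exists>\<zeta>\<in>hcarrier L2R. \<forall>\<eta>\<in>hcarrier L2R. hinner L2R \<zeta> \<eta> = mc x f \<xi> \<eta>"
proof -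
  obtain u where u: "square_integrable u" "\<xi> = l2_class u" using \<xi> by (auto simp: hcarrier_L2R)
  obtain M T where M: "0 \<le> M" "0 \<le> T" "\<And>t p. cmod (f t p) \<le> M * indicator {-T..T} t"
    using Cc_bounds[OF f] by blast
  have "continuous_on (UNIV \<times> X) (\<lambda>(t, p). f t p)" using f by (simp add: Cc_def)
  then have "continuous_on UNIV (\<lambda>q. case (snd q, act (fst q) x) of (t, p) \<Rightarrow> f t p)"
    by (rule continuous_on_compose2)
      (use x in \<open>auto intro!: continuous_on_Pair continuous_on_snd continuous_on_id
        continuous_on_compose2[OF orbit_continuous[OF x, of UNIV], of _ fst] continuous_on_fst\<close>)
  then have "(\<lambda>q :: real \<times> real. f (snd q) (act (fst q) x)) \<in> borel_measurable borel"
    by (intro borel_measurable_continuous_onI) simp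
  then have km: "(\<lambda>q :: real \<times> real. f (snd q) (act (fst q) x)) \<in> borel_measurable (borel \<Otimes>\<^sub>M borel)"
    by (simp add: borel_prod)
  note kernel = km M(3) M(1,2)
  let ?z = "\<lambda>s. LINT t|lborel. f t (act s x) * u (s - t)"
  have z: "square_integrable ?z" by (rule square_integrable_kernel[OF kernel u(1)])
  have "hinner L2R (l2_class ?z) \<eta> = mc x f \<xi> \<eta>" if \<eta>: "\<eta> \<in> hcarrier L2R" for \<eta>
  proof -
    obtain v where v: "square_integrable v" "\<eta> = l2_class v" using \<eta> by (auto simp: hcarrier_L2R)
    show ?thesis unfolding u(2) v(2) mc_eq[OF x f u(1) v(1)] hinner_L2R[OF z v(1)]
      by (rule kernel_Fubini[OF kernel u(1) v(1)])
  qed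
  then show ?thesis using z by (intro bexI[of _ "l2_class ?z"]) auto
qed

lemma
  assumes x: "x \<in> X" and f: "f \<in> Cc X" and \<xi>: "\<xi> \<in> hcarrier L2R"
  shows intCc_closed: "intCc x f \<xi> \<in> hcarrier L2R"
    and inner_intCc: "\<eta> \<in> hcarrier L2R \<Longrightarrow> hinner L2R (intCc x f \<xi>) \<eta> = mc x f \<xi> \<eta>"
proof -
  let ?P = "\<lambda>\<zeta>. \<zeta> \<in> hcarrier L2R \<and> (\<forall>\<eta>\<in>hcarrier L2R. hinner L2R \<zeta> \<eta> = mc x f \<xi> \<eta>)"
  have "\<exists>!\<zeta>. ?P \<zeta>"
  proof (rule ex_ex1I)
    show "\<exists>\<zeta>. ?P \<zeta>" using intCc_exists[OF assms] by blast
    show "\<zeta> = \<zeta>'" if "?P \<zeta>" "?P \<zeta>'" for \<zeta> \<zeta>'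
      by (rule L2R.inner_ext) (use that in auto)
  qed
  then have "?P (THE \<zeta>. ?P \<zeta>)" by (rule theI')
  moreover have "intCc x f \<xi> = (THE \<zeta>. ?P \<zeta>)"
    by (simp add: integrated_Cc_def covariant_mcoef_eq[OF covariant_rep_regular[OF x]])
  ultimately show "intCc x f \<xi> \<in> hcarrier L2R"
    and "\<eta> \<in> hcarrier L2R \<Longrightarrow> hinner L2R (intCc x f \<xi>) \<eta> = mc x f \<xi> \<eta>" by auto
qed

text \<open>Testing the difference v against v / norm(v) recovers its norm as a difference of matrix
  coefficients, which the universal norm controls. If v has norm 0 there is nothing to
  normalise.\<close>

lemma hdist_intCc:
  assumes x: "x \<in> X" and f: "f \<in> Cc X" "g \<in> Cc X" and \<xi>: "\<xi> \<in> hcarrier L2R" "hnorm L2R \<xi> \<le> 1"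
  shows "hdist L2R (intCc x f \<xi>) (intCc x g \<xi>) \<le> adist D f g"
proof -
  define v where "v = hminus L2R (intCc x f \<xi>) (intCc x g \<xi>)"
  have v: "v \<in> hcarrier L2R" using x f \<xi> by (simp add: v_def intCc_closed)
  have d: "hdist L2R (intCc x f \<xi>) (intCc x g \<xi>) = hnorm L2R v"
    by (simp add: v_def hdist_eq_hnorm_hminus)
  show ?thesis
  proof (cases "hnorm L2R v = 0")
    case True
    then show ?thesis using d adist_nonneg[OF f] by simp
  next
    case False
    define w where "w = hscale L2R (of_real (1 / hnorm L2R v)) v"
    have w: "w \<in> hcarrier L2R" "hnorm L2R w = 1"
      using v False by (auto simp: w_def L2R.hnorm_scale norm_divide)
    have "hinner L2R v w = of_real (hnorm L2R v)"
      using v False by (simp add: w_def L2R.inner_scale_right L2R.inner_self power2_eq_square)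
    moreover have "hinner L2R v w = mc x f \<xi> w - mc x g \<xi> w"
      using x f \<xi> w by (simp add: v_def L2R.inner_diff_left intCc_closed inner_intCc)
    ultimately have "hnorm L2R v = cmod (mc x f \<xi> w - mc x g \<xi> w)"
      using v by (metis L2R.hnorm_nonneg norm_of_real abs_of_nonneg)
    also have "\<dots> \<le> adist D f g" by (rule mc_diff[OF x f \<xi>(1) w(1) \<xi>(2)]) (simp add: w)
    finally show ?thesis by (simp add: d)
  qed
qed

end

section \<open>Vector functionals on the crossed product\<close>

context transformation_group
begin

abbreviation A where "A \<equiv> crossed_product X act"

lemma cauchy_seq_closed: "cauchy_seq D F \<Longrightarrow> F k \<in> Cc X"
  by (simp add: cauchy_seq_def D_simps)

lemma cauchy_seqD: "cauchy_seq D F \<Longrightarrow> e > 0 \<Longrightarrow> \<exists>M. \<forall>m\<ge>M. \<forall>n\<ge>M. adist D (F m) (F n) < e"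
  by (simp add: cauchy_seq_def)

lemma cauchy_class_self: "cauchy_seq D F \<Longrightarrow> F \<in> cauchy_class D F"
  by (simp add: cauchy_class_def adist_self cauchy_seq_closed)

lemma acarrier_A: "acarrier A = cauchy_class D ` {F. cauchy_seq D F}"
  by (simp add: crossed_product_def completion_def)

lemma cauchy_repr_in:
  assumes "a \<in> acarrier A" shows "cauchy_repr a \<in> a"
proof -
  obtain F where "cauchy_seq D F" "a = cauchy_class D F" using assms by (auto simp: acarrier_A)
  then have "F \<in> a" by (simp add: cauchy_class_self)
  then show ?thesis unfolding cauchy_repr_def by (rule someI[of "\<lambda>F. F \<in> a"])
qed

lemma member_cauchy_seq: "a \<in> acarrier A \<Longrightarrow> F \<in> a \<Longrightarrow> cauchy_seq D F"
  by (auto simp: acarrier_A cauchy_class_def)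

lemma cauchy_repr_cauchy: "a \<in> acarrier A \<Longrightarrow> cauchy_seq D (cauchy_repr a)"
  by (rule member_cauchy_seq) (auto intro: cauchy_repr_in)

lemma cauchy_seq_const: "f \<in> Cc X \<Longrightarrow> cauchy_seq D (\<lambda>k. f)"
  by (simp add: cauchy_seq_def adist_self D_simps)

lemma cauchy_seq_add:
  assumes "cauchy_seq D F" "cauchy_seq D G"
  shows "cauchy_seq D (\<lambda>k. aadd D (F k) (G k))"
  unfolding cauchy_seq_def
proof (intro conjI allI impI)
  note closed = cauchy_seq_closed[OF assms(1)] cauchy_seq_closed[OF assms(2)]
  show "aadd D (F k) (G k) \<in> acarrier D" for k by (simp add: D_simps Cc_add closed)
  fix e :: real assume "e > 0"
  then obtain M M' where M: "\<forall>m\<ge>M. \<forall>n\<ge>M. adist D (F m) (F n) < e / 2"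
    and M': "\<forall>m\<ge>M'. \<forall>n\<ge>M'. adist D (G m) (G n) < e / 2"
    using cauchy_seqD[OF assms(1), of "e / 2"] cauchy_seqD[OF assms(2), of "e / 2"] by auto
  have "adist D (aadd D (F m) (G m)) (aadd D (F n) (G n)) < e" if "m \<ge> max M M'" "n \<ge> max M M'" for m n
  proof -
    have "adist D (F m) (F n) < e / 2" "adist D (G m) (G n) < e / 2" using M M' that by auto
    then show ?thesis
      using adist_add[OF closed(1)[of m] closed(2)[of m] closed(1)[of n] closed(2)[of n]]
      by (simp add: D_simps)
  qed
  then show "\<exists>M. \<forall>m\<ge>M. \<forall>n\<ge>M. adist D (aadd D (F m) (G m)) (aadd D (F n) (G n)) < e" by blast
qed

lemma cauchy_seq_scale:
  assumes "cauchy_seq D F"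
  shows "cauchy_seq D (\<lambda>k. ascale D c (F k))"
  unfolding cauchy_seq_def
proof (intro conjI allI impI)
  note closed = cauchy_seq_closed[OF assms]
  show "ascale D c (F k) \<in> acarrier D" for k by (simp add: D_simps Cc_scale closed)
  fix e :: real assume "e > 0"
  then have "e / (cmod c + 1) > 0" by (simp add: add_nonneg_pos)
  then obtain M where M: "\<forall>m\<ge>M. \<forall>n\<ge>M. adist D (F m) (F n) < e / (cmod c + 1)"
    using cauchy_seqD[OF assms] by blast
  have "adist D (ascale D c (F m)) (ascale D c (F n)) < e" if "m \<ge> M" "n \<ge> M" for m n
  proof -
    have "adist D (ascale D c (F m)) (ascale D c (F n)) \<le> cmod c * adist D (F m) (F n)"
      using adist_scale[OF closed closed] by (simp add: D_simps)
    also have "\<dots> \<le> (cmod c + 1) * adist D (F m) (F n)"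
      by (intro mult_right_mono adist_nonneg closed) simp
    also have "\<dots> < (cmod c + 1) * (e / (cmod c + 1))"
      using M that by (intro mult_strict_left_mono) (auto simp: add_nonneg_pos)
    also have "\<dots> = e" by (simp add: add_nonneg_eq_0_iff)
    finally show ?thesis .
  qed
  then show "\<exists>M. \<forall>m\<ge>M. \<forall>n\<ge>M. adist D (ascale D c (F m)) (ascale D c (F n)) < e" by blast
qed

lemma aadd_A: "aadd A a b = cauchy_class D (\<lambda>k. aadd D (cauchy_repr a k) (cauchy_repr b k))"
  and ascale_A: "ascale A c a = cauchy_class D (\<lambda>k. ascale D c (cauchy_repr a k))"
  and anorm_A: "anorm A a = lim (\<lambda>k. cp_norm X act (cauchy_repr a k))"
  by (simp_all add: crossed_product_def completion_def D_simps)

lemma anorm_A_limit: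
  assumes a: "a \<in> acarrier A"
  shows "(\<lambda>k. cp_norm X act (cauchy_repr a k)) \<longlonglongrightarrow> anorm A a"
proof -
  let ?F = "cauchy_repr a"
  note F = cauchy_repr_cauchy[OF a]
  have "Cauchy (\<lambda>k. cp_norm X act (?F k))"
  proof (rule metric_CauchyI)
    fix e :: real assume "e > 0"
    then obtain M where "\<forall>m\<ge>M. \<forall>n\<ge>M. adist D (?F m) (?F n) < e" using cauchy_seqD[OF F] by blast
    then show "\<exists>M. \<forall>m\<ge>M. \<forall>n\<ge>M. dist (cp_norm X act (?F m)) (cp_norm X act (?F n)) < e"
      using cp_norm_diff_le[OF cauchy_seq_closed[OF F] cauchy_seq_closed[OF F]]
      unfolding dist_real_def by (meson le_less_trans)
  qed
  then show ?thesis unfolding anorm_A by (simp add: Cauchy_convergent_iff convergent_LIMSEQ_iff)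
qed

text \<open>Makes the definite description in \<open>integrated_form\<close> meaningful: images of a
  Cauchy sequence converge by completeness, equivalent sequences share the limit, and a limit is
  unique.\<close>

lemma integrated_form_limit:
  assumes x: "x \<in> X" and a: "a \<in> acarrier A" and F: "F \<in> a"
    and \<xi>: "\<xi> \<in> hcarrier L2R" "hnorm L2R \<xi> \<le> 1"
  shows "integrated_form L2R (eps_tilde act x) left_regular a \<xi> \<in> hcarrier L2R \<and>
    (\<lambda>k. hdist L2R (intCc x (F k) \<xi>) (integrated_form L2R (eps_tilde act x) left_regular a \<xi>)) \<longlonglongrightarrow> 0"
proof -
  obtain G where G: "cauchy_seq D G" "a = cauchy_class D G" using a by (auto simp: acarrier_A)
  note Gc = cauchy_seq_closed[OF G(1)]
  have IG: "intCc x (G k) \<xi> \<in> hcarrier L2R" for k by (rule intCc_closed[OF x Gc \<xi>(1)])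
  have "\<exists>M. \<forall>m\<ge>M. \<forall>n\<ge>M. hdist L2R (intCc x (G m) \<xi>) (intCc x (G n) \<xi>) < e" if "e > 0" for e
    using cauchy_seqD[OF G(1) that] hdist_intCc[OF x Gc Gc \<xi>] by (meson le_less_trans)
  then obtain \<zeta> where \<zeta>: "\<zeta> \<in> hcarrier L2R" "(\<lambda>k. hdist L2R (intCc x (G k) \<xi>) \<zeta>) \<longlonglongrightarrow> 0"
    using L2R.complete[of "\<lambda>k. intCc x (G k) \<xi>"] IG by blast
  let ?P = "\<lambda>\<zeta>. \<zeta> \<in> hcarrier L2R \<and> (\<forall>F\<in>a. (\<lambda>k. hdist L2R (intCc x (F k) \<xi>) \<zeta>) \<longlonglongrightarrow> 0)"
  have P: "?P \<zeta>"
  proof (intro conjI ballI \<zeta>(1))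
    fix F assume "F \<in> a"
    then have F: "cauchy_seq D F" "(\<lambda>k. adist D (G k) (F k)) \<longlonglongrightarrow> 0"
      by (auto simp: G(2) cauchy_class_def)
    note Fc = cauchy_seq_closed[OF F(1)]
    have IF: "intCc x (F k) \<xi> \<in> hcarrier L2R" for k by (rule intCc_closed[OF x Fc \<xi>(1)])
    have lim: "(\<lambda>k. adist D (G k) (F k) + hdist L2R (intCc x (G k) \<xi>) \<zeta>) \<longlonglongrightarrow> 0"
      using tendsto_add[OF F(2) \<zeta>(2)] by simp
    show "(\<lambda>k. hdist L2R (intCc x (F k) \<xi>) \<zeta>) \<longlonglongrightarrow> 0"
    proof (rule tendsto_sandwich[OF _ _ tendsto_const lim]; intro always_eventually allI)
      fix k
      show "0 \<le> hdist L2R (intCc x (F k) \<xi>) \<zeta>" using IF \<zeta>(1) by simp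
      show "hdist L2R (intCc x (F k) \<xi>) \<zeta> \<le> adist D (G k) (F k) + hdist L2R (intCc x (G k) \<xi>) \<zeta>"
        using L2R.hdist_triangle[OF IF IG \<zeta>(1), of k k] hdist_intCc[OF x Fc Gc \<xi>, of k k]
          adist_commute[OF Fc Gc, of k k] by linarith
    qed
  qed
  have uniq: "\<zeta>' = \<zeta>''" if "?P \<zeta>'" "?P \<zeta>''" for \<zeta>' \<zeta>''
  proof -
    have "G \<in> a" using G by (simp add: cauchy_class_self)
    then have l: "(\<lambda>k. hdist L2R (intCc x (G k) \<xi>) \<zeta>' + hdist L2R (intCc x (G k) \<xi>) \<zeta>'') \<longlonglongrightarrow> 0 + 0"
      using that by (intro tendsto_add) auto
    have "hdist L2R \<zeta>' \<zeta>'' \<le> hdist L2R (intCc x (G k) \<xi>) \<zeta>' + hdist L2R (intCc x (G k) \<xi>) \<zeta>''" for k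
      using L2R.hdist_triangle[of \<zeta>' "intCc x (G k) \<xi>" \<zeta>''] that IG
        L2R.hdist_commute[of \<zeta>' "intCc x (G k) \<xi>"] by simp
    then have "hdist L2R \<zeta>' \<zeta>'' \<le> 0 + 0"
      by (intro LIMSEQ_le_const[OF l]) auto
    moreover have "0 \<le> hdist L2R \<zeta>' \<zeta>''" using that by (intro L2R.hdist_nonneg) auto
    ultimately have "hdist L2R \<zeta>' \<zeta>'' = 0" by linarith
    then show ?thesis using that L2R.hdist_zero[of \<zeta>' \<zeta>''] by simp
  qed
  have "?P (THE \<zeta>. ?P \<zeta>)"
    by (rule theI[of ?P, OF P]) (rule uniq[OF _ P])
  then show ?thesis using F unfolding integrated_form_def by blast
qed

lemma vector_functional_limit:
  assumes x: "x \<in> X" and a: "a \<in> acarrier A" and F: "F \<in> a"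
    and \<xi>: "\<xi> \<in> hcarrier L2R" "hnorm L2R \<xi> = 1"
  shows "(\<lambda>k. mc x (F k) \<xi> \<xi>) \<longlonglongrightarrow> vector_functional (Ind_eps act x) \<xi> a"
proof -
  let ?z = "integrated_form L2R (eps_tilde act x) left_regular a \<xi>"
  have z: "?z \<in> hcarrier L2R" "(\<lambda>k. hdist L2R (intCc x (F k) \<xi>) ?z) \<longlonglongrightarrow> 0"
    using integrated_form_limit[OF x a F \<xi>(1)] \<xi>(2) by auto
  have Fc: "F k \<in> Cc X" for k by (rule cauchy_seq_closed[OF member_cauchy_seq[OF a F]])
  have I: "intCc x (F k) \<xi> \<in> hcarrier L2R" for k by (rule intCc_closed[OF x Fc \<xi>(1)])
  have "(\<lambda>k. mc x (F k) \<xi> \<xi> - hinner L2R ?z \<xi>) \<longlonglongrightarrow> 0"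
  proof (rule Lim_null_comparison[OF always_eventually z(2)], rule allI)
    fix k
    have "mc x (F k) \<xi> \<xi> - hinner L2R ?z \<xi> = hinner L2R (hminus L2R (intCc x (F k) \<xi>) ?z) \<xi>"
      using I z(1) \<xi>(1) inner_intCc[OF x Fc \<xi>(1) \<xi>(1)] by (simp add: L2R.inner_diff_left)
    then show "norm (mc x (F k) \<xi> \<xi> - hinner L2R ?z \<xi>) \<le> hdist L2R (intCc x (F k) \<xi>) ?z"
      using L2R.Cauchy_Schwarz[of "hminus L2R (intCc x (F k) \<xi>) ?z" \<xi>] I z(1) \<xi>
      by (simp add: hdist_eq_hnorm_hminus)
  qed
  then show ?thesis by (simp add: vector_functional_def Ind_eps_def LIM_zero_iff)
qed

text \<open>The sets in \<open>weak_star_base\<close> consist of bounded linear functionals, so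
  membership in \<open>Vec\<close> requires this. Each clause is the limit of the corresponding fact
  for \<open>mc\<close> along representing sequences.\<close>

lemma vector_functional_dual:
  assumes x: "x \<in> X" and \<xi>: "\<xi> \<in> hcarrier L2R" "hnorm L2R \<xi> = 1"
  shows "vector_functional (Ind_eps act x) \<xi> \<in> dual_space A"
  unfolding dual_space_def
proof (intro CollectI conjI ballI allI)
  interpret covariant X act L2R "eps_tilde act x" left_regular by (rule covariant_regular[OF x])
  let ?v = "vector_functional (Ind_eps act x) \<xi>"
  fix a assume a: "a \<in> acarrier A"
  note Fa = cauchy_repr_in[OF a] cauchy_repr_cauchy[OF a]
  note Fac = cauchy_seq_closed[OF Fa(2)]
  note la = vector_functional_limit[OF x a Fa(1) \<xi>]
  {
    fix b assume b: "b \<in> acarrier A"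
    note Fb = cauchy_repr_in[OF b] cauchy_repr_cauchy[OF b]
    \<comment> \<open>The termwise sum of the chosen representatives belongs to the class
      \<open>aadd A a b\<close>, so the functional may be evaluated along this sequence although
      \<open>cauchy_repr\<close> may pick another one.\<close>
    note S = cauchy_seq_add[OF Fa(2) Fb(2)]
    have "aadd A a b \<in> acarrier A" unfolding aadd_A acarrier_A using S by blast
    from vector_functional_limit[OF x this _ \<xi>, unfolded aadd_A, OF cauchy_class_self[OF S]]
    have "(\<lambda>k. mc x (cauchy_repr a k) \<xi> \<xi> + mc x (cauchy_repr b k) \<xi> \<xi>) \<longlonglongrightarrow> ?v (aadd A a b)"
      using mcoef_add[OF Fac cauchy_seq_closed[OF Fb(2)] \<xi>(1) \<xi>(1)] by (simp add: D_simps aadd_A)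
    from LIMSEQ_unique[OF this tendsto_add[OF la vector_functional_limit[OF x b Fb(1) \<xi>]]]
    show "?v (aadd A a b) = ?v a + ?v b" .
  }
  {
    fix c
    note S = cauchy_seq_scale[OF Fa(2), of c]
    have "ascale A c a \<in> acarrier A" unfolding ascale_A acarrier_A using S by blast
    from vector_functional_limit[OF x this _ \<xi>, unfolded ascale_A, OF cauchy_class_self[OF S]]
    have "(\<lambda>k. c * mc x (cauchy_repr a k) \<xi> \<xi>) \<longlonglongrightarrow> ?v (ascale A c a)"
      using mcoef_scale[OF Fac \<xi>(1) \<xi>(1)] by (simp add: D_simps ascale_A)
    from LIMSEQ_unique[OF this tendsto_mult_left[OF la]]
    show "?v (ascale A c a) = c * ?v a" .
  }
next
  let ?v = "vector_functional (Ind_eps act x) \<xi>"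
  have "cmod (?v a) \<le> 1 * anorm A a" if a: "a \<in> acarrier A" for a
  proof -
    note Fa = cauchy_repr_in[OF a] cauchy_repr_cauchy[OF a]
    have "cmod (mc x (cauchy_repr a k) \<xi> \<xi>) \<le> cp_norm X act (cauchy_repr a k)" for k
      using \<xi> by (intro cp_norm_upper[OF covariant_rep_regular[OF x] cauchy_seq_closed[OF Fa(2)]]) auto
    then show ?thesis
      using LIMSEQ_le[OF tendsto_norm[OF vector_functional_limit[OF x a Fa(1) \<xi>]] anorm_A_limit[OF a]]
      by simp
  qed
  then show "\<exists>C. \<forall>a\<in>acarrier A. cmod (?v a) \<le> C * anorm A a" by blast
qed

text \<open>The function is a late term of a representing Cauchy sequence. Since
  \<open>mc_diff\<close> is uniform, a single \<open>f\<close> serves all orbits and all unit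
  vectors, which is essential for comparing x_n with x_0 as n varies.\<close>

lemma vector_functional_approx:
  assumes a: "a \<in> acarrier A" and e: "e > 0"
  shows "\<exists>f\<in>Cc X. \<forall>x\<in>X. \<forall>\<xi>\<in>hcarrier L2R. hnorm L2R \<xi> = 1 \<longrightarrow>
    cmod (vector_functional (Ind_eps act x) \<xi> a - mc x f \<xi> \<xi>) \<le> e"
proof -
  let ?F = "cauchy_repr a"
  note Fa = cauchy_repr_in[OF a] cauchy_repr_cauchy[OF a]
  note Fc = cauchy_seq_closed[OF Fa(2)]
  obtain M where M: "\<forall>m\<ge>M. \<forall>n\<ge>M. adist D (?F m) (?F n) < e" using cauchy_seqD[OF Fa(2) e] by blast
  show ?thesis
  proof (intro bexI[of _ "?F M"] ballI impI Fc)
    fix x \<xi> assume x: "x \<in> X" and \<xi>: "\<xi> \<in> hcarrier L2R" "hnorm L2R \<xi> = 1"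
    have "(\<lambda>k. cmod (mc x (?F k) \<xi> \<xi> - mc x (?F M) \<xi> \<xi>)) \<longlonglongrightarrow>
        cmod (vector_functional (Ind_eps act x) \<xi> a - mc x (?F M) \<xi> \<xi>)"
      by (intro tendsto_intros vector_functional_limit[OF x a Fa(1) \<xi>])
    moreover have "cmod (mc x (?F k) \<xi> \<xi> - mc x (?F M) \<xi> \<xi>) \<le> e" if "k \<ge> M" for k
    proof -
      have "cmod (mc x (?F k) \<xi> \<xi> - mc x (?F M) \<xi> \<xi>) \<le> adist D (?F k) (?F M)"
        using \<xi> by (intro mc_diff[OF x Fc Fc]) auto
      also have "\<dots> \<le> e" using M that by (simp add: less_imp_le)
      finally show ?thesis .
    qed
    ultimately show "cmod (vector_functional (Ind_eps act x) \<xi> a - mc x (?F M) \<xi> \<xi>) \<le> e"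
      by (intro LIMSEQ_le_const2) auto
  qed
qed

definition embed :: "(real \<Rightarrow> 'x \<Rightarrow> complex) \<Rightarrow> (nat \<Rightarrow> real \<Rightarrow> 'x \<Rightarrow> complex) set" where
  "embed f = cauchy_class D (\<lambda>k. f)"

lemma embed_closed: "f \<in> Cc X \<Longrightarrow> embed f \<in> acarrier A"
  unfolding embed_def acarrier_A using cauchy_seq_const by blast

lemma vector_functional_embed:
  assumes x: "x \<in> X" and f: "f \<in> Cc X" and \<xi>: "\<xi> \<in> hcarrier L2R" "hnorm L2R \<xi> = 1"
  shows "vector_functional (Ind_eps act x) \<xi> (embed f) = mc x f \<xi> \<xi>"
  using vector_functional_limit[OF x embed_closed[OF f] _ \<xi>, of "\<lambda>k. f"]
    cauchy_class_self[OF cauchy_seq_const[OF f]] LIMSEQ_unique tendsto_const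
  unfolding embed_def by blast

end

section \<open>Approximation by normalised continuous functions, convolutions, and uniform
  continuity\<close>

lemma L2R_dense_unit:
  assumes \<xi>: "\<xi> \<in> hcarrier L2R" "hnorm L2R \<xi> = 1" and e: "e > 0"
  shows "\<exists>g r. continuous_on UNIV g \<and> 0 \<le> r \<and> (\<forall>s. r < \<bar>s\<bar> \<longrightarrow> g s = 0) \<and>
    hnorm L2R (l2_class g) = 1 \<and> hdist L2R \<xi> (l2_class g) < e"
proof -
  \<comment> \<open>The approximation g has norm c with |1 - c| < d, and normalising it moves it by
    |c - 1|. So d is used twice, whence e / 2, and d < 1 keeps c positive.\<close>
  define d where "d = min (e / 2) (1 / 2)"
  have d: "d > 0" "d \<le> e / 2" "d < 1" using e by (auto simp: d_def)
  obtain g r where g: "continuous_on UNIV g" "\<And>s. r < \<bar>s\<bar> \<Longrightarrow> g s = 0"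
    "hdist L2R \<xi> (l2_class g) < d"
    using L2R_dense[OF \<xi>(1) d(1)] by blast
  have sg: "square_integrable g" by (rule square_integrable_continuous_compact_support[OF g(1,2)])
  define c where "c = hnorm L2R (l2_class g)"
  have gC: "l2_class g \<in> hcarrier L2R" using sg by simp
  have c: "\<bar>1 - c\<bar> < d"
    using L2R.hnorm_triangle_hdist[OF \<xi>(1) gC] L2R.hnorm_triangle_hdist[OF gC \<xi>(1)]
      L2R.hdist_commute[OF gC \<xi>(1)] g(3) \<xi>(2) by (simp add: c_def)
  then have c0: "c > 0" using d(3) by linarith
  let ?h = "\<lambda>s. of_real (1 / c) * g s"
  have hl: "l2_class ?h = hscale L2R (of_real (1 / c)) (l2_class g)" using sg by (simp add: hscale_L2R)
  have hn: "hnorm L2R (l2_class ?h) = 1"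
    unfolding hl using c0 gC by (simp add: L2R.hnorm_scale c_def norm_divide)
  have "hminus L2R (l2_class g) (l2_class ?h) = hscale L2R (of_real (1 - 1 / c)) (l2_class g)"
    unfolding hminus_L2R[OF sg square_integrable_scale[OF sg]] hscale_L2R[OF sg]
    by (simp add: algebra_simps)
  then have "hdist L2R (l2_class g) (l2_class ?h) = \<bar>1 - 1 / c\<bar> * c"
    using gC by (simp add: hdist_eq_hnorm_hminus L2R.hnorm_scale c_def del: of_real_diff)
  also have "\<dots> = \<bar>(1 - 1 / c) * c\<bar>" using c0 by (simp add: abs_mult)
  also have "(1 - 1 / c) * c = c - 1" using c0 by (simp add: field_simps)
  finally have "hdist L2R (l2_class g) (l2_class ?h) < d" using c by simp
  moreover have "l2_class ?h \<in> hcarrier L2R" by (rule l2_class_closed[OF square_integrable_scale[OF sg]])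
  ultimately have "hdist L2R \<xi> (l2_class ?h) < e"
    using L2R.hdist_triangle[OF \<xi>(1) gC, of "l2_class ?h"] g(3) d(2) by linarith
  moreover have "continuous_on UNIV ?h" using g(1) by (intro continuous_intros)
  ultimately show ?thesis using hn g(2) by (intro exI[of _ ?h] exI[of _ "max r 0"]) auto
qed

text \<open>Fubini and the substitution of s - t for t separate the two factors. Applied to rank-one
  kernels, this turns a matrix coefficient into a product of two inner products.\<close>

lemma convolution_integral:
  fixes h k :: "real \<Rightarrow> complex"
  assumes h: "integrable lborel h" and k: "integrable lborel k"
  shows "integrable lborel (\<lambda>t. LINT s|lborel. h s * k (s - t))"
    and "(LINT t|lborel. LINT s|lborel. h s * k (s - t)) = (LINT s|lborel. h s) * (LINT s|lborel. k s)"
proof -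
  have [measurable]: "h \<in> borel_measurable borel" "k \<in> borel_measurable borel"
    using h k by (auto dest: borel_measurable_integrable)
  have [measurable]: "(\<lambda>q. k (fst q - snd q)) \<in> borel_measurable (borel \<Otimes>\<^sub>M borel)"
    by (rule measurable_shift2) simp
  have [measurable]: "(\<lambda>q. h (fst q)) \<in> borel_measurable (borel \<Otimes>\<^sub>M borel)"
    by (rule measurable_compose[OF measurable_fst]) simp
  have ks: "integrable lborel (\<lambda>t. k (s - t))" for s
    using lborel_integrable_real_affine[OF k, of "-1" s] by simp
  have kn: "(LINT t|lborel. cmod (k (s - t))) = (LINT t|lborel. cmod (k t))" for s
    using lborel_integral_real_affine[of "-1" "\<lambda>t. cmod (k t)" s] by simp
  have ki: "(LINT t|lborel. k (s - t)) = (LINT t|lborel. k t)" for s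
    using lborel_integral_real_affine[of "-1" k s] by simp
  let ?F = "\<lambda>q :: real \<times> real. h (fst q) * k (fst q - snd q)"
  have F: "integrable (lborel \<Otimes>\<^sub>M lborel) ?F"
  proof (rule lborel_pair.Fubini_integrable)
    show "?F \<in> borel_measurable (lborel \<Otimes>\<^sub>M lborel)" by measurable
    show "integrable lborel (\<lambda>s. LINT t|lborel. norm (?F (s, t)))"
      using h by (simp add: norm_mult kn)
    show "AE s in lborel. integrable lborel (\<lambda>t. ?F (s, t))" using ks by simp
  qed
  then have F': "integrable (lborel \<Otimes>\<^sub>M lborel) (\<lambda>(s, t). h s * k (s - t))"
    by (simp add: case_prod_unfold)
  show "integrable lborel (\<lambda>t. LINT s|lborel. h s * k (s - t))"
    using lborel_pair.integrable_snd[OF F'] by simp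
  show "(LINT t|lborel. LINT s|lborel. h s * k (s - t)) = (LINT s|lborel. h s) * (LINT s|lborel. k s)"
    unfolding lborel_pair.Fubini_integral[OF F'] by (simp add: ki)
qed

text \<open>Closedness of X makes its bounded part compact, and only times in a compact interval
  matter, since \<open>f\<close> vanishes at the others. Hence one d works for all t.\<close>

lemma Cc_uniformly_continuous_on_bounded:
  fixes X :: "'x::{heine_borel, real_normed_vector} set"
  assumes X: "closed X" and f: "f \<in> Cc X" and e: "e > 0"
  shows "\<exists>d>0. \<forall>t. \<forall>p\<in>X \<inter> cball 0 r. \<forall>q\<in>X \<inter> cball 0 r. dist p q < d \<longrightarrow> cmod (f t p - f t q) \<le> e"
proof -
  obtain M T where M: "\<And>t p. cmod (f t p) \<le> M * indicator {-T..T} t"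
    using Cc_bounds[OF f] by blast
  let ?Q = "{-T..T} \<times> (X \<inter> cball 0 r)"
  have "compact ?Q" using X by (intro compact_Times closed_Int_compact) auto
  moreover have "continuous_on ?Q (\<lambda>(t, p). f t p)"
    using f by (auto simp: Cc_def intro: continuous_on_subset)
  ultimately have "uniformly_continuous_on ?Q (\<lambda>(t, p). f t p)"
    by (intro compact_uniformly_continuous)
  then obtain d where d: "d > 0" "\<And>q q'. q \<in> ?Q \<Longrightarrow> q' \<in> ?Q \<Longrightarrow> dist q' q < d \<Longrightarrow>
      dist (case q' of (t, p) \<Rightarrow> f t p) (case q of (t, p) \<Rightarrow> f t p) < e"
    using e unfolding uniformly_continuous_on_def by metis
  have "cmod (f t p - f t q) \<le> e"
    if "p \<in> X \<inter> cball 0 r" "q \<in> X \<inter> cball 0 r" "dist p q < d" for t p q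
  proof (cases "t \<in> {-T..T}")
    case True
    then show ?thesis using d(2)[of "(t, q)" "(t, p)"] that by (simp add: dist_Pair_Pair dist_norm less_imp_le)
  next
    case False
    then have "f t p = 0" "f t q = 0" using M[of t p] M[of t q] by auto
    then show ?thesis using e by simp
  qed
  with d(1) show ?thesis by blast
qed

lemma orthonormal_family:
  assumes "\<And>i j. i \<in> I \<Longrightarrow> j \<in> I \<Longrightarrow> hinner H (e i) (e j) = (if i = j then 1 else 0)"
  shows "inj_on e I" "orthonormal H (e ` I)"
proof -
  show inj: "inj_on e I"
    by (rule inj_onI) (metis assms zero_neq_one)
  show "orthonormal H (e ` I)"
    using assms inj by (auto simp: orthonormal_def inj_on_eq_iff)
qed

lemma norm_vector_3_le: "norm (vector [x, y, z] :: real ^ 3) \<le> \<bar>x\<bar> + \<bar>y\<bar> + \<bar>z\<bar>"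
  using norm_le_l1_cart[of "vector [x, y, z] :: real ^ 3"] by (simp add: sum_3 vector_3)

section \<open>Rieffel's transformation groups\<close>

locale rieffel =
  fixes X :: "(real ^ 3) set" and act :: "real \<Rightarrow> real ^ 3 \<Rightarrow> real ^ 3"
    and b :: "nat \<Rightarrow> nat \<Rightarrow> real" and L :: "nat \<Rightarrow> nat"
  assumes rieffel: "rieffel_group X act b L"
begin

abbreviation pt where "pt \<equiv> rieffel_point b"

lemmas b_decreasing = rieffel[unfolded rieffel_group_def, THEN conjunct1, rule_format]
lemmas b_tendsto = rieffel[unfolded rieffel_group_def, THEN conjunct2, THEN conjunct1]
lemmas b_superscript = rieffel[unfolded rieffel_group_def, THEN conjunct2, THEN conjunct2, THEN conjunct1, rule_format]
lemmas X_closed = rieffel[unfolded rieffel_group_def, THEN conjunct2, THEN conjunct2, THEN conjunct2, THEN conjunct1]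
lemmas X_eq = rieffel[unfolded rieffel_group_def, THEN conjunct2, THEN conjunct2, THEN conjunct2, THEN conjunct2, THEN conjunct1]
lemmas X_action = rieffel[unfolded rieffel_group_def, THEN conjunct2, THEN conjunct2, THEN conjunct2, THEN conjunct2, THEN conjunct2, THEN conjunct1]
lemmas act_pt_0 = rieffel[unfolded rieffel_group_def, THEN conjunct2, THEN conjunct2, THEN conjunct2, THEN conjunct2, THEN conjunct2, THEN conjunct2, THEN conjunct1, rule_format]
lemmas act_segment_0 = rieffel[unfolded rieffel_group_def, THEN conjunct2, THEN conjunct2, THEN conjunct2, THEN conjunct2, THEN conjunct2, THEN conjunct2, THEN conjunct2, THEN conjunct1, rule_format]
lemmas act_arcs = rieffel[unfolded rieffel_group_def, THEN conjunct2, THEN conjunct2, THEN conjunct2, THEN conjunct2, THEN conjunct2, THEN conjunct2, THEN conjunct2, THEN conjunct2, rule_format]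

lemma act_pt_in: "act t (pt n) \<in> X"
  unfolding X_eq by auto

sublocale transformation_group X act
  using X_action act_pt_in by unfold_locales auto

lemma
  assumes "n \<ge> 1" "L n \<ge> 1"
  shows act_first: "t \<le> real n \<Longrightarrow> act t (pt n) = vector [b n 0, t, 0]"
    and act_last: "- real n < s \<Longrightarrow>
      act (s + real (L n) * (2 * real n + 1)) (pt n) = vector [b n (L n), s, 0]"
    and act_middle: "1 \<le> j \<Longrightarrow> j < L n \<Longrightarrow> - real n < s \<Longrightarrow> s \<le> real n \<Longrightarrow>
      act (s + real j * (2 * real n + 1)) (pt n) = vector [b n j, s, 0]"
    and act_arc: "j < L n \<Longrightarrow> 0 < s \<Longrightarrow> s \<le> 1 \<Longrightarrow>
      act (s + real n + real j * (2 * real n + 1)) (pt n) =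
        vector [(1 - s) * b n j + s * b n (j + 1), real n * cos (pi * s), real n * sin (pi * s)]"
  using act_arcs[OF assms] by auto

text \<open>A common form for the straight pieces of the orbit: piece j is traversed around time j
  (2n + 1). The first and last pieces extend beyond this range, and the range is open on the left
  because there an arc ends.\<close>

lemma act_segment:
  assumes "n \<ge> 1" "j \<le> L n" "- real n < y" "y \<le> real n"
  shows "act (y + real j * (2 * real n + 1)) (pt n) = vector [b n j, y, 0]"
proof (cases "L n = 0")
  case True
  then show ?thesis using assms act_segment_0[of n y] by simp
next
  case False
  then show ?thesis
    using assms act_first[of n y] act_last[of n y] act_middle[of n j y]
    by (cases "j = 0"; cases "j = L n") auto
qed

lemma pt_in [simp]: "pt n \<in> X"
proof -
  have "pt n = act 0 (pt n)"
  proof (cases "n = 0")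
    case True
    then show ?thesis using act_pt_0[of 0]
      by (simp add: rieffel_point_def vec_eq_iff forall_3 vector_3)
  next
    case False
    then show ?thesis using act_segment[of n 0 0] by (simp add: rieffel_point_def)
  qed
  then show ?thesis using act_pt_in by metis
qed

text \<open>A decreasing sequence stays above its limit 0. Applied from index n + 1 on, this leaves
  the strict step from n + 1 to n to give positivity.\<close>

lemma b_pos: assumes "n \<ge> 1" shows "0 < b n 0"
proof -
  note dec = b_decreasing
  have "decseq (\<lambda>k. b (k + (n + 1)) 0)"
    by (rule decseq_SucI) (use dec in \<open>auto intro: less_imp_le\<close>)
  moreover have "(\<lambda>k. b (k + (n + 1)) 0) \<longlonglongrightarrow> 0"
    by (rule LIMSEQ_ignore_initial_segment[OF b_tendsto])
  ultimately have "0 \<le> b (0 + (n + 1)) 0" by (rule decseq_ge)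
  then show ?thesis using dec[OF assms] by simp
qed

lemma b_bounds:
  assumes n: "n \<ge> 1" and j: "j \<le> L n"
  shows "0 \<le> b n j" "b n j \<le> b n 0"
proof -
  have mono: "i \<le> k \<Longrightarrow> k \<le> L n \<Longrightarrow> b n k \<le> b n i" for i k
  proof (induction k)
    case (Suc k)
    show ?case
    proof (cases "i = Suc k")
      case False
      then have "b n k \<le> b n i" using Suc by simp
      moreover have "b n (k + 1) < b n k" using Suc.prems(2) by (intro b_superscript[THEN conjunct2, rule_format] n) auto
      ultimately show ?thesis by simp
    qed simp
  qed simp
  show "b n j \<le> b n 0" using mono[of 0 j] j by simp
  have "0 < b n (L n)"
  proof (cases "L n = 0")
    case True
    then show ?thesis using b_pos[OF n] by simp
  next
    case False
    then show ?thesis using b_superscript[OF n, THEN conjunct1] b_pos[of "n + 1"] by simp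
  qed
  then show "0 \<le> b n j" using mono[OF j] by simp
qed

text \<open>For \<open>n\<close> large compared with \<open>R\<close>, the connecting arcs leave the region \<open>\<bar>y\<bar> \<le> R, \<bar>z\<bar> < 1\<close>.\<close>

lemma orbit_cases:
  assumes n: "real n > R + 1" and R: "0 \<le> R"
    and near: "\<bar>act s (pt n) $ 2\<bar> \<le> R" "\<bar>act s (pt n) $ 3\<bar> < 1"
  obtains j y where "j \<le> L n" "\<bar>y\<bar> \<le> R" "s = y + real j * (2 * real n + 1)"
proof -
  let ?p = "2 * real n + 1"
  have n1: "n \<ge> 1" using n R by (cases n) auto
  note goal = that
  have seg: thesis if "j \<le> L n" "act s (pt n) = vector [b n j, s - real j * ?p, 0]" for j
    by (rule goal[of j "s - real j * ?p"]) (use near(1) that in \<open>auto simp: vector_3\<close>)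
  show thesis
  proof (cases "L n = 0")
    case True
    then show ?thesis using seg[of 0] act_segment_0[OF n1 True, of s] by simp
  next
    case False
    then have L1: "L n \<ge> 1" by simp
    consider "s \<le> real n" | "s > real (L n) * ?p - real n"
      | "real n < s" "s \<le> real (L n) * ?p - real n" by linarith
    then show ?thesis
    proof cases
      case 1
      then show ?thesis using seg[of 0] act_first[OF n1 L1, of s] by simp
    next
      case 2
      then show ?thesis using seg[of "L n"] act_last[OF n1 L1, of "s - real (L n) * ?p"] by simp
    next
      case 3
      define q where "q = (s - real n) / ?p"
      \<comment> \<open>The block n + j (2n + 1) < s <= n + (j + 1) (2n + 1) consists of arc j
        followed by segment j + 1. Blocks are open on the left and closed on the right, so the index
        is the ceiling of q minus 1.\<close>
      define j where "j = nat (\<lceil>q\<rceil> - 1)"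
      have p: "?p > 0" by simp
      have q0: "q > 0" using 3(1) by (simp add: q_def)
      have "s - real n \<le> real (L n) * ?p" using 3(2) by simp
      then have qL: "q \<le> real (L n)" unfolding q_def using p by (simp add: pos_divide_le_eq)
      have c1: "1 \<le> \<lceil>q\<rceil>" using q0 by linarith
      have c2: "\<lceil>q\<rceil> \<le> int (L n)" using qL by (simp add: ceiling_le_iff)
      have jL: "j < L n" unfolding j_def using c1 c2 by (subst nat_less_iff) linarith+
      have jr: "real j = of_int \<lceil>q\<rceil> - 1" using c1 by (simp add: j_def)
      have jq: "real j < q" "q \<le> real j + 1" unfolding jr by linarith+
      define r where "r = s - real n - real j * ?p"
      have qs: "q * ?p = s - real n" using p by (simp add: q_def)
      have r0: "0 < r" using mult_strict_right_mono[OF jq(1) p] by (simp add: r_def qs)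
      have "q * ?p \<le> (real j + 1) * ?p" using jq(2) by (intro mult_right_mono) auto
      then have r1: "r \<le> ?p" unfolding qs by (simp add: r_def algebra_simps)
      have s1: "s = r + real n + real j * ?p" by (simp add: r_def)
      show ?thesis
      proof (cases "r \<le> 1")
        case True
        \<comment> \<open>On an arc the last two coordinates lie on the circle of radius n. In the
          region considered their squares sum to at most R^2 + 1 <= (R + 1)^2 < n^2, which is
          impossible.\<close>
        have "act s (pt n) $ 2 = real n * cos (pi * r)" "act s (pt n) $ 3 = real n * sin (pi * r)"
          unfolding s1 act_arc[OF n1 L1 jL r0 True] by (simp_all add: vector_3)
        then have "(act s (pt n) $ 2)\<^sup>2 + (act s (pt n) $ 3)\<^sup>2 = (real n)\<^sup>2"
          by (simp add: power_mult_distrib flip: distrib_left)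
        moreover have "(act s (pt n) $ 2)\<^sup>2 \<le> R\<^sup>2" using near(1) R by (subst abs_le_square_iff[symmetric]) simp
        moreover have "(act s (pt n) $ 3)\<^sup>2 \<le> 1" using near(2) by (simp add: abs_square_le_1)
        moreover have "(R + 1)\<^sup>2 < (real n)\<^sup>2" using n R by (intro power_strict_mono) auto
        ultimately show ?thesis using R by (simp add: power2_sum)
      next
        case False
        \<comment> \<open>The arc takes time 1, so the second coordinate on the next segment is r -
          1 - n, which lies in (-n, n] for 1 < r <= 2n + 1.\<close>
        have s2: "s = (r - real n - 1) + real (j + 1) * ?p" by (simp add: r_def algebra_simps)
        have "act ((r - real n - 1) + real (j + 1) * ?p) (pt n) = vector [b n (j + 1), r - real n - 1, 0]"
          using False r1 jL n1 by (intro act_segment) auto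
        then show ?thesis using seg[of "j + 1"] jL s2 by simp
      qed
    qed
  qed
qed

end

section \<open>Matrix coefficients along an orbit, and kernels of finite rank\<close>

context transformation_group
begin

lemma mc_integrable:
  assumes x: "x \<in> X" and f: "f \<in> Cc X" and u: "square_integrable u" "square_integrable v"
  shows "integrable lborel (\<lambda>t. LINT s|lborel. f t (act s x) * u (s - t) * cnj (v s))"
proof -
  interpret covariant X act L2R "eps_tilde act x" left_regular by (rule covariant_regular[OF x])
  have "integrable lborel (\<lambda>t. coef f (l2_class u) (l2_class v) t)"
    using u by (intro integrable_coef f) auto
  then show ?thesis
    unfolding coef_def using u square_integrable_orbit[OF Cc_slice[OF f] x]
    by (simp add: left_regular_l2_class eps_tilde_l2_class hinner_L2R)
qed

text \<open>Replacing s by s + c in the kernel formula moves the shift from the vectors to the base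
  point. It expresses the equivalence of the induced representations at points of one orbit.\<close>

lemma mc_translate:
  assumes x: "x \<in> X" and f: "f \<in> Cc X" and u: "square_integrable u" "square_integrable v"
  shows "mc x f (l2_class (\<lambda>s. u (s - c))) (l2_class (\<lambda>s. v (s - c))) =
    mc (act c x) f (l2_class u) (l2_class v)"
proof -
  have "(LINT s|lborel. f t (act s x) * u (s - t - c) * cnj (v (s - c))) =
      (LINT s|lborel. f t (act s (act c x)) * u (s - t) * cnj (v s))" for t
    using lborel_integral_shift[of "\<lambda>s. f t (act s (act c x)) * u (s - t) * cnj (v s)" c] x
    by (simp add: act_add algebra_simps)
  then show ?thesis using x f u by (simp add: mc_eq)
qed

text \<open>With s - t as the new variable, such an \<open>f\<close> has the integral kernel of the
  operator summing the rank-one maps given by the \<open>u j\<close>; the right side is its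
  quadratic form.\<close>

lemma mc_rank_one_sum:
  assumes x: "x \<in> X" and f: "f \<in> Cc X" and J: "finite J"
    and u: "\<And>j. j \<in> J \<Longrightarrow> square_integrable (u j)" "\<And>j s. j \<in> J \<Longrightarrow> cmod (u j s) \<le> c"
    and v: "square_integrable v"
    and fu: "\<And>s t. f t (act s x) = (\<Sum>j\<in>J. u j s * cnj (u j (s - t)))"
  shows "mc x f (l2_class v) (l2_class v) =
    of_real (\<Sum>j\<in>J. (cmod (hinner L2R (l2_class v) (l2_class (u j))))\<^sup>2)"
proof -
  \<comment> \<open>The integrand u(s) cnj(u(s - t)) v(s - t) cnj(v(s)) is regrouped as h(s) k(s -
    t), separating the variables s and s - t.\<close>
  define h where "h j s = u j s * cnj (v s)" for j s
  define k where "k j s = v s * cnj (u j s)" for j s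
  have h: "integrable lborel (h j)" and k: "integrable lborel (k j)" if "j \<in> J" for j
    unfolding h_def k_def using u(1)[OF that] v by simp_all
  \<comment> \<open>Integrability of \<open>h j\<close> and \<open>k j\<close> does not give that of
    h(s) k(s - t) at each single t, which is needed to move the finite sum out of the inner
    integral. Boundedness of \<open>u j\<close> makes it a pairing of two square-integrable
    functions.\<close>
  have hk: "integrable lborel (\<lambda>s. h j s * k j (s - t))" if j: "j \<in> J" for j t
  proof -
    note [measurable] = u(1)[OF j] square_integrable_shift[OF u(1)[OF j], of t]
    have "cmod (u j s * cnj (u j (s - t))) \<le> c * c" for s
      unfolding norm_mult complex_mod_cnj
      by (intro mult_mono u(2)[OF j]) (auto intro: order_trans[OF norm_ge_zero u(2)[OF j]])
    then have "square_integrable (\<lambda>s. (u j s * cnj (u j (s - t))) * v (s - t))"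
      using v by (intro square_integrable_bounded_mult[where c = "c * c"]) (simp, measurable)
    from integrable_mult_cnj[OF this v] show ?thesis by (simp add: h_def k_def mult_ac)
  qed
  have "mc x f (l2_class v) (l2_class v) = (LINT t|lborel. LINT s|lborel. (\<Sum>j\<in>J. h j s * k j (s - t)))"
    unfolding mc_eq[OF x f v v] fu by (simp add: h_def k_def sum_distrib_right sum_distrib_left mult_ac)
  also have "\<dots> = (LINT t|lborel. (\<Sum>j\<in>J. LINT s|lborel. h j s * k j (s - t)))"
    using hk by (intro Bochner_Integration.integral_cong refl Bochner_Integration.integral_sum) auto
  also have "\<dots> = (\<Sum>j\<in>J. (LINT t|lborel. LINT s|lborel. h j s * k j (s - t)))"
    using convolution_integral(1)[OF h k] by (intro Bochner_Integration.integral_sum) auto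
  also have "\<dots> = (\<Sum>j\<in>J. of_real ((cmod (hinner L2R (l2_class v) (l2_class (u j))))\<^sup>2))"
  proof (rule sum.cong[OF refl])
    fix j assume j: "j \<in> J"
    have "(LINT t|lborel. LINT s|lborel. h j s * k j (s - t)) = (LINT s|lborel. h j s) * (LINT s|lborel. k j s)"
      by (rule convolution_integral(2)[OF h[OF j] k[OF j]])
    also have "\<dots> = hinner L2R (l2_class (u j)) (l2_class v) * hinner L2R (l2_class v) (l2_class (u j))"
      unfolding h_def k_def using u(1)[OF j] v by (simp add: hinner_L2R)
    also have "hinner L2R (l2_class (u j)) (l2_class v) = cnj (hinner L2R (l2_class v) (l2_class (u j)))"
      using u(1)[OF j] v by (intro L2R.inner_cnj) auto
    finally show "(LINT t|lborel. LINT s|lborel. h j s * k j (s - t)) =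
        of_real ((cmod (hinner L2R (l2_class v) (l2_class (u j))))\<^sup>2)"
      by (simp only: complex_norm_square mult.commute)
  qed
  finally show ?thesis by simp
qed

lemma dual_space_diff:
  assumes "\<psi> \<in> dual_space A" "\<phi> \<in> dual_space A"
  shows "(\<lambda>a. \<psi> a - \<phi> a) \<in> dual_space A"
proof -
  obtain C C' where C: "\<forall>a\<in>acarrier A. cmod (\<psi> a) \<le> C * anorm A a"
    and C': "\<forall>a\<in>acarrier A. cmod (\<phi> a) \<le> C' * anorm A a"
    using assms by (auto simp: dual_space_def)
  have "\<forall>a\<in>acarrier A. cmod (\<psi> a - \<phi> a) \<le> (C + C') * anorm A a"
  proof
    fix a assume "a \<in> acarrier A"
    then show "cmod (\<psi> a - \<phi> a) \<le> (C + C') * anorm A a"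
      using C C' norm_triangle_ineq4[of "\<psi> a" "\<phi> a"] by (force simp: distrib_right)
  qed
  then have "\<exists>C. \<forall>a\<in>acarrier A. cmod (\<psi> a - \<phi> a) \<le> C * anorm A a" by blast
  then show ?thesis using assms unfolding dual_space_def by (simp add: right_diff_distrib)
qed

end

lemma bump_separation:
  assumes "i \<noteq> (j :: nat)"
  shows "2 * real n + 1 \<le> \<bar>real i * (2 * real n + 1) - real j * (2 * real n + 1)\<bar>"
proof -
  have "1 \<le> \<bar>real i - real j\<bar>" using assms by linarith
  then have "1 * (2 * real n + 1) \<le> \<bar>real i - real j\<bar> * (2 * real n + 1)" by (intro mult_right_mono) auto
  also have "\<dots> = \<bar>(real i - real j) * (2 * real n + 1)\<bar>" by (simp add: abs_mult)
  finally show ?thesis by (simp only: left_diff_distrib mult_1)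
qed

section \<open>Translates of a compactly supported unit vector, and the function acting as a
  finite-rank projection\<close>

locale rieffel_bump = rieffel +
  fixes g :: "real \<Rightarrow> complex" and R :: real
  assumes g_continuous: "continuous_on UNIV g" and R_nonneg: "0 \<le> R"
    and g_support: "\<And>s. R < \<bar>s\<bar> \<Longrightarrow> g s = 0" and g_norm: "hnorm L2R (l2_class g) = 1"
begin

lemma g_square_integrable [simp]: "square_integrable g"
  by (rule square_integrable_continuous_compact_support[OF g_continuous g_support])

definition bump :: "nat \<Rightarrow> nat \<Rightarrow> real \<Rightarrow> complex" where
  "bump n j s = g (s - real j * (2 * real n + 1))"

lemma bump_square_integrable [simp]: "square_integrable (bump n j)"
  unfolding bump_def by simp

text \<open>The supports have radius R about points at least 2n + 1 apart, so R < n makes those of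
  different bumps disjoint; each bump inherits norm 1 from \<open>g\<close>.\<close>

lemma bump_orthonormal:
  assumes n: "R < real n"
  shows "hinner L2R (l2_class (bump n i)) (l2_class (bump n j)) = (if i = j then 1 else 0)"
proof (cases "i = j")
  case True
  have "hinner L2R (l2_class (bump n j)) (l2_class (bump n j)) = hinner L2R (l2_class g) (l2_class g)"
    using lborel_integral_shift[of "\<lambda>s. g s * cnj (g s)"] by (simp add: hinner_L2R bump_def)
  also have "\<dots> = 1" using L2R.inner_self[of "l2_class g"] by (simp add: g_norm)
  finally show ?thesis using True by simp
next
  case False
  have "bump n i s * cnj (bump n j s) = 0" for s
  proof (rule ccontr)
    assume "\<not> ?thesis"
    then have "g (s - real i * (2 * real n + 1)) \<noteq> 0" "g (s - real j * (2 * real n + 1)) \<noteq> 0"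
      by (auto simp: bump_def)
    then have "\<bar>s - real i * (2 * real n + 1)\<bar> \<le> R" "\<bar>s - real j * (2 * real n + 1)\<bar> \<le> R"
      using g_support not_less by blast+
    then show False using bump_separation[OF False, of n] n by linarith
  qed
  then have "(\<lambda>s. bump n i s * cnj (bump n j s)) = (\<lambda>s. 0)" by (rule ext)
  then show ?thesis using False by (simp only: hinner_L2R[OF bump_square_integrable bump_square_integrable]) simp
qed

text \<open>After moving the translation to the base point, both coefficients involve the same
  vector \<open>g\<close>, and for |s| <= R the two orbits differ only by \<open>b n j\<close> in
  the first coordinate. As \<open>b n j \<le> b n 0\<close>, uniform continuity of \<open>f\<close>
  handles all j at once.\<close>

lemma mc_bump_approx:
  assumes f: "f \<in> Cc X" and e: "e > 0"
  shows "\<forall>\<^sub>F n in sequentially. \<forall>j\<le>L n. cmod (mc (pt n) f (l2_class (bump n j)) (l2_class (bump n j))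
    - mc (pt 0) f (l2_class g) (l2_class g)) \<le> e"
proof -
  obtain M T where M: "0 \<le> M" "0 \<le> T" "\<And>t p. cmod (f t p) \<le> M * indicator {-T..T} t"
    using Cc_bounds[OF f] by blast
  obtain c where c: "0 \<le> c" "\<And>s. cmod (g s) \<le> c"
    using continuous_compact_support_bounded[OF g_continuous g_support] by blast
  \<comment> \<open>The supremum c of |g| enters squared; 2R and 2T are the lengths of the ranges of
    s and t. The added 1 in e1 allows B = 0.\<close>
  define B where "B = c\<^sup>2 * (2 * R) * (2 * T)"
  have B: "0 \<le> B" using R_nonneg M(2) by (simp add: B_def)
  define e1 where "e1 = e / (B + 1)"
  have e1: "e1 > 0" using e B by (simp add: e1_def)
  have e1B: "e1 * B \<le> e"
  proof -
    have "e1 * B \<le> e1 * (B + 1)" using e1 by simp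
    also have "\<dots> = e" using B by (simp add: e1_def)
    finally show ?thesis .
  qed
  \<comment> \<open>Points on the two orbits with |s| <= R have norm at most R + 1 once
    \<open>b n j < 1\<close>; this is why \<open>b n 0\<close> is made smaller than both d and 1
    below.\<close>
  obtain d where d: "d > 0" "\<And>t p q. p \<in> X \<inter> cball 0 (R + 1) \<Longrightarrow> q \<in> X \<inter> cball 0 (R + 1) \<Longrightarrow>
      dist p q < d \<Longrightarrow> cmod (f t p - f t q) \<le> e1"
    using Cc_uniformly_continuous_on_bounded[OF X_closed f e1, of "R + 1"] by blast
  have "\<forall>\<^sub>F n in sequentially. b n 0 < min d 1"
    using order_tendstoD(2)[OF b_tendsto, of "min d 1"] d(1) by simp
  moreover have "\<forall>\<^sub>F n in sequentially. R < real n"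
    using filterlim_real_sequentially unfolding filterlim_at_top_dense by blast
  ultimately show ?thesis using eventually_ge_at_top[of 1]
  proof eventually_elim
    case (elim n)
    show ?case
    proof (intro allI impI)
      fix j assume j: "j \<le> L n"
      define x where "x = act (real j * (2 * real n + 1)) (pt n)"
      have x: "x \<in> X" by (simp add: x_def)
      have b: "0 \<le> b n j" "b n j < d" "b n j < 1" using b_bounds[OF elim(3) j] elim(1) by auto
      have near: "cmod (f t (act s x) - f t (act s (pt 0))) \<le> e1 * indicator {-T..T} t"
        if s: "\<bar>s\<bar> \<le> R" for s t
      proof (cases "t \<in> {-T..T}")
        case True
        have p: "act s x = vector [b n j, s, 0]"
          using act_segment[OF elim(3) j, of s] s elim(2) by (simp add: x_def act_add)
        have q: "act s (pt 0) = vector [0, s, 0]" by (rule act_pt_0)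
        have "act s x \<in> X \<inter> cball 0 (R + 1)" "act s (pt 0) \<in> X \<inter> cball 0 (R + 1)"
          using norm_vector_3_le[of "b n j" s 0] norm_vector_3_le[of 0 s 0] b s x
          by (simp_all, simp_all add: p q)
        moreover have "act s x - act s (pt 0) = vector [b n j, 0, 0]"
          unfolding p q by (simp add: vec_eq_iff forall_3 vector_3)
        then have "dist (act s x) (act s (pt 0)) < d"
          using norm_vector_3_le[of "b n j" 0 0] b by (simp add: dist_norm)
        ultimately have "cmod (f t (act s x) - f t (act s (pt 0))) \<le> e1" by (intro d(2))
        then show ?thesis using True by simp
      next
        case False
        then have "f t p = 0" for p using M(3)[of t p] by simp
        then show ?thesis using False by simp
      qed
      have inner: "cmod ((LINT s|lborel. f t (act s x) * g (s - t) * cnj (g s)) -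
          (LINT s|lborel. f t (act s (pt 0)) * g (s - t) * cnj (g s)))
          \<le> (e1 * (c\<^sup>2 * (2 * R))) * indicator {-T..T} t" for t
      proof -
        have i: "integrable lborel (\<lambda>s. f t (act s y) * g (s - t) * cnj (g s))" if "y \<in> X" for y
          using square_integrable_orbit[OF Cc_slice[OF f] that square_integrable_shift[OF g_square_integrable]]
          by (intro integrable_mult_cnj) auto
        \<comment> \<open>The factor cnj(g(s)) confines s to [-R, R], where the orbits are compared;
          nothing is known about the orbit of x_n at other times.\<close>
        have "cmod (f t (act s x) * g (s - t) * cnj (g s) - f t (act s (pt 0)) * g (s - t) * cnj (g s))
            \<le> (e1 * indicator {-T..T} t * c\<^sup>2) * indicator {-R..R} s" for s
        proof (cases "\<bar>s\<bar> \<le> R")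
          case True
          have "cmod (f t (act s x) * g (s - t) * cnj (g s) - f t (act s (pt 0)) * g (s - t) * cnj (g s))
            = cmod (f t (act s x) - f t (act s (pt 0))) * (cmod (g (s - t)) * cmod (g s))"
            by (simp flip: norm_mult left_diff_distrib add: mult.assoc)
               (simp add: norm_mult)
          also have "\<dots> \<le> (e1 * indicator {-T..T} t) * (c * c)"
            using e1 c by (intro mult_mono near True) auto
          finally show ?thesis using True by (simp add: power2_eq_square abs_le_iff)
        next
          case False
          then have "s \<notin> {-R..R}" by auto
          then show ?thesis using False g_support[of s] by simp
        qed
        then have "cmod (LINT s|lborel. f t (act s x) * g (s - t) * cnj (g s)
            - f t (act s (pt 0)) * g (s - t) * cnj (g s)) \<le> (e1 * indicator {-T..T} t * c\<^sup>2) * (2 * R)"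
          by (rule integral_bound_Icc[OF _ R_nonneg])
        then show ?thesis
          using i[OF x] i[of "pt 0"] by (simp add: mult_ac)
      qed
      have "mc (pt n) f (l2_class (bump n j)) (l2_class (bump n j)) = mc x f (l2_class g) (l2_class g)"
        unfolding bump_def x_def by (rule mc_translate[OF pt_in f]) simp_all
      then have "mc (pt n) f (l2_class (bump n j)) (l2_class (bump n j)) - mc (pt 0) f (l2_class g) (l2_class g)
        = (LINT t|lborel. (LINT s|lborel. f t (act s x) * g (s - t) * cnj (g s)) -
          (LINT s|lborel. f t (act s (pt 0)) * g (s - t) * cnj (g s)))"
        using mc_integrable[OF x f g_square_integrable g_square_integrable]
          mc_integrable[OF pt_in f g_square_integrable g_square_integrable, of 0]
        by (simp add: mc_eq[OF x f] mc_eq[OF pt_in f])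
      also have "cmod \<dots> \<le> (e1 * (c\<^sup>2 * (2 * R))) * (2 * T)"
        by (rule integral_bound_Icc[OF inner M(2)])
      also have "\<dots> \<le> e" using e1B by (simp add: B_def mult_ac)
      finally show "cmod (mc (pt n) f (l2_class (bump n j)) (l2_class (bump n j))
        - mc (pt 0) f (l2_class g) (l2_class g)) \<le> e" .
    qed
  qed
qed

text \<open>The cutoff in the first coordinate makes the support compact; the one in the third
  coordinate removes the arcs.\<close>

definition rank_one :: "real \<Rightarrow> real ^ 3 \<Rightarrow> complex" where
  "rank_one t p = (if p \<in> X then of_real (max 0 (1 - \<bar>p $ 3\<bar>) * max 0 (min 1 (2 - \<bar>p $ 1\<bar>)))
     * g (p $ 2) * cnj (g (p $ 2 - t)) else 0)"

lemma rank_one_Cc: "rank_one \<in> Cc X"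
  unfolding Cc_def
proof (intro CollectI conjI)
  have gc: "continuous_on S (\<lambda>q. g (h q))" if "continuous_on S h" for S :: "(real \<times> (real ^ 3)) set" and h
    by (rule continuous_on_compose2[OF g_continuous that]) simp
  have "continuous_on (UNIV \<times> X) (\<lambda>q. of_real (max 0 (1 - \<bar>snd q $ 3\<bar>) * max 0 (min 1 (2 - \<bar>snd q $ 1\<bar>)))
     * g (snd q $ 2) * cnj (g (snd q $ 2 - fst q)))"
    by (intro continuous_intros gc[of _ "\<lambda>q. snd q $ 2"] gc[of _ "\<lambda>q. snd q $ 2 - fst q"])
  then show "continuous_on (UNIV \<times> X) (\<lambda>(t, p). rank_one t p)"
    by (rule continuous_on_eq) (auto simp: rank_one_def)
  let ?B = "{p :: real ^ 3. \<bar>p $ 1\<bar> \<le> 2 \<and> \<bar>p $ 2\<bar> \<le> R \<and> \<bar>p $ 3\<bar> \<le> 1}"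
  \<comment> \<open>On the support both y and y - t have absolute value at most R, so |t| <=
    2R.\<close>
  let ?K = "{- (2 * R)..2 * R} \<times> (X \<inter> ?B)"
  have "closed ?B" by (intro closed_Collect_conj closed_Collect_le continuous_intros)
  moreover have "norm p \<le> R + 3" if "p \<in> ?B" for p
    using norm_le_l1_cart[of p] that by (auto simp: sum_3)
  then have "bounded ?B" unfolding bounded_iff by blast
  ultimately have "compact ?B" by (simp add: compact_eq_bounded_closed)
  then have "compact ?K" using X_closed by (intro compact_Times closed_Int_compact) auto
  moreover have "rank_one t p = 0" if "(t, p) \<notin> ?K" for t p
  proof (rule ccontr)
    assume nz: "rank_one t p \<noteq> 0"
    then have "g (p $ 2) \<noteq> 0" "g (p $ 2 - t) \<noteq> 0" "p \<in> X" "\<bar>p $ 3\<bar> \<le> 1" "\<bar>p $ 1\<bar> \<le> 2"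
      by (auto simp: rank_one_def max_def min_def split: if_splits)
    moreover from this have "\<bar>p $ 2\<bar> \<le> R" "\<bar>p $ 2 - t\<bar> \<le> R"
      using g_support not_less by blast+
    ultimately show False using that by auto
  qed
  ultimately show "\<exists>K. compact K \<and> K \<subseteq> UNIV \<times> X \<and> (\<forall>t p. (t, p) \<notin> K \<longrightarrow> rank_one t p = 0)"
    by (intro exI[of _ ?K]) auto
qed

lemma rank_one_segment:
  assumes "p \<in> X" "p = vector [x, y, 0]" "\<bar>x\<bar> \<le> 1"
  shows "rank_one t p = g y * cnj (g (y - t))"
  using assms by (simp add: rank_one_def vector_3 min_def)

text \<open>At a time within R of some j (2n + 1) the orbit is on segment j, where both cutoffs are
  1, and every other bump vanishes at s. At any other time all bumps vanish, and by
  \<open>orbit_cases\<close> the orbit is outside the region where \<open>rank_one\<close> can be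
  nonzero.\<close>

lemma rank_one_orbit:
  assumes n: "R + 1 < real n" "b n 0 \<le> 1"
  shows "rank_one t (act s (pt n)) = (\<Sum>j\<in>{..L n}. bump n j s * cnj (bump n j (s - t)))"
proof -
  let ?p = "2 * real n + 1"
  have n1: "n \<ge> 1" using n R_nonneg by (cases n) auto
  show ?thesis
  proof (cases "\<exists>j\<le>L n. \<bar>s - real j * ?p\<bar> \<le> R")
    case True
    then obtain j where j: "j \<le> L n" and s: "\<bar>s - real j * ?p\<bar> \<le> R" by blast
    have p: "act s (pt n) = vector [b n j, s - real j * ?p, 0]"
      using act_segment[OF n1 j, of "s - real j * ?p"] s n by simp
    have "rank_one t (act s (pt n)) = bump n j s * cnj (bump n j (s - t))"
      using rank_one_segment[OF act_pt_in p, of t] b_bounds[OF n1 j] n(2) by (simp add: bump_def algebra_simps)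
    also have "\<dots> = (\<Sum>i\<in>{..L n}. if i = j then bump n i s * cnj (bump n i (s - t)) else 0)"
      using j by simp
    also have "\<dots> = (\<Sum>i\<in>{..L n}. bump n i s * cnj (bump n i (s - t)))"
    proof (rule sum.cong[OF refl])
      fix i
      show "(if i = j then bump n i s * cnj (bump n i (s - t)) else 0) = bump n i s * cnj (bump n i (s - t))"
      proof (cases "i = j")
        case False
        have "R < \<bar>s - real i * ?p\<bar>" using bump_separation[OF False, of n] s n by linarith
        then show ?thesis using False g_support by (simp add: bump_def)
      qed simp
    qed
    finally show ?thesis .
  next
    case False
    have "rank_one t (act s (pt n)) = 0"
    proof (rule ccontr)
      assume nz: "rank_one t (act s (pt n)) \<noteq> 0"
      then have "g (act s (pt n) $ 2) \<noteq> 0" and 3: "\<bar>act s (pt n) $ 3\<bar> < 1"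
        by (auto simp: rank_one_def max_def split: if_splits)
      then have 2: "\<bar>act s (pt n) $ 2\<bar> \<le> R" using g_support not_less by blast
      obtain j y where "j \<le> L n" "\<bar>y\<bar> \<le> R" "s = y + real j * ?p"
        using orbit_cases[OF n(1) R_nonneg 2 3] by blast
      then show False using False by auto
    qed
    moreover have "bump n j s = 0" if "j \<le> L n" for j
      using False that g_support[of "s - real j * ?p"] by (force simp: bump_def)
    ultimately show ?thesis by simp
  qed
qed

lemma bump_bounded: "\<exists>c. \<forall>n j s. cmod (bump n j s) \<le> c"
  using continuous_compact_support_bounded[OF g_continuous g_support] unfolding bump_def by meson

lemma mc_rank_one:
  assumes n: "R + 1 < real n" "b n 0 \<le> 1" and \<eta>: "\<eta> \<in> hcarrier L2R"
  shows "mc (pt n) rank_one \<eta> \<eta> = of_real (\<Sum>j\<in>{..L n}. (cmod (hinner L2R \<eta> (l2_class (bump n j))))\<^sup>2)"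
proof -
  obtain v where v: "square_integrable v" "\<eta> = l2_class v" using \<eta> by (auto simp: hcarrier_L2R)
  obtain c where c: "\<And>n j s. cmod (bump n j s) \<le> c" using bump_bounded by blast
  show ?thesis unfolding v(2)
    by (rule mc_rank_one_sum[OF pt_in rank_one_Cc _ _ c v(1) rank_one_orbit[OF n]]) auto
qed

lemma mc_rank_one_0:
  assumes \<eta>: "\<eta> \<in> hcarrier L2R"
  shows "mc (pt 0) rank_one \<eta> \<eta> = of_real ((cmod (hinner L2R \<eta> (l2_class g)))\<^sup>2)"
proof -
  obtain v where v: "square_integrable v" "\<eta> = l2_class v" using \<eta> by (auto simp: hcarrier_L2R)
  obtain c where c: "\<And>s. cmod (g s) \<le> c"
    using continuous_compact_support_bounded[OF g_continuous g_support] by blast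
  \<comment> \<open>The orbit of x_0 passes through the region once, so it is a family with a single
    index; both cutoffs are 1 all along it.\<close>
  have "rank_one t (act s (pt 0)) = (\<Sum>j\<in>{0::nat}. g s * cnj (g (s - t)))" for s t
    using rank_one_segment[OF act_pt_in act_pt_0, of t s] by simp
  from mc_rank_one_sum[OF pt_in rank_one_Cc _ _ _ v(1) this, of c]
  show ?thesis using c unfolding v(2) by simp
qed

end

section \<open>The lower and upper bounds for the multiplicities\<close>

context rieffel
begin

lemma Vec_Ind_eps: "\<eta> \<in> Vec (Ind_eps act x) \<phi> N \<longleftrightarrow> \<eta> \<in> hcarrier L2R \<and> hnorm L2R \<eta> = 1 \<and>
    (\<lambda>a. vector_functional (Ind_eps act x) \<eta> a - \<phi> a) \<in> N"
  by (simp add: Vec_def Ind_eps_def)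

lemma d_mult_Ind_eps: "d_mult (Ind_eps act x) \<phi> N =
    (SUP E\<in>{E. finite E \<and> E \<subseteq> Vec (Ind_eps act x) \<phi> N \<and> orthonormal L2R E}. enat (card E))"
  by (simp add: d_mult_def Ind_eps_def)

context
  fixes \<phi> \<xi>
  assumes dual: "\<phi> \<in> dual_space A" and \<xi>: "\<xi> \<in> hcarrier L2R" "hnorm L2R \<xi> = 1"
    and \<phi>: "\<And>a. a \<in> acarrier A \<Longrightarrow> \<phi> a = vector_functional (Ind_eps act (pt 0)) \<xi> a"
begin

text \<open>The bumps give \<open>L n + 1\<close> distinct orthonormal vectors, and each has its
  vector state in the given neighbourhood once n is large, because the approximation in
  \<open>mc_bump_approx\<close> is uniform in j.\<close>

lemma eventually_d_mult_ge:
  assumes N: "N \<in> weak_star_base A"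
  shows "\<forall>\<^sub>F n in sequentially. enat (L n + 1) \<le> d_mult (Ind_eps act (pt n)) \<phi> N"
proof -
  obtain S e where S: "finite S" "S \<subseteq> acarrier A" "0 < e"
    and N_eq: "N = {\<psi> \<in> dual_space A. \<forall>a\<in>S. cmod (\<psi> a) < e}"
    using N unfolding weak_star_base_def by blast
  \<comment> \<open>Four errors are added: algebra element to function at x_n, x_n to x_0,
    approximating vector to \<open>\<xi>\<close>, and function back to algebra element at x_0. The
    fifth share makes the final inequality strict.\<close>
  define e' where "e' = e / 5"
  have e': "e' > 0" using S(3) by (simp add: e'_def)
  have "\<forall>a\<in>S. \<exists>f. f \<in> Cc X \<and> (\<forall>x\<in>X. \<forall>\<eta>\<in>hcarrier L2R. hnorm L2R \<eta> = 1 \<longrightarrow>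
    cmod (vector_functional (Ind_eps act x) \<eta> a - mc x f \<eta> \<eta>) \<le> e')"
    using vector_functional_approx[OF _ e'] S(2) by blast
  then obtain f where f: "\<And>a. a \<in> S \<Longrightarrow> f a \<in> Cc X"
    "\<And>a x \<eta>. a \<in> S \<Longrightarrow> x \<in> X \<Longrightarrow> \<eta> \<in> hcarrier L2R \<Longrightarrow> hnorm L2R \<eta> = 1 \<Longrightarrow>
      cmod (vector_functional (Ind_eps act x) \<eta> a - mc x (f a) \<eta> \<eta>) \<le> e'"
    using bchoice[of S] by metis
  have "\<forall>k :: nat. \<exists>g r. continuous_on UNIV g \<and> 0 \<le> r \<and> (\<forall>s. r < \<bar>s\<bar> \<longrightarrow> g s = 0) \<and>
    hnorm L2R (l2_class g) = 1 \<and> hdist L2R \<xi> (l2_class g) < inverse (real (Suc k))"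
    by (intro allI L2R_dense_unit[OF \<xi>]) simp
  then obtain G r where G: "\<And>k :: nat. continuous_on UNIV (G k)" "\<And>k. 0 \<le> r k" "\<And>k s. r k < \<bar>s\<bar> \<Longrightarrow> G k s = 0"
    "\<And>k. hnorm L2R (l2_class (G k)) = 1" "\<And>k. hdist L2R \<xi> (l2_class (G k)) < inverse (real (Suc k))"
    by metis
  have GC: "l2_class (G k) \<in> hcarrier L2R" for k
    using square_integrable_continuous_compact_support[OF G(1,3)] by simp
  \<comment> \<open>The closeness required of the approximating vector depends on the bounds M and T
    of each \<open>f a\<close>. A whole sequence \<open>G\<close> with error 1 / (k + 1) lets one k
    be chosen for all of the finite set S.\<close>
  have "\<forall>\<^sub>F k in sequentially. \<forall>a\<in>S. cmod (mc (pt 0) (f a) \<xi> \<xi> - mc (pt 0) (f a) (l2_class (G k)) (l2_class (G k))) < e'"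
  proof (intro eventually_ball_finite S(1) ballI)
    fix a assume a: "a \<in> S"
    obtain M T where M: "0 \<le> M" "0 \<le> T" "\<And>t p. cmod (f a t p) \<le> M * indicator {-T..T} t"
      using Cc_bounds[OF f(1)[OF a]] by blast
    have "(\<lambda>k. M * (inverse (real (Suc k)) * (1 + 1)) * (2 * T)) \<longlonglongrightarrow> M * (0 * (1 + 1)) * (2 * T)"
      by (intro tendsto_intros LIMSEQ_inverse_real_of_nat)
    then have "\<forall>\<^sub>F k in sequentially. M * (inverse (real (Suc k)) * (1 + 1)) * (2 * T) < e'"
      by (rule order_tendstoD(2)) (use e' in simp)
    then show "\<forall>\<^sub>F k in sequentially. cmod (mc (pt 0) (f a) \<xi> \<xi> - mc (pt 0) (f a) (l2_class (G k)) (l2_class (G k))) < e'"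
    proof eventually_elim
      case (elim k)
      have "cmod (mc (pt 0) (f a) \<xi> \<xi> - mc (pt 0) (f a) (l2_class (G k)) (l2_class (G k)))
        \<le> M * (hdist L2R \<xi> (l2_class (G k)) * (hnorm L2R \<xi> + hnorm L2R (l2_class (G k)))) * (2 * T)"
        by (rule covariant.mcoef_vector_diff_bound[OF covariant_regular[OF pt_in] f(1)[OF a] M(3,2) \<xi>(1) GC])
      also have "\<dots> \<le> M * (inverse (real (Suc k)) * (1 + 1)) * (2 * T)"
        unfolding \<xi>(2) G(4) using M G(5)[of k] by (intro mult_right_mono mult_left_mono) auto
      finally show ?case using elim by simp
    qed
  qed
  then obtain k where k: "\<And>a. a \<in> S \<Longrightarrow>
      cmod (mc (pt 0) (f a) \<xi> \<xi> - mc (pt 0) (f a) (l2_class (G k)) (l2_class (G k))) < e'"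
    by (auto simp: eventually_sequentially)
  interpret rieffel_bump X act b L "G k" "r k"
    by unfold_locales (use G in auto)
  have "\<forall>\<^sub>F n in sequentially. \<forall>a\<in>S. \<forall>j\<le>L n. cmod (mc (pt n) (f a) (l2_class (bump n j)) (l2_class (bump n j))
    - mc (pt 0) (f a) (l2_class (G k)) (l2_class (G k))) \<le> e'"
    by (intro eventually_ball_finite S(1) ballI mc_bump_approx f(1) e')
  moreover have "\<forall>\<^sub>F n in sequentially. r k < real n"
    using filterlim_real_sequentially unfolding filterlim_at_top_dense by blast
  ultimately show ?thesis
  proof eventually_elim
    case (elim n)
    let ?\<eta> = "\<lambda>j. l2_class (bump n j)"
    note orth = orthonormal_family[of "{..L n}" L2R ?\<eta>, OF bump_orthonormal[OF elim(2)]]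
    have norm1: "hnorm L2R (?\<eta> j) = 1" for j
      using bump_orthonormal[OF elim(2), of j j] by (simp add: hnorm_def)
    have "?\<eta> j \<in> Vec (Ind_eps act (pt n)) \<phi> N" if j: "j \<le> L n" for j
      unfolding Vec_Ind_eps N_eq
    proof (intro conjI CollectI ballI)
      show \<eta>C: "?\<eta> j \<in> hcarrier L2R" by simp
      show "(\<lambda>a. vector_functional (Ind_eps act (pt n)) (?\<eta> j) a - \<phi> a) \<in> dual_space A"
        by (intro dual_space_diff vector_functional_dual pt_in \<eta>C norm1 dual)
      fix a assume a: "a \<in> S"
      have 1: "cmod (vector_functional (Ind_eps act (pt n)) (?\<eta> j) a - mc (pt n) (f a) (?\<eta> j) (?\<eta> j)) \<le> e'"
        by (rule f(2)[OF a pt_in \<eta>C norm1])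
      have 2: "cmod (\<phi> a - mc (pt 0) (f a) \<xi> \<xi>) \<le> e'"
        using f(2)[OF a pt_in \<xi>] \<phi>[of a] a S(2) by auto
      have 3: "cmod (mc (pt n) (f a) (?\<eta> j) (?\<eta> j) - mc (pt 0) (f a) (l2_class (G k)) (l2_class (G k))) \<le> e'"
        using elim(1) a j by blast
      have "cmod (vector_functional (Ind_eps act (pt n)) (?\<eta> j) a - \<phi> a) \<le> 4 * e'"
        using 1 2 3 k[OF a] by norm
      also have "\<dots> < e" using S(3) by (simp add: e'_def)
      finally show "cmod (vector_functional (Ind_eps act (pt n)) (?\<eta> j) a - \<phi> a) < e" .
    qed (rule norm1)
    then have "?\<eta> ` {..L n} \<in> {E. finite E \<and> E \<subseteq> Vec (Ind_eps act (pt n)) \<phi> N \<and> orthonormal L2R E}"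
      using orth(2) by auto
    moreover have "card (?\<eta> ` {..L n}) = L n + 1" using card_image[OF orth(1)] by simp
    ultimately show "enat (L n + 1) \<le> d_mult (Ind_eps act (pt n)) \<phi> N"
      unfolding d_mult_Ind_eps by (metis (no_types, lifting) SUP_upper)
  qed
qed

text \<open>For orthonormal \<open>\<eta>\<^sub>i\<close> in \<open>Vec\<close>, Bessel's inequality for the vectors \<open>bump n j\<close> bounds
  \<open>\<Sum>\<^sub>i \<langle>\<pi>\<^sub>n(f) \<eta>\<^sub>i, \<eta>\<^sub>i\<rangle>\<close> by \<open>L n + 1\<close>, while each summand exceeds \<open>1 - 2 \<delta>\<close>.\<close>

lemma eventually_d_mult_le:
  obtains N where "N \<in> weak_star_base A"
    "\<forall>\<^sub>F n in sequentially. L n + 1 \<le> K \<longrightarrow> d_mult (Ind_eps act (pt n)) \<phi> N \<le> enat (L n + 1)"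
proof -
  \<comment> \<open>If L + 2 orthonormal vectors existed, with L + 1 <= K, then (L + 2) (1 - 2
    delta) <= L + 1, so 1 <= 2 delta (L + 2) <= 2 delta (K + 1) = 1 / 2. The bound delta <= 1 / 4
    keeps 1 - 2 delta positive.\<close>
  define \<delta> where "\<delta> = 1 / (4 * (real K + 1))"
  have \<delta>: "0 < \<delta>" "\<delta> \<le> 1 / 4" by (auto simp: \<delta>_def field_simps)
  obtain g R where g: "continuous_on UNIV g" "0 \<le> R" "\<forall>s. R < \<bar>s\<bar> \<longrightarrow> g s = 0"
    "hnorm L2R (l2_class g) = 1" "hdist L2R \<xi> (l2_class g) < \<delta> / 2"
    using L2R_dense_unit[OF \<xi>, of "\<delta> / 2"] \<delta>(1) by auto
  interpret rieffel_bump X act b L g R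
    by unfold_locales (use g in auto)
  let ?a = "embed rank_one"
  have aA: "?a \<in> acarrier A" by (rule embed_closed[OF rank_one_Cc])
  define N where "N = {\<psi> \<in> dual_space A. \<forall>a\<in>{?a}. cmod (\<psi> a) < \<delta>}"
  have N: "N \<in> weak_star_base A"
    unfolding weak_star_base_def N_def using aA \<delta>(1) by blast
  define w where "w = cmod (hinner L2R \<xi> (l2_class g))"
  have \<phi>a: "\<phi> ?a = of_real (w\<^sup>2)"
    using \<phi>[OF aA] vector_functional_embed[OF pt_in rank_one_Cc \<xi>, of 0] mc_rank_one_0[OF \<xi>(1)]
    by (simp add: w_def)
  \<comment> \<open>The unit vector of the state need not be \<open>g\<close>, so the value of the
    state at the test element is w^2 rather than 1. Distance below delta / 2 costs delta after
    squaring; the neighbourhood N costs the second delta.\<close>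
  have "cmod (hinner L2R \<xi> \<xi> - hinner L2R \<xi> (l2_class g)) \<le> \<delta> / 2"
    using L2R.inner_diff_bound[of \<xi> \<xi> \<xi> "l2_class g"] \<xi> g(5) L2R.hdist_zero[of \<xi> \<xi>] by simp
  moreover have "hinner L2R \<xi> \<xi> = 1" using \<xi> by (simp add: L2R.inner_self)
  ultimately have "1 - \<delta> / 2 \<le> w"
    unfolding w_def using norm_triangle_ineq2[of 1 "hinner L2R \<xi> (l2_class g)"] by simp
  then have "(1 - \<delta> / 2)\<^sup>2 \<le> w\<^sup>2" using \<delta> by (intro power_mono) auto
  moreover have "1 - \<delta> \<le> (1 - \<delta> / 2)\<^sup>2" by (simp add: power2_diff)
  ultimately have w: "1 - \<delta> \<le> w\<^sup>2" by linarith
  have "\<forall>\<^sub>F n in sequentially. b n 0 < 1"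
    using order_tendstoD(2)[OF b_tendsto, of 1] by simp
  moreover have "\<forall>\<^sub>F n in sequentially. R + 1 < real n"
    using filterlim_real_sequentially unfolding filterlim_at_top_dense by blast
  ultimately have "\<forall>\<^sub>F n in sequentially. L n + 1 \<le> K \<longrightarrow> d_mult (Ind_eps act (pt n)) \<phi> N \<le> enat (L n + 1)"
  proof eventually_elim
    case (elim n)
    show ?case
      unfolding d_mult_Ind_eps
    proof (intro impI SUP_least)
      fix E assume K: "L n + 1 \<le> K"
        and "E \<in> {E. finite E \<and> E \<subseteq> Vec (Ind_eps act (pt n)) \<phi> N \<and> orthonormal L2R E}"
      then have E: "finite E" "E \<subseteq> Vec (Ind_eps act (pt n)) \<phi> N" "orthonormal L2R E" by auto
      have EC: "E \<subseteq> hcarrier L2R" using E(2) by (auto simp: Vec_Ind_eps)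
      let ?m = "\<lambda>\<eta>. \<Sum>j\<in>{..L n}. (cmod (hinner L2R \<eta> (l2_class (bump n j))))\<^sup>2"
      have "1 - 2 * \<delta> \<le> ?m \<eta>" if \<eta>: "\<eta> \<in> E" for \<eta>
      proof -
        have \<eta>': "\<eta> \<in> hcarrier L2R" "hnorm L2R \<eta> = 1"
          and c: "cmod (vector_functional (Ind_eps act (pt n)) \<eta> ?a - \<phi> ?a) < \<delta>"
          using E(2) \<eta> by (auto simp: Vec_Ind_eps N_def)
        have "vector_functional (Ind_eps act (pt n)) \<eta> ?a = of_real (?m \<eta>)"
          using vector_functional_embed[OF pt_in rank_one_Cc \<eta>', of n] mc_rank_one[OF elim(2) _ \<eta>'(1)] elim(1)
          by simp
        then have "cmod (of_real (?m \<eta> - w\<^sup>2)) < \<delta>" using c \<phi>a by simp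
        then have "\<bar>?m \<eta> - w\<^sup>2\<bar> < \<delta>" by (simp only: norm_of_real)
        then show ?thesis using w by linarith
      qed
      then have "(\<Sum>\<eta>\<in>E. 1 - 2 * \<delta>) \<le> (\<Sum>\<eta>\<in>E. ?m \<eta>)" by (intro sum_mono)
      also have "\<dots> = (\<Sum>j\<in>{..L n}. \<Sum>\<eta>\<in>E. (cmod (hinner L2R \<eta> (l2_class (bump n j))))\<^sup>2)"
        by (rule sum.swap)
      also have "\<dots> \<le> (\<Sum>j\<in>{..L n}. 1)"
      proof (rule sum_mono)
        fix j
        have "(\<Sum>\<eta>\<in>E. (cmod (hinner L2R \<eta> (l2_class (bump n j))))\<^sup>2)
          = (\<Sum>\<eta>\<in>E. (cmod (hinner L2R (l2_class (bump n j)) \<eta>))\<^sup>2)"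
          using EC by (intro sum.cong refl) (auto simp: L2R.inner_cnj[of "l2_class (bump n j)"])
        also have "\<dots> \<le> (hnorm L2R (l2_class (bump n j)))\<^sup>2"
          by (rule L2R.Bessel[OF E(1) EC E(3)]) simp
        also have "\<dots> = 1"
          using bump_orthonormal[of n j j] elim(2) by (simp add: hnorm_def)
        finally show "(\<Sum>\<eta>\<in>E. (cmod (hinner L2R \<eta> (l2_class (bump n j))))\<^sup>2) \<le> 1" .
      qed
      finally have card: "real (card E) * (1 - 2 * \<delta>) \<le> real (L n + 1)" by simp
      have "card E \<le> L n + 1"
      proof (rule ccontr)
        assume "\<not> card E \<le> L n + 1"
        then have "real (L n + 2) * (1 - 2 * \<delta>) \<le> real (card E) * (1 - 2 * \<delta>)"
          using \<delta> by (intro mult_right_mono) auto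
        with card have "1 \<le> 2 * \<delta> * real (L n + 2)" by (simp add: algebra_simps)
        also have "\<dots> \<le> 2 * \<delta> * (real K + 1)" using K \<delta> by (intro mult_left_mono) auto
        also have "\<dots> = 1 / 2" by (simp add: \<delta>_def field_simps)
        finally show False by simp
      qed
      then show "enat (card E) \<le> enat (L n + 1)" by simp
    qed
  qed
  with N show ?thesis using that by blast
qed

text \<open>For a finite liminf K use the neighbourhood belonging to K. If the multiplicities were
  eventually above K, no large n could have \<open>L n + 1 \<le> K\<close>, since there the
  multiplicity is at most \<open>L n + 1\<close>; so the liminf would be at least K + 1. Indices are
  \<open>Suc n\<close> because the sequence starts at 1.\<close>

lemma M_L_eq: "M_L A \<phi> sequentially (\<lambda>n. Ind_eps act (pt (Suc n))) = liminf (\<lambda>n. enat (L (Suc n) + 1))"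
  (is "_ = ?l")
proof (rule antisym)
  show "?l \<le> M_L A \<phi> sequentially (\<lambda>n. Ind_eps act (pt (Suc n)))"
    unfolding M_L_def
  proof (intro INF_greatest Liminf_mono)
    fix N assume "N \<in> weak_star_base A"
    from eventually_d_mult_ge[OF this]
    show "\<forall>\<^sub>F n in sequentially. enat (L (Suc n) + 1) \<le> d_mult (Ind_eps act (pt (Suc n))) \<phi> N"
      by (rule eventually_sequentially_Suc[THEN iffD2])
  qed
  show "M_L A \<phi> sequentially (\<lambda>n. Ind_eps act (pt (Suc n))) \<le> ?l"
  proof (cases ?l)
    case (enat K)
    obtain N where N: "N \<in> weak_star_base A"
      "\<forall>\<^sub>F n in sequentially. L n + 1 \<le> K \<longrightarrow> d_mult (Ind_eps act (pt n)) \<phi> N \<le> enat (L n + 1)"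
      using eventually_d_mult_le by blast
    have N': "\<forall>\<^sub>F n in sequentially. L (Suc n) + 1 \<le> K \<longrightarrow>
        d_mult (Ind_eps act (pt (Suc n))) \<phi> N \<le> enat (L (Suc n) + 1)"
      using N(2) by (subst eventually_sequentially_Suc)
    have "liminf (\<lambda>n. d_mult (Ind_eps act (pt (Suc n))) \<phi> N) \<le> ?l"
    proof (rule ccontr)
      assume "\<not> ?thesis"
      then have "enat K < liminf (\<lambda>n. d_mult (Ind_eps act (pt (Suc n))) \<phi> N)" by (simp only: enat not_le)
      then have "\<forall>\<^sub>F n in sequentially. enat K < d_mult (Ind_eps act (pt (Suc n))) \<phi> N"
        by (rule less_LiminfD)
      with N' have "\<forall>\<^sub>F n in sequentially. enat (K + 1) \<le> enat (L (Suc n) + 1)"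
      proof eventually_elim
        case (elim n)
        show ?case
        proof (rule ccontr)
          assume "\<not> ?case"
          then have "L (Suc n) + 1 \<le> K" by simp
          then have "enat K < enat (L (Suc n) + 1)" using elim less_le_trans by blast
          with \<open>L (Suc n) + 1 \<le> K\<close> show False by simp
        qed
      qed
      then have "enat (K + 1) \<le> ?l" by (rule Liminf_bounded)
      then show False unfolding enat by simp
    qed
    then show ?thesis unfolding M_L_def by (intro INF_lower2[OF N(1)])
  qed simp
qed

text \<open>Here the restriction in the upper bound disappears: a finite limsup K forces
  \<open>L (Suc n) + 1 \<le> K\<close> for all large n, so the neighbourhood belonging to K bounds
  the multiplicities eventually.\<close>

lemma M_U_eq: "M_U A \<phi> sequentially (\<lambda>n. Ind_eps act (pt (Suc n))) = limsup (\<lambda>n. enat (L (Suc n) + 1))"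
  (is "_ = ?l")
proof (rule antisym)
  show "?l \<le> M_U A \<phi> sequentially (\<lambda>n. Ind_eps act (pt (Suc n)))"
    unfolding M_U_def
  proof (intro INF_greatest Limsup_mono)
    fix N assume "N \<in> weak_star_base A"
    from eventually_d_mult_ge[OF this]
    show "\<forall>\<^sub>F n in sequentially. enat (L (Suc n) + 1) \<le> d_mult (Ind_eps act (pt (Suc n))) \<phi> N"
      by (rule eventually_sequentially_Suc[THEN iffD2])
  qed
  show "M_U A \<phi> sequentially (\<lambda>n. Ind_eps act (pt (Suc n))) \<le> ?l"
  proof (cases ?l)
    case (enat K)
    obtain N where N: "N \<in> weak_star_base A"
      "\<forall>\<^sub>F n in sequentially. L n + 1 \<le> K \<longrightarrow> d_mult (Ind_eps act (pt n)) \<phi> N \<le> enat (L n + 1)"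
      using eventually_d_mult_le by blast
    have N': "\<forall>\<^sub>F n in sequentially. L (Suc n) + 1 \<le> K \<longrightarrow>
        d_mult (Ind_eps act (pt (Suc n))) \<phi> N \<le> enat (L (Suc n) + 1)"
      using N(2) by (subst eventually_sequentially_Suc)
    have "?l < enat (K + 1)" unfolding enat by simp
    then have "\<forall>\<^sub>F n in sequentially. enat (L (Suc n) + 1) < enat (K + 1)" by (rule Limsup_lessD)
    with N' have "\<forall>\<^sub>F n in sequentially. d_mult (Ind_eps act (pt (Suc n))) \<phi> N \<le> enat (L (Suc n) + 1)"
      by eventually_elim simp
    then have "limsup (\<lambda>n. d_mult (Ind_eps act (pt (Suc n))) \<phi> N) \<le> ?l" by (rule Limsup_mono)
    then show ?thesis unfolding M_U_def by (intro INF_lower2[OF N(1)])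
  qed simp
qed

end

end

theorem lemma6p2:
  fixes X :: "(real ^ 3) set"
    and act :: "real \<Rightarrow> real ^ 3 \<Rightarrow> real ^ 3"
    and b :: "nat \<Rightarrow> nat \<Rightarrow> real"
    and L :: "nat \<Rightarrow> nat"
    and \<phi> :: "(nat \<Rightarrow> real \<Rightarrow> real ^ 3 \<Rightarrow> complex) set \<Rightarrow> complex"
  assumes "rieffel_group X act b L"
    and "associated_pure_state (crossed_product X act) (Ind_eps act (rieffel_point b 0)) \<phi>"
  shows "M_L (crossed_product X act) \<phi> sequentially
           (\<lambda>n. Ind_eps act (rieffel_point b (Suc n))) = liminf (\<lambda>n. enat (L (Suc n) + 1))
       \<and> M_U (crossed_product X act) \<phi> sequentially
           (\<lambda>n. Ind_eps act (rieffel_point b (Suc n))) = limsup (\<lambda>n. enat (L (Suc n) + 1))"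
proof -
  interpret rieffel X act b L by (rule rieffel.intro[OF assms(1)])
  obtain \<xi> where \<xi>: "\<xi> \<in> hcarrier L2R" "hnorm L2R \<xi> = 1"
    "\<And>a. a \<in> acarrier A \<Longrightarrow> \<phi> a = vector_functional (Ind_eps act (pt 0)) \<xi> a"
    using assms(2) by (auto simp: associated_pure_state_def Ind_eps_def)
  have dual: "\<phi> \<in> dual_space A"
    using assms(2) by (simp add: associated_pure_state_def pure_state_def state_def)
  show ?thesis using M_L_eq[OF dual \<xi>] M_U_eq[OF dual \<xi>] by blast
qed

end
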